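(* Let $\kappa$ be an infinite cardinal and let $M$ be a first-order structure whose complete theory $T=\mathrm{Th}(M)$ is NIP. Let $k\geq 1$ and let $X\subseteq M^k$ be an externally definable set with $|X|\geq\kappa^+$. Then $X$ contains an $M$-definable subset of cardinality $\geq\kappa$.
   Context: A set $X\subseteq M^k$ is $M$-definable if $X=\phi(M)$ for some formula $\phi(x)$ with parameters from $M$. It is externally definable if there exist an elementary extension $N\succ M$ and a formula $\psi(x)$ with parameters from $N$ such that $X=\{a\in M^k : N\models\psi(a)\}$. A partitioned formula $\phi(x,y)$ is NIP if in some (equivalently every) model $M$ of $T$ there is $n<\omega$ such that no subset of $M^x$ of size $n$ is shattered by the family $\{\phi(M^x,b): b\in M^y\}$ (a set $A$ is shattered by a family $\mathcal F$ if for every $S\subseteq A$ there is $F\in\mathcal F$ with $F\cap A=S$); $T$ is NIP if every formula is NIP. *)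

theory Defs
  imports Main
begin

unbundle cardinal_syntax

text \<open>
  A symbol of a signature is a name together with an arity, so the same name at two arities counts
  as two symbols. Constants are function symbols of arity 0. Both sets may be empty, finite, or of
  any cardinality.
\<close>

record ('f, 'r) signature =
  funs :: "('f \<times> nat) set"
  rels :: "('r \<times> nat) set"

datatype 'f trm = Var nat | Fn 'f "'f trm list"

datatype ('f, 'r) fm =
    Bot
  | Eq "'f trm" "'f trm"
  | Rel 'r "'f trm list"
  | Neg "('f, 'r) fm"
  | Conj "('f, 'r) fm" "('f, 'r) fm"
  | Exists nat "('f, 'r) fm"

fun wf_trm :: "('f, 'r) signature \<Rightarrow> 'f trm \<Rightarrow> bool" where
  "wf_trm L (Var i) \<longleftrightarrow> True"
| "wf_trm L (Fn f ts) \<longleftrightarrow> (f, length ts) \<in> funs L \<and> (\<forall>t \<in> set ts. wf_trm L t)"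

fun wf_fm :: "('f, 'r) signature \<Rightarrow> ('f, 'r) fm \<Rightarrow> bool" where
  "wf_fm L Bot \<longleftrightarrow> True"
| "wf_fm L (Eq s t) \<longleftrightarrow> wf_trm L s \<and> wf_trm L t"
| "wf_fm L (Rel r ts) \<longleftrightarrow> (r, length ts) \<in> rels L \<and> (\<forall>t \<in> set ts. wf_trm L t)"
| "wf_fm L (Neg \<phi>) \<longleftrightarrow> wf_fm L \<phi>"
| "wf_fm L (Conj \<phi> \<psi>) \<longleftrightarrow> wf_fm L \<phi> \<and> wf_fm L \<psi>"
| "wf_fm L (Exists i \<phi>) \<longleftrightarrow> wf_fm L \<phi>"

fun fv_trm :: "'f trm \<Rightarrow> nat set" where
  "fv_trm (Var i) = {i}"
| "fv_trm (Fn f ts) = (\<Union>t \<in> set ts. fv_trm t)"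

fun fv :: "('f, 'r) fm \<Rightarrow> nat set" where
  "fv Bot = {}"
| "fv (Eq s t) = fv_trm s \<union> fv_trm t"
| "fv (Rel r ts) = (\<Union>t \<in> set ts. fv_trm t)"
| "fv (Neg \<phi>) = fv \<phi>"
| "fv (Conj \<phi> \<psi>) = fv \<phi> \<union> fv \<psi>"
| "fv (Exists i \<phi>) = fv \<phi> - {i}"

record ('f, 'r, 'a) struct =
  univ :: "'a set"
  fun_int :: "'f \<Rightarrow> 'a list \<Rightarrow> 'a"
  rel_int :: "'r \<Rightarrow> 'a list \<Rightarrow> bool"

definition tuples :: "nat \<Rightarrow> 'a set \<Rightarrow> 'a list set" where
  "tuples n A = {xs. length xs = n \<and> set xs \<subseteq> A}"

definition is_struct :: "('f, 'r) signature \<Rightarrow> ('f, 'r, 'a) struct \<Rightarrow> bool" where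
  "is_struct L M \<longleftrightarrow> univ M \<noteq> {} \<and>
     (\<forall>(f, n) \<in> funs L. \<forall>xs \<in> tuples n (univ M). fun_int M f xs \<in> univ M)"

fun eval :: "('f, 'r, 'a) struct \<Rightarrow> (nat \<Rightarrow> 'a) \<Rightarrow> 'f trm \<Rightarrow> 'a" where
  "eval M v (Var i) = v i"
| "eval M v (Fn f ts) = fun_int M f (map (eval M v) ts)"

fun sat :: "('f, 'r, 'a) struct \<Rightarrow> (nat \<Rightarrow> 'a) \<Rightarrow> ('f, 'r) fm \<Rightarrow> bool" where
  "sat M v Bot \<longleftrightarrow> False"
| "sat M v (Eq s t) \<longleftrightarrow> eval M v s = eval M v t"
| "sat M v (Rel r ts) \<longleftrightarrow> rel_int M r (map (eval M v) ts)"
| "sat M v (Neg \<phi>) \<longleftrightarrow> \<not> sat M v \<phi>"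
| "sat M v (Conj \<phi> \<psi>) \<longleftrightarrow> sat M v \<phi> \<and> sat M v \<psi>"
| "sat M v (Exists i \<phi>) \<longleftrightarrow> (\<exists>a \<in> univ M. sat M (v(i := a)) \<phi>)"

definition Th :: "('f, 'r) signature \<Rightarrow> ('f, 'r, 'a) struct \<Rightarrow> ('f, 'r) fm set" where
  "Th L M = {\<phi>. wf_fm L \<phi> \<and> fv \<phi> = {} \<and> (\<forall>v. range v \<subseteq> univ M \<longrightarrow> sat M v \<phi>)}"

definition is_model :: "('f, 'r) signature \<Rightarrow> ('f, 'r) fm set \<Rightarrow> ('f, 'r, 'a) struct \<Rightarrow> bool" where
  "is_model L T M \<longleftrightarrow> is_struct L M \<and> T \<subseteq> Th L M"

text \<open>
  A formula in the variables \<open>x\<^sub>0, \<dots>, x\<^sub>p\<^sub>-\<^sub>1, y\<^sub>0, \<dots>, y\<^sub>q\<^sub>-\<^sub>1\<close> is a formula with free variables among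
  the indices below \<open>p + q\<close>, the first \<open>p\<close> of them being the \<open>x\<close>-variables. It is evaluated at tuples
  \<open>a\<close>, \<open>b\<close> of lengths \<open>p\<close>, \<open>q\<close> by the valuation \<open>nth (a @ b)\<close>; the unspecified values of \<open>nth\<close> beyond
  the end of the list only affect variables that are not free.
\<close>

definition definable ::
  "('f, 'r) signature \<Rightarrow> ('f, 'r, 'a) struct \<Rightarrow> nat \<Rightarrow> 'a list set \<Rightarrow> bool" where
  "definable L M k X \<longleftrightarrow>
     (\<exists>\<phi> q. \<exists>b \<in> tuples q (univ M). wf_fm L \<phi> \<and> fv \<phi> \<subseteq> {..<k + q} \<and>
        X = {a \<in> tuples k (univ M). sat M (nth (a @ b)) \<phi>})"

definition elementary_embedding ::
  "('f, 'r) signature \<Rightarrow> ('a \<Rightarrow> 'b) \<Rightarrow> ('f, 'r, 'a) struct \<Rightarrow> ('f, 'r, 'b) struct \<Rightarrow> bool" where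
  "elementary_embedding L e M N \<longleftrightarrow> e ` univ M \<subseteq> univ N \<and>
     (\<forall>\<phi> v. wf_fm L \<phi> \<and> range v \<subseteq> univ M \<longrightarrow> (sat M v \<phi> \<longleftrightarrow> sat N (e \<circ> v) \<phi>))"

text \<open>
  HOL cannot quantify over the type carrying the elementary extension \<open>N\<close>, so that type is passed
  as an argument. In a theorem that assumes external definability, \<open>'b\<close> is a type variable occurring
  in this assumption only, and its implicit universal quantification is the quantification over all
  elementary extensions. As \<open>N\<close> and \<open>M\<close> may live in different types, \<open>M\<close> is identified with an
  elementary substructure of \<open>N\<close> along \<open>e\<close>; for \<open>'b = 'a\<close> and \<open>e = id\<close> this is literal inclusion.
\<close>

definition externally_definable ::
  "'b itself \<Rightarrow> ('f, 'r) signature \<Rightarrow> ('f, 'r, 'a) struct \<Rightarrow> nat \<Rightarrow> 'a list set \<Rightarrow> bool" where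
  "externally_definable (_ :: 'b itself) L M k X \<longleftrightarrow>
     (\<exists>(N :: ('f, 'r, 'b) struct) e. is_struct L N \<and> elementary_embedding L e M N \<and>
        (\<exists>\<psi> q. \<exists>c \<in> tuples q (univ N). wf_fm L \<psi> \<and> fv \<psi> \<subseteq> {..<k + q} \<and>
           X = {a \<in> tuples k (univ M). sat N (nth (map e a @ c)) \<psi>}))"

definition shattered :: "'a set \<Rightarrow> 'a set set \<Rightarrow> bool" where
  "shattered A F \<longleftrightarrow> (\<forall>S \<subseteq> A. \<exists>B \<in> F. B \<inter> A = S)"

definition instances :: "('f, 'r, 'a) struct \<Rightarrow> nat \<Rightarrow> nat \<Rightarrow> ('f, 'r) fm \<Rightarrow> 'a list set set" where
  "instances M p q \<phi> = {{a \<in> tuples p (univ M). sat M (nth (a @ b)) \<phi>} |b. b \<in> tuples q (univ M)}"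

text \<open>
  NIP asks for a bound in \<^emph>\<open>some\<close> model of \<open>T\<close>, taken here with elements in the type \<open>'a\<close>. For complete
  \<open>T\<close> the choice of the model is immaterial, hence so is that of \<open>'a\<close>, as long as \<open>T\<close> has a model
  in \<open>'a\<close>.
\<close>

definition NIP_formula ::
  "'a itself \<Rightarrow> ('f, 'r) signature \<Rightarrow> ('f, 'r) fm set \<Rightarrow> nat \<Rightarrow> nat \<Rightarrow> ('f, 'r) fm \<Rightarrow> bool" where
  "NIP_formula (_ :: 'a itself) L T p q \<phi> \<longleftrightarrow>
     (\<exists>M :: ('f, 'r, 'a) struct. is_model L T M \<and>
        (\<exists>n. \<not> (\<exists>A \<subseteq> tuples p (univ M). finite A \<and> card A = n \<and> shattered A (instances M p q \<phi>))))"

definition NIP :: "'a itself \<Rightarrow> ('f, 'r) signature \<Rightarrow> ('f, 'r) fm set \<Rightarrow> bool" where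
  "NIP (\<alpha> :: 'a itself) L T \<longleftrightarrow>
     (\<forall>\<phi> p q. wf_fm L \<phi> \<and> fv \<phi> \<subseteq> {..<p + q} \<longrightarrow> NIP_formula \<alpha> L T p q \<phi>)"

end

theory Submission
  imports Defs Complex_Main "HOL-Library.Nat_Bijection"
begin

text \<open>
  By NIP, an externally definable set \<open>X\<close> is approximated from inside: some formula \<open>\<theta>\<close> satisfies that
  every finite subset of \<open>X\<close> lies in an instance \<open>\<theta>(M, b) \<subseteq> X\<close>. If all definable subsets of \<open>X\<close> had
  fewer than \<open>\<kappa>\<close> elements, these instances would form a cofinal family \<open>F\<close> of small subsets of \<open>X\<close>, and
  it suffices to see that \<open>F\<close> shatters arbitrarily large finite sets.

  Points \<open>a\<^sub>1, \<dots>, a\<^sub>n\<close> of a shattered set are chosen so that \<open>a\<^sub>i\<^sub>+\<^sub>1\<close> precedes \<open>a\<^sub>i\<close>. For a finite set \<open>G\<close>, the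
  traces on \<open>G\<close> of the members of \<open>F\<close> containing \<open>a\<^sub>1, \<dots>, a\<^sub>k\<close> should depend only on \<open>G\<close>, so that they
  are known before the \<open>a\<^sub>i\<close> are. This is achieved for a randomly chosen \<open>a\<^sub>1, \<dots>, a\<^sub>k\<close>, up to a small
  error: take a finite family of sets of more than \<open>\<kappa>\<close> points such that each \<open>G\<close> splits only a small
  proportion of them. If there were none, repeated splitting would give exponentially many types over
  linearly many parameters, against NIP and the Sauer-Shelah lemma. Since the exceptional points
  always form a set of size at most \<open>\<kappa>\<close> and the members of \<open>F\<close> have fewer than \<open>\<kappa>\<close> elements, a trace
  realised together with a typical new point is also realised without it, which gives shattering.
\<close>

section \<open>Uniformly expressible relations\<close>

text \<open>The locale \<open>tame_cofinal_family\<close> contains no logic; NIP enters it only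
  through its assumption \<open>tame\<close>. That assumption is not a direct instance of NIP: it
  concerns the relation "some member of the family contains y and P and misses Q", which quantifies
  over the members, and the set of their parameters is not definable. Hence the inner approximation
  is carried out twice, for \<open>X\<close> and for the set of parameters whose instances lie
  inside \<open>X\<close>. The combinatorial obstacle is that infinitely many finite sets G have to
  be handled at once. Points that behave alike over one G come from a pigeonhole argument, but the
  next G may split them again, and this is why the argument settles for proportions. The index sets
  \<open>\<Omega>\<close> are iterated products of finite families, and every error is a fraction of
  the indices. Each further point costs a constant factor in accuracy, so the induction treats all
  accuracies together.\<close>

lemma eval_cong: "(\<And>i. i \<in> fv_trm t \<Longrightarrow> v i = w i) \<Longrightarrow> eval M v t = eval M w t"
proof (induction t)
  case (Fn f ts)
  then have "map (eval M v) ts = map (eval M w) ts" by (intro map_cong) auto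
  then show ?case by (simp only: eval.simps)
qed simp

lemma sat_cong: "(\<And>i. i \<in> fv \<phi> \<Longrightarrow> v i = w i) \<Longrightarrow> sat M v \<phi> \<longleftrightarrow> sat M w \<phi>"
proof (induction \<phi> arbitrary: v w)
  case (Eq s t)
  have "eval M v s = eval M w s" "eval M v t = eval M w t"
    by (rule eval_cong, rule Eq.prems, simp)+
  then show ?case by simp
next
  case (Rel r ts)
  then have "map (eval M v) ts = map (eval M w) ts"
    by (intro map_cong eval_cong) auto
  then show ?case by (simp only: sat.simps)
next
  case (Conj \<phi> \<psi>)
  from Conj.prems have "sat M v \<phi> \<longleftrightarrow> sat M w \<phi>" "sat M v \<psi> \<longleftrightarrow> sat M w \<psi>"
    by (rule Conj.IH, simp)+
  then show ?case by simp
next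
  case (Exists i \<phi>)
  have "sat M (v(i := a)) \<phi> \<longleftrightarrow> sat M (w(i := a)) \<phi>" for a
    using Exists.prems by (intro Exists.IH) auto
  then show ?case by simp
next
  case (Neg \<phi>)
  have "sat M v \<phi> \<longleftrightarrow> sat M w \<phi>" by (rule Neg.IH) (simp add: Neg.prems)
  then show ?case by simp
qed simp

section \<open>Renaming of variables\<close>

fun ren_trm :: "(nat \<Rightarrow> nat) \<Rightarrow> 'f trm \<Rightarrow> 'f trm" where
  "ren_trm r (Var i) = Var (r i)"
| "ren_trm r (Fn f ts) = Fn f (map (ren_trm r) ts)"

text \<open>Bound variables are renamed along with the free ones. For an injective map this rules
  out capture without any choice of fresh names, and all renamings below are injective.\<close>

fun ren_fm :: "(nat \<Rightarrow> nat) \<Rightarrow> ('f, 'r) fm \<Rightarrow> ('f, 'r) fm" where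
  "ren_fm r Bot = Bot"
| "ren_fm r (Eq s t) = Eq (ren_trm r s) (ren_trm r t)"
| "ren_fm r (Rel p ts) = Rel p (map (ren_trm r) ts)"
| "ren_fm r (Neg \<phi>) = Neg (ren_fm r \<phi>)"
| "ren_fm r (Conj \<phi> \<psi>) = Conj (ren_fm r \<phi>) (ren_fm r \<psi>)"
| "ren_fm r (Exists i \<phi>) = Exists (r i) (ren_fm r \<phi>)"

lemma wf_ren_trm: "wf_trm L (ren_trm r t) \<longleftrightarrow> wf_trm L t"
  by (induction t) auto

lemma wf_ren_fm: "wf_fm L (ren_fm r \<phi>) \<longleftrightarrow> wf_fm L \<phi>"
  by (induction \<phi>) (auto simp: wf_ren_trm)

lemma fv_ren_trm: "fv_trm (ren_trm r t) = r ` fv_trm t"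
  by (induction t) auto

lemma fv_ren_fm: "inj r \<Longrightarrow> fv (ren_fm r \<phi>) = r ` fv \<phi>"
  by (induction \<phi>) (auto simp: fv_ren_trm image_Un image_UN image_set_diff inj_eq)

lemma eval_ren_trm: "eval M v (ren_trm r t) = eval M (v \<circ> r) t"
proof (induction t)
  case (Fn f ts)
  then have "map (eval M v) (map (ren_trm r) ts) = map (eval M (v \<circ> r)) ts"
    unfolding map_map by (intro map_cong) (simp_all del: comp_apply add: o_apply[of "eval M v"])
  then show ?case by (simp only: eval.simps ren_trm.simps)
qed simp

lemma sat_ren_fm: "inj r \<Longrightarrow> sat M v (ren_fm r \<phi>) \<longleftrightarrow> sat M (v \<circ> r) \<phi>"
proof (induction \<phi> arbitrary: v)
  case (Exists i \<phi>)
  have "v(r i := a) \<circ> r = (v \<circ> r)(i := a)" for a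
    using Exists.prems by (auto simp: fun_eq_iff inj_eq)
  then show ?case using Exists by (simp del: comp_apply fun_upd_apply)
next
  case (Rel p ts)
  have "map (eval M v) (map (ren_trm r) ts) = map (eval M (v \<circ> r)) ts"
    unfolding map_map by (intro map_cong) (simp_all add: eval_ren_trm)
  then show ?case by (simp only: sat.simps ren_fm.simps)
qed (simp_all add: eval_ren_trm)

section \<open>Tuples, and closure properties of expressible relations\<close>

lemma tuples_append: "xs \<in> tuples m U \<Longrightarrow> ys \<in> tuples n U \<Longrightarrow> xs @ ys \<in> tuples (m + n) U"
  by (auto simp: tuples_def)

lemma tuples_length: "xs \<in> tuples n U \<Longrightarrow> length xs = n"
  by (simp add: tuples_def)

lemma tuples_0: "tuples 0 U = {[]}"
  by (auto simp: tuples_def)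

lemma tuples_split:
  assumes "zs \<in> tuples (m + n) U"
  obtains xs ys where "zs = xs @ ys" "xs \<in> tuples m U" "ys \<in> tuples n U"
proof
  show "zs = take m zs @ drop m zs" by simp
qed (use assms in \<open>auto simp: tuples_def dest: in_set_takeD in_set_dropD\<close>)

text \<open>One formula has to serve all structures on the carrier type: the bound in
  \<open>NIP_formula\<close> holds in some other model of the theory, and statements built from
  \<open>R\<close> must be compared between that model and \<open>M\<close>. Speaking of relations
  instead of formulas hides the bookkeeping of variables.\<close>

definition expressible ::
  "('f, 'r) signature \<Rightarrow> nat \<Rightarrow> (('f, 'r, 'a) struct \<Rightarrow> 'a list \<Rightarrow> bool) \<Rightarrow> bool" where
  "expressible L n R \<longleftrightarrow> (\<exists>\<phi>. wf_fm L \<phi> \<and> fv \<phi> \<subseteq> {..<n} \<and>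
     (\<forall>M xs. is_struct L M \<longrightarrow> xs \<in> tuples n (univ M) \<longrightarrow> (sat M (nth xs) \<phi> \<longleftrightarrow> R M xs)))"

lemma expressible_fm:
  "wf_fm L \<phi> \<Longrightarrow> fv \<phi> \<subseteq> {..<n} \<Longrightarrow> expressible L n (\<lambda>M xs. sat M (nth xs) \<phi>)"
  unfolding expressible_def by blast

lemma expressible_cong:
  assumes "expressible L n R"
    and "\<And>M xs. is_struct L M \<Longrightarrow> xs \<in> tuples n (univ M) \<Longrightarrow> R M xs \<longleftrightarrow> R' M xs"
  shows "expressible L n R'"
proof -
  obtain \<phi> where "wf_fm L \<phi>" "fv \<phi> \<subseteq> {..<n}"
    "\<forall>M xs. is_struct L M \<longrightarrow> xs \<in> tuples n (univ M) \<longrightarrow> (sat M (nth xs) \<phi> \<longleftrightarrow> R M xs)"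
    using assms(1) unfolding expressible_def by blast
  then show ?thesis
    unfolding expressible_def using assms(2) by (intro exI[of _ \<phi>]) auto
qed

lemma expressible_not:
  assumes "expressible L n R"
  shows "expressible L n (\<lambda>M xs. \<not> R M xs)"
proof -
  obtain \<phi> where "wf_fm L \<phi>" "fv \<phi> \<subseteq> {..<n}"
    "\<forall>M xs. is_struct L M \<longrightarrow> xs \<in> tuples n (univ M) \<longrightarrow> (sat M (nth xs) \<phi> \<longleftrightarrow> R M xs)"
    using assms(1) unfolding expressible_def by blast
  then show ?thesis
    unfolding expressible_def by (intro exI[of _ "Neg \<phi>"]) auto
qed

lemma expressible_conj:
  assumes "expressible L n R" "expressible L n R'"
  shows "expressible L n (\<lambda>M xs. R M xs \<and> R' M xs)"
proof -
  obtain \<phi> \<psi> where "wf_fm L \<phi>" "fv \<phi> \<subseteq> {..<n}" "wf_fm L \<psi>" "fv \<psi> \<subseteq> {..<n}"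
    and "\<forall>M xs. is_struct L M \<longrightarrow> xs \<in> tuples n (univ M) \<longrightarrow> (sat M (nth xs) \<phi> \<longleftrightarrow> R M xs)"
    and "\<forall>M xs. is_struct L M \<longrightarrow> xs \<in> tuples n (univ M) \<longrightarrow> (sat M (nth xs) \<psi> \<longleftrightarrow> R' M xs)"
    using assms unfolding expressible_def by blast
  then show ?thesis
    unfolding expressible_def by (intro exI[of _ "Conj \<phi> \<psi>"]) auto
qed

lemma expressible_True: "expressible L n (\<lambda>M xs. True)"
  unfolding expressible_def by (intro exI[of _ "Neg Bot"]) auto

lemma expressible_disj:
  assumes "expressible L n R" "expressible L n R'"
  shows "expressible L n (\<lambda>M xs. R M xs \<or> R' M xs)"
  using expressible_not[OF expressible_conj[OF expressible_not[OF assms(1)] expressible_not[OF assms(2)]]]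
  by simp

lemma expressible_const: "expressible L n (\<lambda>M xs. b)"
  using expressible_True expressible_not[OF expressible_True] by (cases b) simp_all

lemma expressible_iff_const:
  "expressible L n R \<Longrightarrow> expressible L n (\<lambda>M xs. R M xs \<longleftrightarrow> b)"
  using expressible_not by (cases b) auto

lemma expressible_ball:
  assumes "finite I" "\<And>i. i \<in> I \<Longrightarrow> expressible L n (R i)"
  shows "expressible L n (\<lambda>M xs. \<forall>i \<in> I. R i M xs)"
  using assms
proof (induction I rule: finite_induct)
  case empty
  then show ?case using expressible_True by simp
next
  case (insert i I)
  then show ?case using expressible_conj[of L n "R i"] by simp
qed

lemma expressible_ex1:
  assumes "expressible L (Suc n) R"
  shows "expressible L n (\<lambda>M xs. \<exists>a \<in> univ M. R M (xs @ [a]))"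
proof -
  obtain \<phi> where \<phi>: "wf_fm L \<phi>" "fv \<phi> \<subseteq> {..<Suc n}"
    and sat: "\<And>M xs. is_struct L M \<Longrightarrow> xs \<in> tuples (Suc n) (univ M) \<Longrightarrow> sat M (nth xs) \<phi> \<longleftrightarrow> R M xs"
    using assms unfolding expressible_def by blast
  have "sat M (nth xs) (Exists n \<phi>) \<longleftrightarrow> (\<exists>a \<in> univ M. R M (xs @ [a]))"
    if M: "is_struct L M" and xs: "xs \<in> tuples n (univ M)" for M :: "('a, 'b, 'c) struct" and xs
  proof -
    have "sat M ((nth xs)(n := a)) \<phi> \<longleftrightarrow> R M (xs @ [a])" if "a \<in> univ M" for a
    proof -
      have "sat M ((nth xs)(n := a)) \<phi> \<longleftrightarrow> sat M (nth (xs @ [a])) \<phi>"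
        using \<phi>(2) tuples_length[OF xs] by (intro sat_cong) (auto simp: nth_append)
      also have "\<dots> \<longleftrightarrow> R M (xs @ [a])"
        using that xs by (intro sat[OF M]) (auto simp: tuples_def)
      finally show ?thesis .
    qed
    then show ?thesis by simp
  qed
  then show ?thesis
    unfolding expressible_def using \<phi> by (intro exI[of _ "Exists n \<phi>"]) auto
qed

lemma expressible_ex:
  assumes "expressible L (n + q) R"
  shows "expressible L n (\<lambda>M xs. \<exists>ys \<in> tuples q (univ M). R M (xs @ ys))"
  using assms
proof (induction q arbitrary: R)
  case 0
  then show ?case by (simp add: tuples_0)
next
  case (Suc q)
  have "expressible L n (\<lambda>M xs. \<exists>ys \<in> tuples q (univ M). \<exists>a \<in> univ M. R M ((xs @ ys) @ [a]))"
    using Suc.prems by (intro Suc.IH expressible_ex1) simp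
  then show ?case
  proof (rule expressible_cong)
    fix M :: "('a, 'b, 'c) struct" and xs
    show "(\<exists>ys \<in> tuples q (univ M). \<exists>a \<in> univ M. R M ((xs @ ys) @ [a])) \<longleftrightarrow>
        (\<exists>ys \<in> tuples (Suc q) (univ M). R M (xs @ ys))"
    proof
      assume "\<exists>ys \<in> tuples q (univ M). \<exists>a \<in> univ M. R M ((xs @ ys) @ [a])"
      then obtain ys a where *: "ys \<in> tuples q (univ M)" "a \<in> univ M" "R M (xs @ (ys @ [a]))"
        by auto
      then have "ys @ [a] \<in> tuples (Suc q) (univ M)" by (auto simp: tuples_def)
      then show "\<exists>ys \<in> tuples (Suc q) (univ M). R M (xs @ ys)" using *(3) by blast
    next
      assume "\<exists>ys \<in> tuples (Suc q) (univ M). R M (xs @ ys)"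
      then obtain zs where zs: "zs \<in> tuples (q + 1) (univ M)" "R M (xs @ zs)" by auto
      obtain ys as where *: "zs = ys @ as" "ys \<in> tuples q (univ M)" "as \<in> tuples 1 (univ M)"
        using tuples_split[OF zs(1)] .
      then obtain a where "as = [a]" "a \<in> univ M"
        by (auto simp: tuples_def length_Suc_conv)
      then show "\<exists>ys \<in> tuples q (univ M). \<exists>a \<in> univ M. R M ((xs @ ys) @ [a])"
        using * zs(2) by auto
    qed
  qed
qed

text \<open>The list \<open>is\<close> may repeat indices, so renaming along it is not injective.
  Instead the formula is shifted to fresh variables from \<open>m\<close> on, which are then equated
  with the entries selected by \<open>is\<close> and quantified away.\<close>

lemma expressible_subst:
  assumes R: "expressible L (length is) R" and "set is \<subseteq> {..<m}"
  shows "expressible L m (\<lambda>M xs. R M (map (nth xs) is))"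
proof -
  let ?n = "length is"
  obtain \<phi> where \<phi>: "wf_fm L \<phi>" "fv \<phi> \<subseteq> {..<?n}"
    and sat: "\<And>M xs. is_struct L M \<Longrightarrow> xs \<in> tuples ?n (univ M) \<Longrightarrow> sat M (nth xs) \<phi> \<longleftrightarrow> R M xs"
    using R unfolding expressible_def by blast
  have inj: "inj (\<lambda>i. m + i)" by auto
  have 1: "expressible L (m + ?n) (\<lambda>M zs. R M (drop m zs))"
  proof (rule expressible_cong[OF expressible_fm])
    show "wf_fm L (ren_fm (\<lambda>i. m + i) \<phi>)" using \<phi> by (simp add: wf_ren_fm)
    show "fv (ren_fm (\<lambda>i. m + i) \<phi>) \<subseteq> {..<m + ?n}" using \<phi> by (auto simp: fv_ren_fm[OF inj])
    fix M :: "('a, 'b, 'c) struct" and zs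
    assume M: "is_struct L M" and zs: "zs \<in> tuples (m + ?n) (univ M)"
    have "sat M (nth zs) (ren_fm (\<lambda>i. m + i) \<phi>) \<longleftrightarrow> sat M (nth (drop m zs)) \<phi>"
      unfolding sat_ren_fm[OF inj] using \<phi>(2) tuples_length[OF zs]
      by (intro sat_cong) auto
    also have "\<dots> \<longleftrightarrow> R M (drop m zs)"
      using zs by (intro sat[OF M]) (auto simp: tuples_def dest: in_set_dropD)
    finally show "sat M (nth zs) (ren_fm (\<lambda>i. m + i) \<phi>) \<longleftrightarrow> R M (drop m zs)" .
  qed
  have 2: "expressible L (m + ?n) (\<lambda>M zs. \<forall>i \<in> {..<?n}. zs ! (m + i) = zs ! (is ! i))"
  proof (intro expressible_ball)
    fix i assume "i \<in> {..<?n}"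
    then have "is ! i < m" using assms(2) nth_mem by blast
    then show "expressible L (m + ?n) (\<lambda>M zs. zs ! (m + i) = zs ! (is ! i))"
      using \<open>i \<in> {..<?n}\<close> expressible_fm[of L "Eq (Var (m + i)) (Var (is ! i))" "m + ?n"] by auto
  qed simp
  have "expressible L m (\<lambda>M xs. \<exists>ys \<in> tuples ?n (univ M).
      R M (drop m (xs @ ys)) \<and> (\<forall>i \<in> {..<?n}. (xs @ ys) ! (m + i) = (xs @ ys) ! (is ! i)))"
    by (rule expressible_ex[OF expressible_conj[OF 1 2]])
  then show ?thesis
  proof (rule expressible_cong)
    fix M :: "('a, 'b, 'c) struct" and xs
    assume M: "is_struct L M" and xs: "xs \<in> tuples m (univ M)"
    have lt: "is ! i < m" if "i < ?n" for i using that assms(2) nth_mem by blast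
    have l: "length xs = m" using xs by (rule tuples_length)
    have mem: "map (nth xs) is \<in> tuples ?n (univ M)"
      using assms(2) xs by (auto simp: tuples_def) (metis lessThan_iff nth_mem subsetD)
    have eq: "(\<forall>i \<in> {..<?n}. (xs @ ys) ! (m + i) = (xs @ ys) ! (is ! i)) \<longleftrightarrow> ys = map (nth xs) is"
      if "ys \<in> tuples ?n (univ M)" for ys
      using tuples_length[OF that] l lt
      by (auto simp: nth_append list_eq_iff_nth_eq)
    show "(\<exists>ys \<in> tuples ?n (univ M).
      R M (drop m (xs @ ys)) \<and> (\<forall>i \<in> {..<?n}. (xs @ ys) ! (m + i) = (xs @ ys) ! (is ! i)))
      \<longleftrightarrow> R M (map (nth xs) is)"
      using eq mem l by auto
  qed
qed

lemma map_nth_upt: "s + l \<le> length xs \<Longrightarrow> map (nth xs) [s..<s + l] = take l (drop s xs)"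
  by (auto intro!: nth_equalityI)

text \<open>A block \<open>(s, l)\<close> stands for the \<open>l\<close> consecutive entries starting at position \<open>s\<close>.\<close>

lemma expressible_blocks:
  assumes R: "expressible L (sum_list (map snd bl)) R"
    and bl: "\<forall>b \<in> set bl. fst b + snd b \<le> m"
  shows "expressible L m (\<lambda>M xs. R M (concat (map (\<lambda>(s, l). take l (drop s xs)) bl)))"
proof -
  let ?is = "concat (map (\<lambda>(s, l). [s..<s + l]) bl)"
  have len: "length ?is = sum_list (map snd bl)"
    by (induction bl) auto
  have sub: "set ?is \<subseteq> {..<m}" using bl by force
  have "expressible L m (\<lambda>M xs. R M (map (nth xs) ?is))"
    using R sub by (intro expressible_subst) (simp_all only: len)
  then show ?thesis
  proof (rule expressible_cong)
    fix M :: "('a, 'b, 'c) struct" and xs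
    assume xs: "xs \<in> tuples m (univ M)"
    have "map (nth xs) ?is = concat (map (\<lambda>(s, l). take l (drop s xs)) bl)"
      unfolding map_concat map_map
      using bl tuples_length[OF xs]
      by (intro arg_cong[where f = concat] map_cong) (auto simp: map_nth_upt)
    then show "R M (map (nth xs) ?is) \<longleftrightarrow> R M (concat (map (\<lambda>(s, l). take l (drop s xs)) bl))"
      by simp
  qed
qed

lemma expressible_sentence:
  fixes M M' :: "('f, 'r, 'a) struct"
  assumes R: "expressible L 0 R" and M: "is_struct L M" and M': "is_model L (Th L M) M'"
    and "R M []"
  shows "R M' []"
proof -
  obtain \<phi> where \<phi>: "wf_fm L \<phi>" "fv \<phi> \<subseteq> {..<0}"
    and sat: "\<And>(M :: ('f, 'r, 'a) struct) xs.
      is_struct L M \<Longrightarrow> xs \<in> tuples 0 (univ M) \<Longrightarrow> sat M (nth xs) \<phi> \<longleftrightarrow> R M xs"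
    using R unfolding expressible_def by blast
  \<comment> \<open>\<open>nth []\<close> need not take values in the universe, whereas
    \<open>Th\<close> speaks only of valuations that do; for a sentence the valuation is
    immaterial.\<close>
  have cong: "sat N v \<phi> \<longleftrightarrow> sat N (nth []) \<phi>" for N :: "('f, 'r, 'a) struct" and v
    using \<phi>(2) by (intro sat_cong) auto
  have "sat M (nth []) \<phi>" using sat[OF M, of "[]"] assms(4) by (simp add: tuples_0)
  then have "sat M v \<phi>" for v using cong[of M v] by blast
  then have "\<phi> \<in> Th L M" using \<phi> unfolding Th_def by simp
  then have "\<phi> \<in> Th L M'" and s: "is_struct L M'" using M' unfolding is_model_def by auto
  moreover obtain a where "a \<in> univ M'" using s unfolding is_struct_def by auto
  ultimately have "sat M' (\<lambda>_. a) \<phi>" unfolding Th_def by auto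
  then have "sat M' (nth []) \<phi>" using cong[of M' "\<lambda>_. a"] by blast
  then show ?thesis using sat[OF s, of "[]"] by (simp add: tuples_0)
qed

section \<open>Lists of tuples coded by concatenation, and transfer of NIP to M\<close>

lemma take_drop_concat:
  assumes "\<And>x. x \<in> set ss \<Longrightarrow> length x = k" "j < length ss"
  shows "take k (drop (j * k) (concat ss)) = ss ! j"
  using assms
proof (induction ss arbitrary: j)
  case (Cons x ss)
  then show ?case by (cases j) auto
qed simp

lemma length_concat_const: "(\<And>x. x \<in> set ss \<Longrightarrow> length x = k) \<Longrightarrow> length (concat ss) = length ss * k"
  by (induction ss) auto

lemma nth_concat_const:
  assumes len: "\<And>x. x \<in> set ss \<Longrightarrow> length x = k" and "i < length ss" "l < k"
  shows "concat ss ! (i * k + l) = ss ! i ! l"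
proof -
  have "Suc i * k \<le> length ss * k" using assms(2) by (intro mult_le_mono1) simp
  then have "i * k + l < length (concat ss)"
    using length_concat_const[OF len] assms(3) by simp
  then have "concat ss ! (i * k + l) = take k (drop (i * k) (concat ss)) ! l"
    using assms(3) by simp
  then show ?thesis using take_drop_concat[OF len assms(2)] by simp
qed

lemma concat_tuples:
  assumes "set ss \<subseteq> tuples k U"
  shows "concat ss \<in> tuples (length ss * k) U"
  using assms length_concat_const[of ss k] by (auto simp: tuples_def)

lemma tuples_concatE:
  assumes "zs \<in> tuples (n * k) U"
  obtains ss where "zs = concat ss" "length ss = n" "set ss \<subseteq> tuples k U"
  using assms
proof (induction n arbitrary: zs thesis)
  case 0
  then show ?case by (auto simp: tuples_0)
next
  case (Suc n)
  from Suc.prems(2) have "zs \<in> tuples (k + n * k) U" by simp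
  then obtain xs ys where *: "zs = xs @ ys" "xs \<in> tuples k U" "ys \<in> tuples (n * k) U"
    by (rule tuples_split)
  obtain ss where "ys = concat ss" "length ss = n" "set ss \<subseteq> tuples k U"
    using Suc.IH[OF _ *(3)] by blast
  then show ?case using * Suc.prems(1)[of "xs # ss"] by auto
qed

text \<open>Here \<open>zs\<close> is the concatenation of \<open>n\<close> tuples of length
  \<open>p\<close>. The pattern \<open>S\<close> is fixed outside the formula, so that shattering
  becomes a finite conjunction over all \<open>S\<close>.\<close>

lemma expressible_ex_pattern:
  assumes R: "expressible L (p + q) R"
  shows "expressible L (n * p)
    (\<lambda>M zs. \<exists>c \<in> tuples q (univ M). \<forall>j \<in> {..<n}. R M (take p (drop (j * p) zs) @ c) \<longleftrightarrow> j \<in> S)"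
proof -
  have "expressible L (n * p + q) (\<lambda>M zs. R M (take p (drop (j * p) zs) @ take q (drop (n * p) zs)))"
    if "j \<in> {..<n}" for j
  proof -
    have "j * p + p \<le> n * p + q"
    proof -
      have "Suc j * p \<le> n * p" using that by (intro mult_le_mono1) auto
      then show ?thesis by simp
    qed
    then show ?thesis
      using R expressible_blocks[of L "[(j * p, p), (n * p, q)]" R "n * p + q"] by simp
  qed
  then have "expressible L (n * p + q) (\<lambda>M zs. \<forall>j \<in> {..<n}.
      R M (take p (drop (j * p) zs) @ take q (drop (n * p) zs)) \<longleftrightarrow> j \<in> S)"
    by (intro expressible_ball expressible_iff_const) auto
  from expressible_ex[OF this] show ?thesis
  proof (rule expressible_cong)
    fix M :: "('a, 'b, 'c) struct" and zs
    assume zs: "zs \<in> tuples (n * p) (univ M)"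
    have *: "take p (drop (j * p) (zs @ c)) = take p (drop (j * p) zs)" if "j < n" for j c
    proof -
      have "Suc j * p \<le> n * p" using that by (intro mult_le_mono1) auto
      then show ?thesis using tuples_length[OF zs] by simp
    qed
    have **: "take q (drop (n * p) (zs @ c)) = c" if "c \<in> tuples q (univ M)" for c
      using tuples_length[OF zs] tuples_length[OF that] by simp
    show "(\<exists>ys \<in> tuples q (univ M). \<forall>j \<in> {..<n}.
        R M (take p (drop (j * p) (zs @ ys)) @ take q (drop (n * p) (zs @ ys))) \<longleftrightarrow> j \<in> S) \<longleftrightarrow>
      (\<exists>c \<in> tuples q (univ M). \<forall>j \<in> {..<n}. R M (take p (drop (j * p) zs) @ c) \<longleftrightarrow> j \<in> S)"
      by (intro bex_cong ball_cong refl) (simp only: * ** lessThan_iff)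
  qed
qed

definition sect :: "('f, 'r, 'a) struct \<Rightarrow> (('f, 'r, 'a) struct \<Rightarrow> 'a list \<Rightarrow> bool) \<Rightarrow> nat \<Rightarrow> 'a list \<Rightarrow> 'a list set"
  where "sect M R p d = {a \<in> tuples p (univ M). R M (a @ d)}"

lemma shattered_list_iff:
  assumes "distinct ss" "set ss \<subseteq> tuples p (univ M)"
  shows "shattered (set ss) {sect M R p c |c. c \<in> tuples q (univ M)} \<longleftrightarrow>
    (\<forall>S \<in> Pow {..<length ss}. \<exists>c \<in> tuples q (univ M). \<forall>j \<in> {..<length ss}. R M (ss ! j @ c) \<longleftrightarrow> j \<in> S)"
    (is "?L \<longleftrightarrow> ?R")
proof
  assume L: ?L
  show ?R
  proof
    fix S assume "S \<in> Pow {..<length ss}"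
    then have S: "S \<subseteq> {..<length ss}" by simp
    then have "nth ss ` S \<subseteq> set ss" by auto
    then obtain c where c: "c \<in> tuples q (univ M)" "sect M R p c \<inter> set ss = nth ss ` S"
      using L unfolding shattered_def by blast
    have "R M (ss ! j @ c) \<longleftrightarrow> j \<in> S" if "j < length ss" for j
    proof -
      have "R M (ss ! j @ c) \<longleftrightarrow> ss ! j \<in> sect M R p c \<inter> set ss"
        using that assms(2) nth_mem[OF that] by (auto simp: sect_def)
      also have "\<dots> \<longleftrightarrow> j \<in> S"
        unfolding c(2) using that S assms(1) by (auto simp: nth_eq_iff_index_eq)
      finally show ?thesis .
    qed
    then show "\<exists>c \<in> tuples q (univ M). \<forall>j \<in> {..<length ss}. R M (ss ! j @ c) \<longleftrightarrow> j \<in> S"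
      using c(1) by auto
  qed
next
  assume R: ?R
  show ?L
    unfolding shattered_def
  proof (intro allI impI)
    fix S assume S: "S \<subseteq> set ss"
    then obtain c where c: "c \<in> tuples q (univ M)"
      "\<forall>j \<in> {..<length ss}. R M (ss ! j @ c) \<longleftrightarrow> j \<in> {j. j < length ss \<and> ss ! j \<in> S}"
      using R[rule_format, of "{j. j < length ss \<and> ss ! j \<in> S}"] by auto
    have "sect M R p c \<inter> set ss = S"
    proof (intro equalityI subsetI)
      fix x assume "x \<in> sect M R p c \<inter> set ss"
      then show "x \<in> S" using c(2) by (auto simp: sect_def in_set_conv_nth)
    next
      fix x assume "x \<in> S"
      then show "x \<in> sect M R p c \<inter> set ss"
      proof -
        have x: "x \<in> set ss" using S \<open>x \<in> S\<close> by blast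
        then obtain j where "j < length ss" "x = ss ! j" by (auto simp: in_set_conv_nth)
        then have "R M (x @ c)" using c(2) \<open>x \<in> S\<close> by simp
        then show ?thesis using x assms(2) by (auto simp: sect_def)
      qed
    qed
    then show "\<exists>B \<in> {sect M R p c |c. c \<in> tuples q (univ M)}. B \<inter> set ss = S"
      using c(1) by blast
  qed
qed

text \<open>NIP bounds shattering in some model of the theory only. That an n-element set is
  shattered is a sentence, so if it were true in \<open>M\<close> it would belong to the theory and
  hold in that model as well.\<close>

lemma NIP_expressible:
  fixes M :: "('f, 'r, 'a) struct"
  assumes M: "is_struct L M" and NIP: "NIP TYPE('a) L (Th L M)"
    and R: "expressible L (p + q) (R :: ('f, 'r, 'a) struct \<Rightarrow> _)"
  shows "\<exists>n. \<forall>A \<subseteq> tuples p (univ M). finite A \<longrightarrow> card A = n \<longrightarrow>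
    \<not> shattered A {sect M R p c |c. c \<in> tuples q (univ M)}"
proof -
  obtain \<phi> where \<phi>: "wf_fm L \<phi>" "fv \<phi> \<subseteq> {..<p + q}"
    and sat: "\<And>(M :: ('f, 'r, 'a) struct) xs.
      is_struct L M \<Longrightarrow> xs \<in> tuples (p + q) (univ M) \<Longrightarrow> sat M (nth xs) \<phi> \<longleftrightarrow> R M xs"
    using R unfolding expressible_def by blast
  from NIP \<phi> have "NIP_formula TYPE('a) L (Th L M) p q \<phi>" unfolding NIP_def by blast
  then obtain M' :: "('f, 'r, 'a) struct" and n where M': "is_model L (Th L M) M'"
    and n: "\<not> (\<exists>A \<subseteq> tuples p (univ M'). finite A \<and> card A = n \<and> shattered A (instances M' p q \<phi>))"
    unfolding NIP_formula_def by blast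
  have sM': "is_struct L M'" using M' unfolding is_model_def by blast
  have inst: "instances M' p q \<phi> = {sect M' R p c |c. c \<in> tuples q (univ M')}"
  proof -
    have "{a \<in> tuples p (univ M'). sat M' (nth (a @ b)) \<phi>} = sect M' R p b"
      if "b \<in> tuples q (univ M')" for b
      using sat[OF sM' tuples_append] that by (auto simp: sect_def)
    then show ?thesis unfolding instances_def by blast
  qed
  \<comment> \<open>The first conjunct makes the \<open>n\<close> blocks of \<open>zs\<close>
    pairwise distinct, so that they form a set of exactly \<open>n\<close> tuples; the second asks
    for a parameter for each pattern.\<close>
  define T where "T = (\<lambda>(N :: ('f, 'r, 'a) struct) (zs :: 'a list).
    (\<forall>ij \<in> {(i, j). i < n \<and> j < n \<and> i \<noteq> j}.
        \<not> (\<forall>l \<in> {..<p}. zs ! (fst ij * p + l) = zs ! (snd ij * p + l))) \<and>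
    (\<forall>S \<in> Pow {..<n}. \<exists>c \<in> tuples q (univ N). \<forall>j \<in> {..<n}. R N (take p (drop (j * p) zs) @ c) \<longleftrightarrow> j \<in> S))"
  have T: "expressible L (n * p) T"
    unfolding T_def
  proof (intro expressible_conj expressible_ball expressible_not expressible_ex_pattern[OF R])
    show "finite {(i, j). i < n \<and> j < n \<and> i \<noteq> j}"
      by (rule finite_subset[of _ "{..<n} \<times> {..<n}"]) auto
    fix ij l assume ij: "ij \<in> {(i, j). i < n \<and> j < n \<and> i \<noteq> j}" and l: "l \<in> {..<p}"
    have *: "i * p + l < n * p" if "i < n" for i
    proof -
      have "Suc i * p \<le> n * p" using that by (intro mult_le_mono1) auto
      then show ?thesis using l by simp
    qed
    show "expressible L (n * p) (\<lambda>N zs. zs ! (fst ij * p + l) = zs ! (snd ij * p + l))"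
      using expressible_fm[of L "Eq (Var (fst ij * p + l)) (Var (snd ij * p + l))" "n * p"]
        *[of "fst ij"] *[of "snd ij"] ij by auto
  qed simp_all
  have char: "(\<exists>A \<subseteq> tuples p (univ N). finite A \<and> card A = n \<and>
      shattered A {sect N R p c |c. c \<in> tuples q (univ N)}) \<longleftrightarrow> (\<exists>zs \<in> tuples (n * p) (univ N). T N zs)"
    (is "?L \<longleftrightarrow> ?R") for N :: "('f, 'r, 'a) struct"
  proof -
    have T_concat: "T N (concat ss) \<longleftrightarrow> distinct ss \<and> (\<forall>S \<in> Pow {..<length ss}. \<exists>c \<in> tuples q (univ N).
        \<forall>j \<in> {..<length ss}. R N (ss ! j @ c) \<longleftrightarrow> j \<in> S)"
      if ss: "length ss = n" "set ss \<subseteq> tuples p (univ N)" for ss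
    proof -
      have len: "length x = p" if "x \<in> set ss" for x using that ss(2) by (auto simp: tuples_def)
      have bl: "take p (drop (j * p) (concat ss)) = ss ! j" if "j < n" for j
        using take_drop_concat[OF len] that ss(1) by simp
      have nth: "concat ss ! (i * p + l) = ss ! i ! l" if "i < n" "l < p" for i l
        using nth_concat_const[OF len] that ss(1) by simp
      have "(\<forall>l \<in> {..<p}. concat ss ! (i * p + l) = concat ss ! (j * p + l)) \<longleftrightarrow> ss ! i = ss ! j"
        if "i < n" "j < n" for i j
        using that nth len ss(1) by (auto simp: list_eq_iff_nth_eq)
      then have "(\<forall>ij \<in> {(i, j). i < n \<and> j < n \<and> i \<noteq> j}.
        \<not> (\<forall>l \<in> {..<p}. concat ss ! (fst ij * p + l) = concat ss ! (snd ij * p + l))) \<longleftrightarrow> distinct ss"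
        unfolding distinct_conv_nth using ss(1) by fastforce
      moreover have "(\<forall>j \<in> {..<n}. R N (take p (drop (j * p) (concat ss)) @ c) \<longleftrightarrow> j \<in> S) \<longleftrightarrow>
          (\<forall>j \<in> {..<n}. R N (ss ! j @ c) \<longleftrightarrow> j \<in> S)" for S c
        using bl by auto
      ultimately show ?thesis unfolding T_def ss(1) by simp
    qed
    show ?thesis
    proof
      assume ?L
      then obtain A where A: "A \<subseteq> tuples p (univ N)" "finite A" "card A = n"
        "shattered A {sect N R p c |c. c \<in> tuples q (univ N)}" by blast
      obtain ss where ss: "set ss = A" "distinct ss"
        using finite_distinct_list[OF A(2)] by blast
      then have "length ss = n" using A(3) distinct_card by fastforce
      then have "T N (concat ss)" "concat ss \<in> tuples (n * p) (univ N)"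
        using T_concat[of ss] shattered_list_iff[OF ss(2), of p N R q] ss A concat_tuples[of ss p] by auto
      then show ?R by blast
    next
      assume ?R
      then obtain zs where zs: "zs \<in> tuples (n * p) (univ N)" "T N zs" by blast
      obtain ss where ss: "zs = concat ss" "length ss = n" "set ss \<subseteq> tuples p (univ N)"
        using tuples_concatE[OF zs(1)] .
      then have "distinct ss" "shattered (set ss) {sect N R p c |c. c \<in> tuples q (univ N)}"
        using T_concat[OF ss(2,3)] zs(2) shattered_list_iff[OF _ ss(3), of R q] by auto
      then show ?L using ss distinct_card[of ss] by (intro exI[of _ "set ss"]) auto
    qed
  qed
  have "expressible L 0 (\<lambda>N xs. \<exists>zs \<in> tuples (n * p) (univ N). T N (xs @ zs))"
    using T by (intro expressible_ex) simp
  from expressible_sentence[OF this M M'] have "\<not> (\<exists>zs \<in> tuples (n * p) (univ M). T M zs)"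
    using n char[of M'] unfolding inst by auto
  then have "\<not> (\<exists>A \<subseteq> tuples p (univ M). finite A \<and> card A = n \<and>
      shattered A {sect M R p c |c. c \<in> tuples q (univ M)})"
    by (simp only: char simp_thms)
  then show ?thesis
    by (intro exI[of _ n] allI impI notI) (erule notE, intro exI conjI)
qed

section \<open>Approximation of externally definable sets from inside\<close>

lemma maximal_ideal:
  assumes "\<H> \<subseteq> Pow W" "W \<notin> \<H>" "{} \<in> \<H>"
    and "\<And>A B. A \<in> \<H> \<Longrightarrow> B \<subseteq> A \<Longrightarrow> B \<in> \<H>" "\<And>A B. A \<in> \<H> \<Longrightarrow> B \<in> \<H> \<Longrightarrow> A \<union> B \<in> \<H>"
  obtains I where "\<H> \<subseteq> I" "W \<notin> I" "\<And>A B. A \<in> I \<Longrightarrow> B \<subseteq> A \<Longrightarrow> B \<in> I"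
    "\<And>A B. A \<in> I \<Longrightarrow> B \<in> I \<Longrightarrow> A \<union> B \<in> I" "\<And>S. S \<subseteq> W \<Longrightarrow> S \<in> I \<or> W - S \<in> I"
proof -
  define \<I> where "\<I> = {I. \<H> \<subseteq> I \<and> I \<subseteq> Pow W \<and> W \<notin> I \<and> (\<forall>A \<in> I. \<forall>B. B \<subseteq> A \<longrightarrow> B \<in> I) \<and>
    (\<forall>A \<in> I. \<forall>B \<in> I. A \<union> B \<in> I)}"
  have "\<exists>I \<in> \<I>. \<forall>J \<in> \<I>. I \<subseteq> J \<longrightarrow> J = I"
  proof (rule subset_Zorn_nonempty)
    have "\<forall>A \<in> \<H>. \<forall>B. B \<subseteq> A \<longrightarrow> B \<in> \<H>" "\<forall>A \<in> \<H>. \<forall>B \<in> \<H>. A \<union> B \<in> \<H>"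
      using assms(4) by blast (intro ballI assms(5))
    then have "\<H> \<in> \<I>" unfolding \<I>_def using assms(1,2) by simp
    then show "\<I> \<noteq> {}" by blast
    fix \<C> assume ne: "\<C> \<noteq> {}" and chain: "subset.chain \<I> \<C>"
    then have sub: "\<C> \<subseteq> \<I>" and lin: "\<And>X Y. X \<in> \<C> \<Longrightarrow> Y \<in> \<C> \<Longrightarrow> X \<subseteq> Y \<or> Y \<subseteq> X"
      unfolding subset_chain_def by auto
    have "A \<union> B \<in> \<Union>\<C>" if AB: "A \<in> \<Union>\<C>" "B \<in> \<Union>\<C>" for A B
    proof -
      obtain X Y where XY: "X \<in> \<C>" "Y \<in> \<C>" "A \<in> X" "B \<in> Y" using AB by blast
      then obtain Z where "Z \<in> \<C>" "A \<in> Z" "B \<in> Z" using lin[of X Y] by blast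
      then have "A \<union> B \<in> Z" using sub unfolding \<I>_def by blast
      then show ?thesis using \<open>Z \<in> \<C>\<close> by blast
    qed
    moreover have "\<H> \<subseteq> \<Union>\<C>" using ne sub unfolding \<I>_def by blast
    moreover have "\<Union>\<C> \<subseteq> Pow W" "W \<notin> \<Union>\<C>" using sub unfolding \<I>_def by blast+
    moreover have "B \<in> \<Union>\<C>" if "A \<in> \<Union>\<C>" "B \<subseteq> A" for A B
      using that sub unfolding \<I>_def by blast
    ultimately show "\<Union>\<C> \<in> \<I>" unfolding \<I>_def by auto
  qed
  then obtain I where I: "I \<in> \<I>" and max: "\<And>J. J \<in> \<I> \<Longrightarrow> I \<subseteq> J \<Longrightarrow> J = I" by blast
  have HI: "\<H> \<subseteq> I" and IW: "I \<subseteq> Pow W" and WI: "W \<notin> I"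
    and "\<forall>A \<in> I. \<forall>B. B \<subseteq> A \<longrightarrow> B \<in> I" and "\<forall>A \<in> I. \<forall>B \<in> I. A \<union> B \<in> I"
    using I unfolding \<I>_def by simp_all
  then have down: "\<And>A B. A \<in> I \<Longrightarrow> B \<subseteq> A \<Longrightarrow> B \<in> I"
    and un: "\<And>A B. A \<in> I \<Longrightarrow> B \<in> I \<Longrightarrow> A \<union> B \<in> I"
    by simp_all
  have "S \<in> I \<or> W - S \<in> I" if S: "S \<subseteq> W" for S
  proof (rule ccontr)
    assume neg: "\<not> (S \<in> I \<or> W - S \<in> I)"
    \<comment> \<open>The ideal generated by \<open>I\<close> and \<open>S\<close>. It is proper
      because \<open>W - S\<close> is not in \<open>I\<close>, so by maximality it equals
      \<open>I\<close>, which then contains \<open>S\<close>.\<close>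
    define J where "J = {B. \<exists>A \<in> I. B \<subseteq> A \<union> S}"
    have "W \<notin> J"
    proof
      assume "W \<in> J"
      then obtain A where "A \<in> I" "W \<subseteq> A \<union> S" unfolding J_def by blast
      then have "W - S \<in> I" using down[of A "W - S"] by blast
      then show False using neg by blast
    qed
    moreover have "A \<union> B \<in> J" if "A \<in> J" "B \<in> J" for A B
    proof -
      obtain A' B' where "A' \<in> I" "B' \<in> I" "A \<subseteq> A' \<union> S" "B \<subseteq> B' \<union> S" using \<open>A \<in> J\<close> \<open>B \<in> J\<close> unfolding J_def by blast
      then have "A' \<union> B' \<in> I" "A \<union> B \<subseteq> (A' \<union> B') \<union> S" using un by auto
      then show ?thesis unfolding J_def mem_Collect_eq by (intro bexI)
    qed
    moreover have "I \<subseteq> J" unfolding J_def by blast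
    moreover have "J \<subseteq> Pow W" using IW S unfolding J_def by auto
    moreover have "B \<in> J" if "A \<in> J" "B \<subseteq> A" for A B
      using that unfolding J_def by blast
    moreover have "\<H> \<subseteq> J" using HI \<open>I \<subseteq> J\<close> by simp
    ultimately have "J \<in> \<I>" unfolding \<I>_def by simp
    then have "J = I" using max \<open>I \<subseteq> J\<close> by simp
    moreover have "S \<in> J" using HI assms(3) unfolding J_def by auto
    ultimately show False using neg by blast
  qed
  then show thesis using that[of I] HI WI down un by simp
qed

text \<open>
  \<open>generic I W n\<close> is the iterated quantifier ``for almost all \<open>x\<^sub>1 \<in> W\<close>, \<dots>, for almost all
  \<open>x\<^sub>n \<in> W\<close>'' with respect to the ultrafilter dual to \<open>I\<close>.
\<close>

fun generic :: "'x set set \<Rightarrow> 'x set \<Rightarrow> nat \<Rightarrow> ('x list \<Rightarrow> bool) \<Rightarrow> bool" where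
  "generic I W 0 \<chi> \<longleftrightarrow> \<chi> []"
| "generic I W (Suc n) \<chi> \<longleftrightarrow> {x \<in> W. \<not> generic I W n (\<lambda>ss. \<chi> (x # ss))} \<in> I"

locale prime_ideal =
  fixes I :: "'x set set" and W :: "'x set"
  assumes proper: "W \<notin> I" and empty: "{} \<in> I"
    and down: "A \<in> I \<Longrightarrow> B \<subseteq> A \<Longrightarrow> B \<in> I" and Un: "A \<in> I \<Longrightarrow> B \<in> I \<Longrightarrow> A \<union> B \<in> I"
    and prime: "S \<subseteq> W \<Longrightarrow> S \<in> I \<or> W - S \<in> I"
begin

lemma generic_True: "generic I W n (\<lambda>_. True)"
  by (induction n) (auto simp: empty)

lemma generic_conj: "generic I W n \<chi> \<Longrightarrow> generic I W n \<chi>' \<Longrightarrow> generic I W n (\<lambda>ss. \<chi> ss \<and> \<chi>' ss)"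
proof (induction n arbitrary: \<chi> \<chi>')
  case (Suc n)
  have "{x \<in> W. \<not> generic I W n (\<lambda>ss. \<chi> (x # ss) \<and> \<chi>' (x # ss))} \<subseteq>
      {x \<in> W. \<not> generic I W n (\<lambda>ss. \<chi> (x # ss))} \<union> {x \<in> W. \<not> generic I W n (\<lambda>ss. \<chi>' (x # ss))}"
    using Suc.IH by blast
  moreover have "{x \<in> W. \<not> generic I W n (\<lambda>ss. \<chi> (x # ss))} \<union>
      {x \<in> W. \<not> generic I W n (\<lambda>ss. \<chi>' (x # ss))} \<in> I"
    by (rule Un) (use Suc.prems in simp_all)
  ultimately show ?case unfolding generic.simps by (rule down[rotated])
qed simp

lemma generic_ball:
  "finite A \<Longrightarrow> (\<And>a. a \<in> A \<Longrightarrow> generic I W n (\<chi> a)) \<Longrightarrow> generic I W n (\<lambda>ss. \<forall>a \<in> A. \<chi> a ss)"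
proof (induction A rule: finite_induct)
  case empty
  then show ?case using generic_True by simp
next
  case (insert a A)
  then show ?case using generic_conj[of n "\<chi> a" "\<lambda>ss. \<forall>a \<in> A. \<chi> a ss"] by simp
qed

text \<open>Primeness lets negation pass through the nested quantifiers. A property that is not
  generic therefore has a generic negation, which can be used as a hypothesis.\<close>

lemma generic_cases: "generic I W n \<chi> \<or> generic I W n (\<lambda>ss. \<not> \<chi> ss)"
proof (induction n arbitrary: \<chi>)
  case (Suc n)
  let ?S = "{x \<in> W. \<not> generic I W n (\<lambda>ss. \<chi> (x # ss))}"
  have "?S \<in> I \<or> W - ?S \<in> I" by (rule prime) blast
  moreover have "{x \<in> W. \<not> generic I W n (\<lambda>ss. \<not> \<chi> (x # ss))} \<subseteq> W - ?S"
    using Suc.IH by blast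
  ultimately have "?S \<in> I \<or> {x \<in> W. \<not> generic I W n (\<lambda>ss. \<not> \<chi> (x # ss))} \<in> I"
    by (elim disjE) (simp, rule disjI2, erule down)
  then show ?case by simp
qed simp

lemma generic_Suc_ex: "generic I W (Suc n) \<chi> \<Longrightarrow> \<exists>x \<in> W. generic I W n (\<lambda>ss. \<chi> (x # ss))"
proof (rule ccontr)
  assume "generic I W (Suc n) \<chi>" and "\<not> (\<exists>x \<in> W. generic I W n (\<lambda>ss. \<chi> (x # ss)))"
  moreover from this have "{x \<in> W. \<not> generic I W n (\<lambda>ss. \<chi> (x # ss))} = W" by blast
  ultimately show False using proper by simp
qed

lemma generic_ex: "generic I W n \<chi> \<Longrightarrow> \<exists>ss. length ss = n \<and> set ss \<subseteq> W \<and> \<chi> ss"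
proof (induction n arbitrary: \<chi>)
  case (Suc n)
  then obtain x where x: "x \<in> W" "generic I W n (\<lambda>ss. \<chi> (x # ss))" using generic_Suc_ex by blast
  then obtain ss where "length ss = n" "set ss \<subseteq> W" "\<chi> (x # ss)" using Suc.IH by blast
  then show ?case using x(1) by (intro exI[of _ "x # ss"]) auto
qed simp

end

section \<open>Honest definitions: approximation by instances inside the set\<close>

definition inner_approximable ::
  "('f, 'r) signature \<Rightarrow> ('f, 'r, 'a) struct \<Rightarrow> nat \<Rightarrow> 'a list set \<Rightarrow> 'a list set \<Rightarrow> bool" where
  "inner_approximable L M k W H \<longleftrightarrow>
     (\<exists>q (R :: ('f, 'r, 'a) struct \<Rightarrow> 'a list \<Rightarrow> bool). expressible L (k + q) R \<and>
       (\<forall>A \<subseteq> H. finite A \<longrightarrow> (\<exists>d \<in> tuples q (univ M). A \<subseteq> sect M R k d \<and> sect M R k d \<subseteq> W)))"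

text \<open>What an externally definable set leaves behind in \<open>M\<close>: its finite traces
  are traces of instances of one formula over \<open>M\<close>. With this notion the approximation
  applies to sets derived from \<open>X\<close> without constructing elementary extensions for
  them.\<close>

definition locally_definable ::
  "('f, 'r) signature \<Rightarrow> ('f, 'r, 'a) struct \<Rightarrow> nat \<Rightarrow> 'a list set \<Rightarrow> bool" where
  "locally_definable L M k W \<longleftrightarrow> W \<subseteq> tuples k (univ M) \<and>
     (\<exists>q (R :: ('f, 'r, 'a) struct \<Rightarrow> 'a list \<Rightarrow> bool). expressible L (k + q) R \<and>
       (\<forall>A \<subseteq> tuples k (univ M). finite A \<longrightarrow> (\<exists>c \<in> tuples q (univ M). A \<inter> sect M R k c = A \<inter> W)))"

lemma inner_approximable_subset:
  "inner_approximable L M k W H \<Longrightarrow> H' \<subseteq> H \<Longrightarrow> inner_approximable L M k W H'"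
  unfolding inner_approximable_def by (meson subset_trans)

lemma inner_approximable_empty: "inner_approximable L M k W {}"
  unfolding inner_approximable_def
  by (intro exI[of _ 0] exI[of _ "\<lambda>_ _. False"]) (auto simp: expressible_const tuples_0 sect_def)

lemma expressible_pair_left:
  assumes "expressible L (n + q1) R"
  shows "expressible L (n + (q1 + q2)) (\<lambda>M xs. R M (take (n + q1) xs))"
  using expressible_blocks[of L "[(0, n + q1)]" R "n + (q1 + q2)"] assms by simp

lemma expressible_pair_right:
  assumes "expressible L (n + q2) R"
  shows "expressible L (n + (q1 + q2)) (\<lambda>M xs. R M (take n xs @ take q2 (drop (n + q1) xs)))"
  using expressible_blocks[of L "[(0, n), (n + q1, q2)]" R "n + (q1 + q2)"] assms by simp

text \<open>Together with the lemmas on subsets and on the empty set this makes the approximable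
  \<open>H\<close> inside \<open>W\<close> an ideal, which is why \<open>H\<close> is kept apart
  from \<open>W\<close>. The disjunction of both formulas, with the parameter blocks side by side,
  serves for the union.\<close>

lemma inner_approximable_Un:
  fixes M :: "('f, 'r, 'a) struct"
  assumes "inner_approximable L M k W H1" "inner_approximable L M k W H2"
  shows "inner_approximable L M k W (H1 \<union> H2)"
proof -
  obtain q1 R1 where 1: "expressible L (k + q1) (R1 :: ('f, 'r, 'a) struct \<Rightarrow> _)"
    "\<And>A. A \<subseteq> H1 \<Longrightarrow> finite A \<Longrightarrow> \<exists>d \<in> tuples q1 (univ M). A \<subseteq> sect M R1 k d \<and> sect M R1 k d \<subseteq> W"
    using assms(1) unfolding inner_approximable_def by blast
  obtain q2 R2 where 2: "expressible L (k + q2) (R2 :: ('f, 'r, 'a) struct \<Rightarrow> _)"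
    "\<And>A. A \<subseteq> H2 \<Longrightarrow> finite A \<Longrightarrow> \<exists>d \<in> tuples q2 (univ M). A \<subseteq> sect M R2 k d \<and> sect M R2 k d \<subseteq> W"
    using assms(2) unfolding inner_approximable_def by blast
  define R where "R = (\<lambda>M xs. R1 M (take (k + q1) xs) \<or> R2 M (take k xs @ take q2 (drop (k + q1) xs)))"
  have R: "expressible L (k + (q1 + q2)) R"
    unfolding R_def by (intro expressible_disj expressible_pair_left expressible_pair_right 1 2)
  have sect: "sect M R k (d1 @ d2) = sect M R1 k d1 \<union> sect M R2 k d2"
    if "d1 \<in> tuples q1 (univ M)" "d2 \<in> tuples q2 (univ M)" for d1 d2
    using that by (auto simp: sect_def R_def tuples_def)
  have "\<exists>d \<in> tuples (q1 + q2) (univ M). A \<subseteq> sect M R k d \<and> sect M R k d \<subseteq> W"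
    if A: "A \<subseteq> H1 \<union> H2" "finite A" for A
  proof -
    obtain d1 where d1: "d1 \<in> tuples q1 (univ M)" "A \<inter> H1 \<subseteq> sect M R1 k d1" "sect M R1 k d1 \<subseteq> W"
      using 1(2)[of "A \<inter> H1"] A(2) by auto
    obtain d2 where d2: "d2 \<in> tuples q2 (univ M)" "A \<inter> H2 \<subseteq> sect M R2 k d2" "sect M R2 k d2 \<subseteq> W"
      using 2(2)[of "A \<inter> H2"] A(2) by auto
    show ?thesis
      using tuples_append[OF d1(1) d2(1)] sect[OF d1(1) d2(1)] d1 d2 A(1)
      by (intro bexI[of _ "d1 @ d2"]) auto
  qed
  then show ?thesis unfolding inner_approximable_def using R by blast
qed

text \<open>Parameters from \<open>M\<close> are allowed because coordinates already chosen are
  moved into them.\<close>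

definition definable_on_lists ::
  "('f, 'r) signature \<Rightarrow> ('f, 'r, 'a) struct \<Rightarrow> nat \<Rightarrow> nat \<Rightarrow> ('a list list \<Rightarrow> bool) \<Rightarrow> bool" where
  "definable_on_lists L M k n \<chi> \<longleftrightarrow>
     (\<exists>q (R :: ('f, 'r, 'a) struct \<Rightarrow> 'a list \<Rightarrow> bool). \<exists>m \<in> tuples q (univ M). expressible L (n * k + q) R \<and>
       (\<forall>ss. length ss = n \<longrightarrow> set ss \<subseteq> tuples k (univ M) \<longrightarrow> (\<chi> ss \<longleftrightarrow> R M (concat ss @ m))))"

lemma definable_on_lists_True: "definable_on_lists L M k n (\<lambda>_. True)"
  unfolding definable_on_lists_def
  by (intro exI[of _ 0] exI[of _ "\<lambda>_ _. True"]) (simp add: expressible_True tuples_0)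

lemma definable_on_lists_conj:
  fixes M :: "('f, 'r, 'a) struct"
  assumes "definable_on_lists L M k n \<chi>1" "definable_on_lists L M k n \<chi>2"
  shows "definable_on_lists L M k n (\<lambda>ss. \<chi>1 ss \<and> \<chi>2 ss)"
proof -
  obtain q1 R1 m1 where 1: "expressible L (n * k + q1) (R1 :: ('f, 'r, 'a) struct \<Rightarrow> _)" "m1 \<in> tuples q1 (univ M)"
    "\<And>ss. length ss = n \<Longrightarrow> set ss \<subseteq> tuples k (univ M) \<Longrightarrow> \<chi>1 ss \<longleftrightarrow> R1 M (concat ss @ m1)"
    using assms(1) unfolding definable_on_lists_def by blast
  obtain q2 R2 m2 where 2: "expressible L (n * k + q2) (R2 :: ('f, 'r, 'a) struct \<Rightarrow> _)" "m2 \<in> tuples q2 (univ M)"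
    "\<And>ss. length ss = n \<Longrightarrow> set ss \<subseteq> tuples k (univ M) \<Longrightarrow> \<chi>2 ss \<longleftrightarrow> R2 M (concat ss @ m2)"
    using assms(2) unfolding definable_on_lists_def by blast
  define R where "R = (\<lambda>M xs. R1 M (take (n * k + q1) xs) \<and>
    R2 M (take (n * k) xs @ take q2 (drop (n * k + q1) xs)))"
  have R: "expressible L (n * k + (q1 + q2)) R"
    unfolding R_def by (intro expressible_conj expressible_pair_left expressible_pair_right 1 2)
  have "\<chi>1 ss \<and> \<chi>2 ss \<longleftrightarrow> R M (concat ss @ (m1 @ m2))"
    if ss: "length ss = n" "set ss \<subseteq> tuples k (univ M)" for ss
    using tuples_length[OF concat_tuples[OF ss(2)]] ss 1 2 by (simp add: R_def tuples_length)
  then show ?thesis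
    unfolding definable_on_lists_def using R tuples_append[OF 1(2) 2(2)]
    by (intro exI[of _ "q1 + q2"] exI[of _ R] bexI[of _ "m1 @ m2"]) simp_all
qed

lemma definable_on_lists_ball:
  "finite A \<Longrightarrow> (\<And>a. a \<in> A \<Longrightarrow> definable_on_lists L M k n (\<chi> a)) \<Longrightarrow>
    definable_on_lists L M k n (\<lambda>ss. \<forall>a \<in> A. \<chi> a ss)"
proof (induction A rule: finite_induct)
  case empty
  then show ?case using definable_on_lists_True by simp
next
  case (insert a A)
  then show ?case using definable_on_lists_conj[of L M k n "\<chi> a" "\<lambda>ss. \<forall>a \<in> A. \<chi> a ss"] by simp
qed

lemma definable_on_lists_Cons:
  fixes M :: "('f, 'r, 'a) struct"
  assumes "definable_on_lists L M k (Suc n) \<chi>" and x: "x \<in> tuples k (univ M)"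
  shows "definable_on_lists L M k n (\<lambda>ss. \<chi> (x # ss))"
proof -
  obtain q R m where 1: "expressible L (Suc n * k + q) (R :: ('f, 'r, 'a) struct \<Rightarrow> _)" "m \<in> tuples q (univ M)"
    "\<And>ss. length ss = Suc n \<Longrightarrow> set ss \<subseteq> tuples k (univ M) \<Longrightarrow> \<chi> ss \<longleftrightarrow> R M (concat ss @ m)"
    using assms(1) unfolding definable_on_lists_def by blast
  define R' where "R' = (\<lambda>M xs. R M (take k (drop (n * k) xs) @ take (n * k) xs @ take q (drop (n * k + k) xs)))"
  have R': "expressible L (n * k + (k + q)) R'"
    unfolding R'_def
    using 1(1) expressible_blocks[of L "[(n * k, k), (0, n * k), (n * k + k, q)]" R "n * k + (k + q)"]
    by (simp add: algebra_simps)
  have "\<chi> (x # ss) \<longleftrightarrow> R' M (concat ss @ (x @ m))"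
    if ss: "length ss = n" "set ss \<subseteq> tuples k (univ M)" for ss
    using tuples_length[OF concat_tuples[OF ss(2)]] ss 1(3)[of "x # ss"] x tuples_length[OF x]
      tuples_length[OF 1(2)] by (simp add: R'_def)
  then show ?thesis
    unfolding definable_on_lists_def using R' tuples_append[OF x 1(2)]
    by (intro exI[of _ "k + q"] exI[of _ R'] bexI[of _ "x @ m"]) simp_all
qed

text \<open>
  The coordinates outside \<open>W\<close> are chosen from the last to the first: if \<open>s\<^sub>0\<close> has to avoid \<open>W\<close>, a
  finite set \<open>A\<close> of generic points that no \<open>\<chi>\<close>-section inside \<open>W\<close> covers is fixed first, then the
  remaining coordinates are chosen so that their \<open>\<chi>\<close>-section covers \<open>A\<close>.
\<close>

lemma generic_realises_pattern:
  assumes "prime_ideal I W" and W: "W \<subseteq> tuples k (univ M)"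
    and inner: "\<And>H. H \<subseteq> W \<Longrightarrow> inner_approximable L M k W H \<Longrightarrow> H \<in> I"
    and "definable_on_lists L M k (length \<sigma>) \<chi>" "generic I W (length \<sigma>) \<chi>"
  shows "\<exists>ss. length ss = length \<sigma> \<and> set ss \<subseteq> tuples k (univ M) \<and> \<chi> ss \<and>
    (\<forall>j < length \<sigma>. ss ! j \<in> W \<longleftrightarrow> \<sigma> ! j)"
  using assms(4,5)
proof (induction \<sigma> arbitrary: \<chi>)
  case Nil
  then show ?case by simp
next
  case (Cons s \<sigma>)
  interpret prime_ideal I W by fact
  let ?n = "length \<sigma>" and ?T = "tuples k (univ M)"
  have Cons_ok: "\<exists>ss. length ss = length (s # \<sigma>) \<and> set ss \<subseteq> ?T \<and> \<chi> ss \<and>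
      (\<forall>j < length (s # \<sigma>). ss ! j \<in> W \<longleftrightarrow> (s # \<sigma>) ! j)"
    if "x \<in> ?T" "x \<in> W \<longleftrightarrow> s" "length ss = ?n" "set ss \<subseteq> ?T" "\<chi> (x # ss)"
      "\<forall>j < ?n. ss ! j \<in> W \<longleftrightarrow> \<sigma> ! j" for x ss
    using that by (intro exI[of _ "x # ss"]) (auto simp: less_Suc_eq_0_disj)
  have dCons: "definable_on_lists L M k ?n (\<lambda>ss. \<chi> (x # ss))" if "x \<in> ?T" for x
    using definable_on_lists_Cons[of L M k ?n \<chi> x] Cons.prems(1) that by simp
  show ?case
  proof (cases s)
    case True
    obtain x where x: "x \<in> W" "generic I W ?n (\<lambda>ss. \<chi> (x # ss))"
      using generic_Suc_ex Cons.prems(2) by auto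
    have xT: "x \<in> ?T" using x(1) W by blast
    obtain ss where "length ss = ?n" "set ss \<subseteq> ?T" "\<chi> (x # ss)" "\<forall>j < ?n. ss ! j \<in> W \<longleftrightarrow> \<sigma> ! j"
      using Cons.IH[OF dCons[OF xT] x(2)] by blast
    then show ?thesis using Cons_ok[OF xT] x(1) True by simp
  next
    case False
    define B where "B = {x \<in> W. generic I W ?n (\<lambda>ss. \<chi> (x # ss))}"
    have "B \<notin> I"
    proof
      assume "B \<in> I"
      moreover have "{x \<in> W. \<not> generic I W ?n (\<lambda>ss. \<chi> (x # ss))} \<in> I" using Cons.prems(2) by simp
      ultimately have "B \<union> {x \<in> W. \<not> generic I W ?n (\<lambda>ss. \<chi> (x # ss))} \<in> I" by (rule Un)
      moreover have "B \<union> {x \<in> W. \<not> generic I W ?n (\<lambda>ss. \<chi> (x # ss))} = W" unfolding B_def by blast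
      ultimately show False using proper by simp
    qed
    moreover have "B \<subseteq> W" unfolding B_def by blast
    ultimately have notin: "\<not> inner_approximable L M k W B" using inner[of B] by blast
    have "definable_on_lists L M k (Suc ?n) \<chi>" using Cons.prems(1) by simp
    then obtain q R m where R: "expressible L (Suc ?n * k + q) R" "m \<in> tuples q (univ M)"
      "\<And>ss. length ss = Suc ?n \<Longrightarrow> set ss \<subseteq> ?T \<Longrightarrow> \<chi> ss \<longleftrightarrow> R M (concat ss @ m)"
      unfolding definable_on_lists_def by blast
    \<comment> \<open>The formula of \<open>\<chi>\<close> is read with its first block as the
      point, and with the other blocks and \<open>m\<close> as the parameter. It cannot approximate
      \<open>B\<close>, and a finite \<open>A\<close> witnesses this.\<close>
    have "expressible L (k + (?n * k + q)) R" using R(1) by (simp add: algebra_simps)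
    then have "\<not> (\<forall>A \<subseteq> B. finite A \<longrightarrow>
        (\<exists>d \<in> tuples (?n * k + q) (univ M). A \<subseteq> sect M R k d \<and> sect M R k d \<subseteq> W))"
      using notin unfolding inner_approximable_def by metis
    then obtain A where A: "A \<subseteq> B" "finite A"
      "\<And>d. d \<in> tuples (?n * k + q) (univ M) \<Longrightarrow> A \<subseteq> sect M R k d \<Longrightarrow> \<not> sect M R k d \<subseteq> W"
      by auto
    have AT: "A \<subseteq> ?T" using A(1) W unfolding B_def by blast
    have "definable_on_lists L M k ?n (\<lambda>ss. \<forall>x \<in> A. \<chi> (x # ss))"
      using dCons AT by (intro definable_on_lists_ball A) blast
    moreover have "generic I W ?n (\<lambda>ss. \<forall>x \<in> A. \<chi> (x # ss))"
      using A(1) unfolding B_def by (intro generic_ball A(2)) auto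
    ultimately have "\<exists>ss. length ss = ?n \<and> set ss \<subseteq> ?T \<and> (\<forall>x \<in> A. \<chi> (x # ss)) \<and>
        (\<forall>j < ?n. ss ! j \<in> W \<longleftrightarrow> \<sigma> ! j)"
      by (rule Cons.IH)
    then obtain ss where ss: "length ss = ?n" "set ss \<subseteq> ?T" "\<forall>x \<in> A. \<chi> (x # ss)"
      "\<forall>j < ?n. ss ! j \<in> W \<longleftrightarrow> \<sigma> ! j"
      by blast
    have sect: "x \<in> sect M R k (concat ss @ m) \<longleftrightarrow> \<chi> (x # ss)" if "x \<in> ?T" for x
      using that R(3)[of "x # ss"] ss(1,2) by (simp add: sect_def)
    have "concat ss @ m \<in> tuples (?n * k + q) (univ M)"
      using tuples_append[OF concat_tuples[OF ss(2)] R(2)] ss(1) by simp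
    moreover have "A \<subseteq> sect M R k (concat ss @ m)" using sect AT ss(3) by blast
    ultimately have "\<not> sect M R k (concat ss @ m) \<subseteq> W" by (rule A(3))
    then obtain x where x: "x \<in> sect M R k (concat ss @ m)" "x \<notin> W" by blast
    moreover from x(1) have "x \<in> ?T" by (simp add: sect_def)
    ultimately have "x \<in> ?T" "x \<notin> W" "\<chi> (x # ss)" using sect by simp_all
    then show ?thesis using Cons_ok[of x ss] ss False by simp
  qed
qed

text \<open>If \<open>W\<close> were not approximable, its approximable subsets would lie in a prime
  ideal without \<open>W\<close>. For generic n-tuples each pattern \<open>S\<close> is then
  realised by a parameter: otherwise the absence of such a parameter would be a generic definable
  property, hence shared by a tuple whose entries in \<open>W\<close> are exactly those at positions
  in \<open>S\<close>, and there the local definition of \<open>W\<close> does realise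
  \<open>S\<close>. So one tuple realises all patterns, against NIP.\<close>

theorem honest_definition:
  fixes M :: "('f, 'r, 'a) struct"
  assumes M: "is_struct L M" and NIP: "NIP TYPE('a) L (Th L M)" and W: "locally_definable L M k W"
  shows "inner_approximable L M k W W"
proof (rule ccontr)
  assume notin: "\<not> inner_approximable L M k W W"
  let ?T = "tuples k (univ M)"
  obtain q R where R: "expressible L (k + q) (R :: ('f, 'r, 'a) struct \<Rightarrow> _)"
    and loc: "\<And>A. A \<subseteq> ?T \<Longrightarrow> finite A \<Longrightarrow> \<exists>c \<in> tuples q (univ M). A \<inter> sect M R k c = A \<inter> W"
    and WT: "W \<subseteq> ?T"
    using W unfolding locally_definable_def by blast
  obtain n where n: "\<And>A. A \<subseteq> ?T \<Longrightarrow> finite A \<Longrightarrow> card A = n \<Longrightarrow>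
      \<not> shattered A {sect M R k c |c. c \<in> tuples q (univ M)}"
    using NIP_expressible[OF M NIP R] by blast
  let ?H = "{H. H \<subseteq> W \<and> inner_approximable L M k W H}"
  obtain I where I: "?H \<subseteq> I" "W \<notin> I" "\<And>A B. A \<in> I \<Longrightarrow> B \<subseteq> A \<Longrightarrow> B \<in> I"
    "\<And>A B. A \<in> I \<Longrightarrow> B \<in> I \<Longrightarrow> A \<union> B \<in> I" "\<And>S. S \<subseteq> W \<Longrightarrow> S \<in> I \<or> W - S \<in> I"
  proof (rule maximal_ideal[of ?H W])
    show "W \<notin> ?H" using notin by simp
    show "{} \<in> ?H" using inner_approximable_empty by auto
    show "\<And>A B. A \<in> ?H \<Longrightarrow> B \<subseteq> A \<Longrightarrow> B \<in> ?H" using inner_approximable_subset by blast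
    show "\<And>A B. A \<in> ?H \<Longrightarrow> B \<in> ?H \<Longrightarrow> A \<union> B \<in> ?H" using inner_approximable_Un by blast
  qed auto
  have "{} \<in> I" using I(1) inner_approximable_empty by blast
  interpret prime_ideal I W
    by (rule prime_ideal.intro[OF I(2) \<open>{} \<in> I\<close> I(3-5)])
  define \<chi> where "\<chi> S ss \<longleftrightarrow> (\<exists>c \<in> tuples q (univ M). \<forall>j \<in> {..<n}. R M (ss ! j @ c) \<longleftrightarrow> j \<in> S)"
    for S :: "nat set" and ss
  have gen: "generic I W n (\<chi> S)" if "S \<subseteq> {..<n}" for S
  proof (rule ccontr)
    assume "\<not> generic I W n (\<chi> S)"
    then have g: "generic I W n (\<lambda>ss. \<not> \<chi> S ss)" using generic_cases by blast
    let ?\<sigma> = "map (\<lambda>j. j \<in> S) [0..<n]"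
    have "definable_on_lists L M k n (\<lambda>ss. \<not> \<chi> S ss)"
      unfolding definable_on_lists_def
    proof (intro exI bexI conjI allI impI)
      show "expressible L (n * k + 0) (\<lambda>M zs. \<not> (\<exists>c \<in> tuples q (univ M).
          \<forall>j \<in> {..<n}. R M (take k (drop (j * k) zs) @ c) \<longleftrightarrow> j \<in> S))"
        unfolding add_0_right by (intro expressible_not expressible_ex_pattern R)
      show "[] \<in> tuples 0 (univ M)" by (simp add: tuples_0)
      fix ss assume ss: "length ss = n" "set ss \<subseteq> ?T"
      have len: "length x = k" if "x \<in> set ss" for x using that ss(2) by (auto simp: tuples_def)
      have "take k (drop (j * k) (concat ss)) = ss ! j" if "j \<in> {..<n}" for j
        using take_drop_concat[OF len] that ss(1) by simp
      then show "\<not> \<chi> S ss \<longleftrightarrow> \<not> (\<exists>c \<in> tuples q (univ M).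
          \<forall>j \<in> {..<n}. R M (take k (drop (j * k) (concat ss @ [])) @ c) \<longleftrightarrow> j \<in> S)"
        unfolding \<chi>_def by simp
    qed
    then have "\<exists>ss. length ss = length ?\<sigma> \<and> set ss \<subseteq> ?T \<and> \<not> \<chi> S ss \<and>
        (\<forall>j < length ?\<sigma>. ss ! j \<in> W \<longleftrightarrow> ?\<sigma> ! j)"
      using g I(1) by (intro generic_realises_pattern[OF prime_ideal_axioms WT]) auto
    then obtain ss where ss: "length ss = n" "set ss \<subseteq> ?T" "\<not> \<chi> S ss" "\<forall>j < n. ss ! j \<in> W \<longleftrightarrow> j \<in> S"
      by auto
    obtain c where c: "c \<in> tuples q (univ M)" "set ss \<inter> sect M R k c = set ss \<inter> W"
      using loc[of "set ss"] ss(2) by auto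
    have "R M (ss ! j @ c) \<longleftrightarrow> j \<in> S" if "j < n" for j
    proof -
      have "ss ! j \<in> set ss" using that ss(1) by auto
      then have "R M (ss ! j @ c) \<longleftrightarrow> ss ! j \<in> W" using c(2) ss(2) unfolding sect_def by blast
      then show ?thesis using ss(4) that by blast
    qed
    then show False using ss(3) c(1) unfolding \<chi>_def by auto
  qed
  then have "generic I W n (\<lambda>ss. \<forall>S \<in> Pow {..<n}. \<chi> S ss)" by (intro generic_ball) auto
  then obtain ss where ss: "length ss = n" "set ss \<subseteq> W" "\<forall>S \<in> Pow {..<n}. \<chi> S ss"
    using generic_ex by blast
  have "distinct ss"
    unfolding distinct_conv_nth
  proof (intro allI impI)
    fix i j assume ij: "i < length ss" "j < length ss" "i \<noteq> j"
    have "\<chi> {i} ss" using ss ij by simp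
    then obtain c where "\<forall>l \<in> {..<n}. R M (ss ! l @ c) \<longleftrightarrow> l \<in> {i}" unfolding \<chi>_def by blast
    then have "R M (ss ! i @ c)" "\<not> R M (ss ! j @ c)" using ij ss(1) by auto
    then show "ss ! i \<noteq> ss ! j" by auto
  qed
  moreover have "set ss \<subseteq> ?T" using ss(2) WT by blast
  ultimately have "shattered (set ss) {sect M R k c |c. c \<in> tuples q (univ M)}"
    using shattered_list_iff[of ss k M R q] ss unfolding \<chi>_def by simp
  then show False using n[OF \<open>set ss \<subseteq> ?T\<close>] distinct_card[OF \<open>distinct ss\<close>] ss(1) by simp
qed

section \<open>Cofinal families of small sets\<close>

text \<open>The Sauer-Shelah lemma with a crude bound. After removal of \<open>x\<close> each trace
  counts once in \<open>Y0 \<union> Y1\<close>, and those that extend in both ways count again in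
  \<open>Y0 \<inter> Y1\<close>. A set shattered by the latter can be enlarged by \<open>x\<close>,
  so there the exponent drops by one.\<close>

lemma card_le_if_not_shattered:
  assumes "finite T" "Y \<subseteq> Pow T" "\<And>A. A \<subseteq> T \<Longrightarrow> card A = d \<Longrightarrow> \<not> shattered A Y"
  shows "card Y \<le> (card T + 1) ^ d"
  using assms
proof (induction T arbitrary: Y d rule: finite_induct)
  case empty
  then have "card Y \<le> card {{} :: 'a set}" by (intro card_mono) auto
  then show ?case by simp
next
  case (insert x T)
  show ?case
  proof (cases d)
    case 0
    have "\<not> shattered {} Y" using insert.prems(2)[of "{}"] 0 by simp
    then have "Y = {}" unfolding shattered_def by auto
    then show ?thesis by simp
  next
    case (Suc e)
    define Y0 where "Y0 = {S \<in> Y. x \<notin> S}"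
    define Y1 where "Y1 = (\<lambda>S. S - {x}) ` {S \<in> Y. x \<in> S}"
    have finY: "finite Y" using insert.prems(1) insert.hyps(1) finite_subset by fastforce
    have inj: "inj_on (\<lambda>S. S - {x}) {S \<in> Y. x \<in> S}"
      by (rule inj_onI) blast
    have "card Y = card Y0 + card {S \<in> Y. x \<in> S}"
      unfolding Y0_def using finY by (subst card_Un_disjoint[symmetric]) (auto intro: arg_cong[where f = card])
    also have "\<dots> = card Y0 + card Y1" unfolding Y1_def using card_image[OF inj] by simp
    also have "\<dots> = card (Y0 \<union> Y1) + card (Y0 \<inter> Y1)"
      using finY by (intro card_Un_Int) (simp_all add: Y0_def Y1_def)
    finally have split: "card Y = card (Y0 \<union> Y1) + card (Y0 \<inter> Y1)" .
    have sub: "Y0 \<union> Y1 \<subseteq> Pow T" using insert.prems(1) unfolding Y0_def Y1_def by auto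
    have "card (Y0 \<union> Y1) \<le> (card T + 1) ^ Suc e"
    proof (rule insert.IH[OF sub])
      fix A assume A: "A \<subseteq> T" "card A = Suc e"
      show "\<not> shattered A (Y0 \<union> Y1)"
      proof
        assume sh: "shattered A (Y0 \<union> Y1)"
        have "shattered A Y"
          unfolding shattered_def
        proof (intro allI impI)
          fix S assume "S \<subseteq> A"
          then obtain B where B: "B \<in> Y0 \<union> Y1" "B \<inter> A = S" using sh unfolding shattered_def by blast
          have "x \<notin> A" using A(1) insert.hyps(2) by blast
          then obtain B' where "B' \<in> Y" "B' \<inter> A = B \<inter> A"
            using B(1) unfolding Y0_def Y1_def by blast
          then show "\<exists>B \<in> Y. B \<inter> A = S" using B(2) by blast
        qed
        then show False using insert.prems(2)[of A] A Suc by auto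
      qed
    qed
    moreover have "card (Y0 \<inter> Y1) \<le> (card T + 1) ^ e"
    proof (rule insert.IH)
      show "Y0 \<inter> Y1 \<subseteq> Pow T" using sub by blast
      fix A assume A: "A \<subseteq> T" "card A = e"
      show "\<not> shattered A (Y0 \<inter> Y1)"
      proof
        assume sh: "shattered A (Y0 \<inter> Y1)"
        have xA: "x \<notin> A" using A(1) insert.hyps(2) by blast
        have "shattered (insert x A) Y"
          unfolding shattered_def
        proof (intro allI impI)
          fix S assume S: "S \<subseteq> insert x A"
          then have "S - {x} \<subseteq> A" by blast
          then obtain B where B: "B \<in> Y0" "B \<in> Y1" "B \<inter> A = S - {x}"
            using sh unfolding shattered_def by blast
          have "B \<in> Y" "x \<notin> B" using B(1) unfolding Y0_def by auto
          moreover have "insert x B \<in> Y" using B(2) \<open>x \<notin> B\<close> unfolding Y1_def by (auto simp: insert_absorb)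
          moreover have "B \<inter> insert x A = S" if "x \<notin> S" using that B(3) \<open>x \<notin> B\<close> by blast
          moreover have "insert x B \<inter> insert x A = S" if "x \<in> S" using that B(3) \<open>x \<notin> B\<close> xA by blast
          ultimately show "\<exists>B \<in> Y. B \<inter> insert x A = S" by (cases "x \<in> S") blast+
        qed
        moreover have "card (insert x A) = Suc e"
          using A xA finite_subset[OF A(1) insert.hyps(1)] by simp
        moreover have "insert x A \<subseteq> insert x T" using A(1) by blast
        ultimately show False using insert.prems(2)[of "insert x A"] Suc by simp
      qed
    qed
    ultimately have "card Y \<le> (card T + 1) ^ e * (card T + 2)" using split by (simp add: algebra_simps)
    also have "\<dots> \<le> (card T + 2) ^ e * (card T + 2)" by (intro mult_right_mono power_mono) auto
    also have "\<dots> = (card (insert x T) + 1) ^ d" using insert.hyps Suc by simp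
    finally show ?thesis .
  qed
qed

text \<open>Division by \<open>m ^ N\<close> leaves the growth of \<open>(1 + 1 / m) ^ N\<close>
  against a power of a linear term. With \<open>r\<close> the root of order \<open>d + 1\<close> of
  \<open>1 + 1 / m\<close>, it suffices that \<open>r ^ N\<close> exceeds the linear term itself;
  the order \<open>d + 1\<close> also covers \<open>d = 0\<close>.\<close>

lemma exponential_beats_polynomial:
  fixes m c d :: nat
  assumes "m \<ge> 1"
  obtains N where "m ^ N * (c * N + 1) ^ d < (m + 1) ^ N"
proof -
  define b :: real where "b = 1 + 1 / real m"
  have b: "b > 1" using assms by (simp add: b_def)
  define r where "r = root (Suc d) b"
  have r: "r > 1" "r ^ Suc d = b" using b by (simp_all add: r_def del: power_Suc)
  have "(\<lambda>n. real n / r ^ n) \<longlonglongrightarrow> 0"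
    using lim_n_over_pown[of r] r(1) by simp
  then have "\<forall>\<^sub>F n in sequentially. real n / r ^ n < 1 / (real c + 1)"
    by (rule order_tendstoD) simp
  then have "\<forall>\<^sub>F n in sequentially. real n / r ^ n < 1 / (real c + 1) \<and> n \<ge> 1"
    using eventually_ge_at_top by (rule eventually_conj)
  then obtain N where N: "real N / r ^ N < 1 / (real c + 1)" "N \<ge> 1"
    using eventually_happens'[OF sequentially_bot] by blast
  have rN: "r ^ N > 0" using r(1) by simp
  have "real c * real N + 1 \<le> real N * (real c + 1)" using N(2) by (simp add: algebra_simps)
  also have "\<dots> < r ^ N" using N(1) rN by (simp add: field_simps)
  finally have lt: "real c * real N + 1 < r ^ N" .
  have "(real c * real N + 1) ^ d \<le> (real c * real N + 1) ^ Suc d"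
    by (intro power_increasing) auto
  also have "\<dots> < (r ^ N) ^ Suc d" by (intro power_strict_mono lt) auto
  also have "\<dots> = b ^ N" by (metis power_mult mult.commute r(2))
  finally have "real m ^ N * (real c * real N + 1) ^ d < real m ^ N * b ^ N"
    using assms by (intro mult_strict_left_mono) auto
  also have "\<dots> = (real m + 1) ^ N"
    using assms by (simp add: b_def power_mult_distrib[symmetric] field_simps)
  finally have "real (m ^ N * (c * N + 1) ^ d) < real ((m + 1) ^ N)"
    by (simp add: add.commute)
  then show thesis using that[of N] by linarith
qed

section \<open>The combinatorial setting and its two notions of smallness\<close>

definition separated_by :: "'x set set \<Rightarrow> 'x set \<times> 'x set \<Rightarrow> 'x set" where
  "separated_by F \<theta> = {y. \<exists>B \<in> F. y \<in> B \<and> fst \<theta> \<subseteq> B \<and> snd \<theta> \<inter> B = {}}"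

text \<open>In \<open>tame\<close> the shattered points are the conditions \<open>(P, Q)\<close> and
  the parameters are the points \<open>y\<close>. The bound may depend on \<open>K\<close>, which
  will be the size of a sample plus that of a test set.\<close>

locale tame_cofinal_family =
  fixes \<kappa> :: "'c rel" and X :: "'x set" and F :: "'x set set"
  assumes Cinfinite: "Cinfinite \<kappa>" and large: "\<not> |X| \<le>o \<kappa>"
    and small: "B \<in> F \<Longrightarrow> |B| <o \<kappa>"
    and cofinal: "A \<subseteq> X \<Longrightarrow> finite A \<Longrightarrow> \<exists>B \<in> F. A \<subseteq> B"
    and tame: "\<exists>d. \<forall>\<Theta>. finite \<Theta> \<longrightarrow> card \<Theta> = d \<longrightarrow>
      \<Theta> \<subseteq> {(P, Q). P \<subseteq> X \<and> Q \<subseteq> X \<and> finite P \<and> finite Q \<and> card P \<le> K \<and> card Q \<le> K} \<longrightarrow>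
      \<not> shattered \<Theta> {{\<theta>. y \<in> separated_by F \<theta>} |y. y \<in> X}"
begin

text \<open>\<open>few\<close> sets are closed under unions of \<kappa> many, \<open>tiny\<close>
  ones in general only under finite unions, as \<kappa> may be singular. Exceptional points only
  have to be \<open>few\<close>; the strict bound keeps members of \<open>F\<close> from covering
  sets of size \<kappa>.\<close>

abbreviation few :: "'x set \<Rightarrow> bool" where "few S \<equiv> |S| \<le>o \<kappa>"
abbreviation tiny :: "'x set \<Rightarrow> bool" where "tiny S \<equiv> |S| <o \<kappa>"

lemma Card_order: "Card_order \<kappa>" and infinite_Field: "\<not> finite (Field \<kappa>)"
  using Cinfinite unfolding cinfinite_def by auto

lemma finite_less: "finite S \<Longrightarrow> |S| <o \<kappa>"
  using finite_ordLess_infinite[of "|S|" \<kappa>] Card_order infinite_Field card_of_Well_order[of S]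
  by (simp add: Field_card_of card_order_on_well_order_on)

lemma finite_le: "finite S \<Longrightarrow> |S| \<le>o \<kappa>"
  using finite_less ordLess_imp_ordLeq by blast

lemma few_subset: "few S \<Longrightarrow> S' \<subseteq> S \<Longrightarrow> few S'"
  using card_of_mono1 ordLeq_transitive by blast

lemma tiny_subset: "tiny S \<Longrightarrow> S' \<subseteq> S \<Longrightarrow> tiny S'"
  using card_of_mono1 ordLeq_ordLess_trans by blast

lemma few_UN: "|J| \<le>o \<kappa> \<Longrightarrow> (\<And>j. j \<in> J \<Longrightarrow> few (A j)) \<Longrightarrow> few (\<Union>j \<in> J. A j)"
  using card_of_UNION_ordLeq_infinite_Field[OF infinite_Field Card_order] by blast

lemma few_Un: "few S \<Longrightarrow> few S' \<Longrightarrow> few (S \<union> S')"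
  using card_of_Un_ordLeq_infinite_Field[OF infinite_Field _ _ Card_order] by blast

lemma tiny_Un: "tiny S \<Longrightarrow> tiny S' \<Longrightarrow> tiny (S \<union> S')"
  using card_of_Un_ordLess_infinite_Field[OF infinite_Field Card_order] by blast

lemma image_le: "|J| \<le>o \<kappa> \<Longrightarrow> |f ` J| \<le>o \<kappa>"
  using card_of_image ordLeq_transitive by blast

lemma tiny_UN: "finite V \<Longrightarrow> (\<And>v. v \<in> V \<Longrightarrow> tiny (A v)) \<Longrightarrow> tiny (\<Union>v \<in> V. A v)"
  by (induction V rule: finite_induct) (simp_all add: finite_less tiny_Un)

lemma tiny_pigeonhole:
  assumes "\<not> tiny A" "finite V" "f ` A \<subseteq> V"
  shows "\<exists>v. \<not> tiny {y \<in> A. f y = v}"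
proof (rule ccontr)
  assume "\<not> ?thesis"
  then have "tiny (\<Union>v \<in> V. {y \<in> A. f y = v})" by (intro tiny_UN[OF assms(2)]) blast
  moreover have "A \<subseteq> (\<Union>v \<in> V. {y \<in> A. f y = v})" using assms(3) by blast
  ultimately show False using tiny_subset assms(1) by blast
qed

lemma few_pigeonhole:
  assumes "\<not> few A" "finite V" "f ` A \<subseteq> V"
  shows "\<exists>v. \<not> few {y \<in> A. f y = v}"
proof (rule ccontr)
  assume "\<not> ?thesis"
  then have "few (\<Union>v \<in> V. {y \<in> A. f y = v})" by (intro few_UN[OF finite_le[OF assms(2)]]) blast
  moreover have "A \<subseteq> (\<Union>v \<in> V. {y \<in> A. f y = v})" using assms(3) by blast
  ultimately show False using few_subset assms(1) by blast
qed

text \<open>The set found has exactly \<kappa> elements: few enough to index a family on which a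
  sample can be tested, too many to be covered by a member of \<open>F\<close>.\<close>

lemma ex_few_not_tiny:
  assumes "\<not> few Z"
  obtains A where "A \<subseteq> Z" "few A" "\<not> tiny A"
proof -
  have "\<kappa> \<le>o |Z|"
    using assms Card_order card_of_Well_order[of Z]
    by (metis card_order_on_well_order_on not_ordLeq_iff_ordLess ordLess_imp_ordLeq)
  then have "|Field \<kappa>| \<le>o |Z|"
    using card_of_Field_ordIso[OF Card_order] ordIso_ordLeq_trans by blast
  then obtain f where f: "inj_on f (Field \<kappa>)" "f ` Field \<kappa> \<subseteq> Z"
    using card_of_ordLeq[of "Field \<kappa>" Z] by blast
  have "|f ` Field \<kappa>| =o |Field \<kappa>|"
    using card_of_ordIsoI[OF inj_on_imp_bij_betw[OF f(1)]] ordIso_symmetric by blast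
  then have "|f ` Field \<kappa>| =o \<kappa>" using card_of_Field_ordIso[OF Card_order] ordIso_transitive by blast
  then have "few (f ` Field \<kappa>)" "\<not> tiny (f ` Field \<kappa>)"
    using ordIso_imp_ordLeq not_ordLess_ordIso by blast+
  then show thesis using that f(2) by blast
qed

section \<open>Traces, samples and the exchange of a point\<close>

definition traces :: "'x set \<Rightarrow> 'x set \<Rightarrow> 'x set set" where
  "traces P G = {B \<inter> G |B. B \<in> F \<and> P \<subseteq> B}"

text \<open>The goal is the case of empty \<open>G\<close>, where freeness means that
  \<open>P\<close> is shattered, as some member of \<open>F\<close> contains \<open>P\<close>. The
  set \<open>G\<close> is carried along because each step of the induction needs the intersection
  with \<open>P\<close> to be independent of the trace on a test set.\<close>

definition free_over :: "'x set \<Rightarrow> 'x set \<Rightarrow> bool" where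
  "free_over P G \<longleftrightarrow> (\<forall>D \<in> traces P G. \<forall>A \<subseteq> P. \<exists>B \<in> F. B \<inter> G = D \<and> B \<inter> P = A)"

definition small_sets :: "nat \<Rightarrow> 'x set set" where
  "small_sets K = {G. G \<subseteq> X \<and> finite G \<and> card G \<le> K}"

text \<open>The order of quantifiers matters: the predictions \<open>t\<close> are fixed in advance,
  while the sample \<open>P\<close> may depend on the test family \<open>J\<close>. Every
  \<open>G\<close> in \<open>J\<close> has its own bad indices, at most a fraction 1/m of
  \<open>\<Omega>\<close>; an index may be bad for some \<open>G\<close> and good for others. The
  bound on \<open>J\<close> allows the exceptional points of all its members to be avoided
  together.\<close>

definition sample :: "nat \<Rightarrow> nat \<Rightarrow> nat \<Rightarrow> nat set \<Rightarrow> ('x set \<Rightarrow> nat \<Rightarrow> 'x set set) \<Rightarrow> bool" where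
  "sample k K m \<Omega> t \<longleftrightarrow> finite \<Omega> \<and> \<Omega> \<noteq> {} \<and>
     (\<forall>J. J \<subseteq> small_sets K \<longrightarrow> |J| \<le>o \<kappa> \<longrightarrow>
       (\<exists>P. (\<forall>i \<in> \<Omega>. P i \<subseteq> X \<and> finite (P i)) \<and>
         (\<forall>G \<in> J. m * card {i \<in> \<Omega>. \<not> (card (P i) = k \<and> traces (P i) G = t G i \<and> free_over (P i) G)} \<le> card \<Omega>)))"

lemma sampleD:
  assumes "sample k K m \<Omega> t" "J \<subseteq> small_sets K" "|J| \<le>o \<kappa>"
  shows "\<exists>P. (\<forall>i \<in> \<Omega>. P i \<subseteq> X \<and> finite (P i)) \<and>
    (\<forall>G \<in> J. m * card {i \<in> \<Omega>. \<not> (card (P i) = k \<and> traces (P i) G = t G i \<and> free_over (P i) G)} \<le> card \<Omega>)"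
  using assms unfolding sample_def by simp

lemma insert_small_sets: "G \<in> small_sets K \<Longrightarrow> y \<in> X \<Longrightarrow> insert y G \<in> small_sets (Suc K)"
  unfolding small_sets_def by (auto simp: card_insert_if)

text \<open>The bridge to \<open>tame\<close>: a trace containing the new point \<open>y\<close> is
  a condition on \<open>y\<close> of the form considered there.\<close>

lemma insert_mem_traces_iff:
  assumes "y \<notin> G" "D \<subseteq> G"
  shows "insert y D \<in> traces P (insert y G) \<longleftrightarrow> y \<in> separated_by F (P \<union> D, G - D)"
proof -
  have "insert y D = B \<inter> insert y G \<longleftrightarrow> y \<in> B \<and> D \<subseteq> B \<and> (G - D) \<inter> B = {}" for B
  proof
    assume "insert y D = B \<inter> insert y G"
    then show "y \<in> B \<and> D \<subseteq> B \<and> (G - D) \<inter> B = {}" using assms(1) by auto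
  next
    assume "y \<in> B \<and> D \<subseteq> B \<and> (G - D) \<inter> B = {}"
    then show "insert y D = B \<inter> insert y G" using assms(2) by auto
  qed
  then show ?thesis unfolding traces_def separated_by_def by auto
qed

text \<open>The recursion behind the induction: traces over one more point can be read off traces
  over \<open>P\<close> on a larger test set. A sample gains a point at the expense of the size of
  its test sets.\<close>

lemma traces_insert: "y \<notin> G \<Longrightarrow> traces (insert y P) G = {D. D \<subseteq> G \<and> insert y D \<in> traces P (insert y G)}"
proof (intro equalityI subsetI)
  fix D assume y: "y \<notin> G" and "D \<in> traces (insert y P) G"
  then obtain B where "B \<in> F" "insert y P \<subseteq> B" "D = B \<inter> G" unfolding traces_def by blast
  moreover from this have "insert y D = B \<inter> insert y G" by blast
  ultimately show "D \<in> {D. D \<subseteq> G \<and> insert y D \<in> traces P (insert y G)}" unfolding traces_def by blast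
next
  fix D assume y: "y \<notin> G" and "D \<in> {D. D \<subseteq> G \<and> insert y D \<in> traces P (insert y G)}"
  then obtain B where "B \<in> F" "P \<subseteq> B" "insert y D = B \<inter> insert y G" "D \<subseteq> G" unfolding traces_def by blast
  moreover from this y have "D = B \<inter> G" by auto
  moreover from calculation have "insert y P \<subseteq> B" by auto
  ultimately show "D \<in> traces (insert y P) G" unfolding traces_def by blast
qed

lemma traces_nonempty: "P \<subseteq> X \<Longrightarrow> finite P \<Longrightarrow> traces P G \<noteq> {}"
  using cofinal[of P] unfolding traces_def by blast

text \<open>Whether \<open>B\<close> contains \<open>y\<close> is prescribed through the trace on
  \<open>insert y G\<close>, namely \<open>insert y D\<close> or, by \<open>exch\<close>,
  \<open>D\<close> itself. Freeness of \<open>P\<close> over \<open>insert y G\<close> takes care of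
  the rest.\<close>

lemma free_over_insert:
  assumes P: "P \<subseteq> X" "finite P" and y: "y \<notin> G" and free: "free_over P (insert y G)"
    and exch: "\<And>D. D \<subseteq> G \<Longrightarrow> insert y D \<in> traces P (insert y G) \<Longrightarrow> D \<in> traces P (insert y G)"
  shows "y \<notin> P" "free_over (insert y P) G"
proof -
  show yP: "y \<notin> P"
  proof
    assume "y \<in> P"
    obtain D where D: "D \<in> traces P (insert y G)" using traces_nonempty[OF P] by blast
    then have "y \<in> D" using \<open>y \<in> P\<close> unfolding traces_def by blast
    moreover obtain B where "B \<inter> insert y G = D" "B \<inter> P = {}"
      using free[unfolded free_over_def, rule_format, OF D, of "{}"] by auto
    ultimately show False using \<open>y \<in> P\<close> by blast
  qed
  show "free_over (insert y P) G"
    unfolding free_over_def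
  proof (intro ballI allI impI)
    fix D A assume "D \<in> traces (insert y P) G" and A: "A \<subseteq> insert y P"
    then have D: "D \<subseteq> G" "insert y D \<in> traces P (insert y G)" using traces_insert[OF y] by blast+
    have A': "A - {y} \<subseteq> P" using A by blast
    define D' where "D' = (if y \<in> A then insert y D else D)"
    have D': "D' \<in> traces P (insert y G)" using D exch unfolding D'_def by simp
    obtain B where B: "B \<in> F" "B \<inter> insert y G = D'" "B \<inter> P = A - {y}"
      using free[unfolded free_over_def, rule_format, OF D' A'] by blast
    have "B \<inter> G = D" using B(2) y D(1) unfolding D'_def by (auto split: if_splits)
    moreover have "y \<in> B \<longleftrightarrow> y \<in> A" using B(2) y D(1) unfolding D'_def by (auto split: if_splits)
    then have "B \<inter> insert y P = A" using B(3) yP A by blast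
    ultimately show "\<exists>B \<in> F. B \<inter> G = D \<and> B \<inter> insert y P = A" using B(1) by blast
  qed
qed

text \<open>The traces on \<open>G\<close> predicted for the i-th sample enlarged by
  \<open>y\<close>, in accordance with \<open>traces_insert\<close>.\<close>

definition patterns :: "('x set \<Rightarrow> nat \<Rightarrow> 'x set set) \<Rightarrow> 'x set \<Rightarrow> 'x \<Rightarrow> nat \<Rightarrow> 'x set set" where
  "patterns t G y i = {D. D \<subseteq> G \<and> insert y D \<in> t (insert y G) i}"

text \<open>
  A member of the family is tiny, so it misses some of any non-tiny set of indiscernible points \<open>y\<close>;
  hence a pattern realised together with \<open>y\<close> is also realised without \<open>y\<close>.
\<close>

lemma few_exceptions_to_exchange:
  assumes samp: "sample k (Suc K) m \<Omega> t" and G: "G \<in> small_sets K"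
  shows "few {y \<in> X. y \<notin> G \<and>
    card \<Omega> < m * card {i \<in> \<Omega>. \<exists>D \<in> patterns t G y i. D \<notin> t (insert y G) i}}" (is "few ?E")
proof (rule ccontr)
  assume "\<not> few ?E"
  then obtain A where A: "A \<subseteq> ?E" "few A" "\<not> tiny A" by (rule ex_few_not_tiny)
  have AX: "y \<in> X" "y \<notin> G" if "y \<in> A" for y using that A(1) by auto
  have J: "(\<lambda>y. insert y G) ` A \<subseteq> small_sets (Suc K)" using AX(1) insert_small_sets[OF G] by blast
  obtain P where good: "\<forall>H \<in> (\<lambda>y. insert y G) ` A.
      m * card {i \<in> \<Omega>. \<not> (card (P i) = k \<and> traces (P i) H = t H i \<and> free_over (P i) H)} \<le> card \<Omega>"
    using sampleD[OF samp J image_le[OF A(2)]] by blast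
  have fin: "finite \<Omega>" using samp unfolding sample_def by blast
  have "\<exists>iD. fst iD \<in> \<Omega> \<and> snd iD \<in> patterns t G y (fst iD) \<and> snd iD \<notin> t (insert y G) (fst iD) \<and>
      traces (P (fst iD)) (insert y G) = t (insert y G) (fst iD)" if y: "y \<in> A" for y
  proof -
    let ?bad = "{i \<in> \<Omega>. \<not> (card (P i) = k \<and> traces (P i) (insert y G) = t (insert y G) i \<and>
      free_over (P i) (insert y G))}"
    let ?ex = "{i \<in> \<Omega>. \<exists>D \<in> patterns t G y i. D \<notin> t (insert y G) i}"
    \<comment> \<open>The exceptional indices outnumber the bad ones, so at some index the exchange
      fails although the prediction is correct.\<close>
    have "m * card ?bad \<le> card \<Omega>" using good y by simp
    also have "\<dots> < m * card ?ex" using y A(1) by auto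
    finally have "m * card ?bad < m * card ?ex" .
    then have "\<not> card ?ex \<le> card ?bad" by simp
    then have "\<not> ?ex \<subseteq> ?bad" using card_mono[of ?bad ?ex] fin by auto
    then obtain i where "i \<in> ?ex" "i \<notin> ?bad" by blast
    then show ?thesis by fastforce
  qed
  then obtain f where f: "\<And>y. y \<in> A \<Longrightarrow> fst (f y) \<in> \<Omega> \<and> snd (f y) \<in> patterns t G y (fst (f y)) \<and>
      snd (f y) \<notin> t (insert y G) (fst (f y)) \<and>
      traces (P (fst (f y))) (insert y G) = t (insert y G) (fst (f y))"
    by metis
  have "f y \<in> \<Omega> \<times> Pow G" if "y \<in> A" for y
    using f[OF that] unfolding patterns_def by (simp add: mem_Times_iff)
  then have "f ` A \<subseteq> \<Omega> \<times> Pow G" by blast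
  moreover have "finite (\<Omega> \<times> Pow G)" using fin G unfolding small_sets_def by simp
  \<comment> \<open>Once the index is fixed, the same sample \<open>P i\<close> serves all points of
    the remaining set, so one member \<open>B\<close> can be compared with all of them.\<close>
  ultimately obtain v where v: "\<not> tiny {y \<in> A. f y = v}" using tiny_pigeonhole[OF A(3)] by blast
  obtain i D where iD: "v = (i, D)" by fastforce
  let ?A' = "{y \<in> A. f y = v}"
  have f': "D \<in> patterns t G y i" "D \<notin> t (insert y G) i" "traces (P i) (insert y G) = t (insert y G) i"
    if "y \<in> ?A'" for y using f[of y] that iD by auto
  have "\<not> finite ?A'" using v finite_less by blast
  then have "?A' \<noteq> {}" by (intro notI) simp
  then obtain y where y: "y \<in> ?A'" by blast
  then have "insert y D \<in> traces (P i) (insert y G)" "D \<subseteq> G" using f'[OF y] unfolding patterns_def by auto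
  then obtain B where B: "B \<in> F" "P i \<subseteq> B" "insert y D = B \<inter> insert y G" unfolding traces_def by blast
  have "y \<notin> G" using AX y by blast
  then have BG: "B \<inter> G = D" using B(3) \<open>D \<subseteq> G\<close> by auto
  have "\<not> ?A' \<subseteq> B" using tiny_subset[OF small[OF B(1)]] v by blast
  then obtain y' where y': "y' \<in> ?A'" "y' \<notin> B" by blast
  then have "D = B \<inter> insert y' G" using BG by blast
  then have "D \<in> traces (P i) (insert y' G)" using B(1,2) unfolding traces_def by blast
  then show False using f'[OF y'(1)] by simp
qed

section \<open>Cells of more than \<kappa> points and the sets that split them\<close>

definition settled :: "nat \<Rightarrow> nat set \<Rightarrow> ('x set \<Rightarrow> nat \<Rightarrow> 'x set set) \<Rightarrow> 'x set \<Rightarrow> 'x set \<Rightarrow> bool" where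
  "settled m \<Omega> t Z G \<longleftrightarrow> (\<exists>\<tau>. few {y \<in> Z. card \<Omega> < m * card {i \<in> \<Omega>. patterns t G y i \<noteq> \<tau> i}})"

text \<open>Only finitely many assignments of patterns to indices exist, so one of them,
  \<open>\<tau>\<close>, is shared exactly by more than few points of \<open>Z\<close>. As
  \<open>Z\<close> is not settled with this \<open>\<tau>\<close>, more than few points are far from
  it, and hence far from each of the former.\<close>

lemma split_unsettled:
  assumes "finite \<Omega>" "finite G" "\<not> few Z" "\<not> settled m \<Omega> t Z G"
  shows "\<exists>Z' Z''. Z' \<subseteq> Z \<and> Z'' \<subseteq> Z \<and> \<not> few Z' \<and> \<not> few Z'' \<and>
    (\<forall>y \<in> Z'. \<forall>y' \<in> Z''. card \<Omega> < m * card {i \<in> \<Omega>. patterns t G y i \<noteq> patterns t G y' i})"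
proof -
  let ?f = "\<lambda>y. {(i, D). i \<in> \<Omega> \<and> D \<in> patterns t G y i}"
  have "?f ` Z \<subseteq> Pow (\<Omega> \<times> Pow G)" unfolding patterns_def by auto
  moreover have "finite (Pow (\<Omega> \<times> Pow G))" using assms(1,2) by simp
  ultimately have "\<exists>v. \<not> few {y \<in> Z. ?f y = v}" by (intro few_pigeonhole[OF assms(3)])
  then obtain v where v: "\<not> few {y \<in> Z. ?f y = v}" ..
  define \<tau> where "\<tau> i = {D. (i, D) \<in> v}" for i
  define Z'' where "Z'' = {y \<in> Z. card \<Omega> < m * card {i \<in> \<Omega>. patterns t G y i \<noteq> \<tau> i}}"
  have Z'': "\<not> few Z''" using assms(4) unfolding settled_def Z''_def by blast
  have const: "patterns t G y i = \<tau> i" if "y \<in> {y \<in> Z. ?f y = v}" "i \<in> \<Omega>" for y i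
    using that unfolding \<tau>_def by auto
  have "card \<Omega> < m * card {i \<in> \<Omega>. patterns t G y i \<noteq> patterns t G y' i}"
    if y: "y \<in> {y \<in> Z. ?f y = v}" and y': "y' \<in> Z''" for y y'
  proof -
    have "{i \<in> \<Omega>. patterns t G y i \<noteq> patterns t G y' i} = {i \<in> \<Omega>. patterns t G y' i \<noteq> \<tau> i}"
      using const[OF y] by auto
    then show ?thesis using y' unfolding Z''_def by simp
  qed
  then show ?thesis using v Z''
    by (intro exI[of _ "{y \<in> Z. ?f y = v}"] exI[of _ Z'']) (auto simp: Z''_def)
qed

definition separated :: "nat \<Rightarrow> nat set \<Rightarrow> ('x set \<Rightarrow> nat \<Rightarrow> 'x set set) \<Rightarrow> 'x set set \<Rightarrow> 'x set \<Rightarrow> 'x set \<Rightarrow> bool" where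
  "separated m \<Omega> t \<G> Z Z' \<longleftrightarrow> (\<exists>G \<in> \<G>. \<forall>y \<in> Z. \<forall>y' \<in> Z'.
     card \<Omega> < m * card {i \<in> \<Omega>. patterns t G y i \<noteq> patterns t G y' i})"

lemma separated_mono:
  assumes "separated m \<Omega> t \<G> Z Z'" "Y \<subseteq> Z" "Y' \<subseteq> Z'" "\<G> \<subseteq> \<G>'"
  shows "separated m \<Omega> t \<G>' Y Y'"
proof -
  obtain G where G: "G \<in> \<G>" and sep: "\<forall>y \<in> Z. \<forall>y' \<in> Z'.
      card \<Omega> < m * card {i \<in> \<Omega>. patterns t G y i \<noteq> patterns t G y' i}"
    using assms(1) unfolding separated_def by blast
  have "\<forall>y \<in> Y. \<forall>y' \<in> Y'. card \<Omega> < m * card {i \<in> \<Omega>. patterns t G y i \<noteq> patterns t G y' i}"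
    using sep assms(2,3) by blast
  then show ?thesis unfolding separated_def using G assms(4) by blast
qed

lemma separated_sym:
  assumes "separated m \<Omega> t \<G> Z Z'"
  shows "separated m \<Omega> t \<G> Z' Z"
proof -
  have "{i \<in> \<Omega>. patterns t G y i \<noteq> patterns t G y' i} = {i \<in> \<Omega>. patterns t G y' i \<noteq> patterns t G y i}"
    for G y y' by auto
  then have eq: "card {i \<in> \<Omega>. patterns t G y i \<noteq> patterns t G y' i} =
      card {i \<in> \<Omega>. patterns t G y' i \<noteq> patterns t G y i}" for G y y'
    by (rule arg_cong)
  obtain G where G: "G \<in> \<G>" "\<forall>y \<in> Z. \<forall>y' \<in> Z'.
      card \<Omega> < m * card {i \<in> \<Omega>. patterns t G y i \<noteq> patterns t G y' i}"
    using assms unfolding separated_def by blast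
  have "card \<Omega> < m * card {i \<in> \<Omega>. patterns t G y i \<noteq> patterns t G y' i}" if "y \<in> Z'" "y' \<in> Z" for y y'
    unfolding eq[of G y y'] using G(2) that by blast
  then show ?thesis unfolding separated_def using G(1) by blast
qed

text \<open>At least \<open>(1 + 1 / m) ^ N\<close> cells are told apart by \<open>N\<close> test
  sets; the inequality is multiplied out to stay within the naturals.\<close>

definition separated_system ::
  "nat \<Rightarrow> nat set \<Rightarrow> ('x set \<Rightarrow> nat \<Rightarrow> 'x set set) \<Rightarrow> nat \<Rightarrow> nat \<Rightarrow> nat set \<Rightarrow> (nat \<Rightarrow> 'x set) \<Rightarrow> 'x set list \<Rightarrow> bool"
  where
  "separated_system m \<Omega> t K N I Z Gs \<longleftrightarrow> finite I \<and> I \<noteq> {} \<and> (\<forall>j \<in> I. Z j \<subseteq> X \<and> \<not> few (Z j)) \<and>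
     length Gs = N \<and> set Gs \<subseteq> small_sets K \<and> (m + 1) ^ N \<le> m ^ N * card I \<and>
     (\<forall>j \<in> I. \<forall>j' \<in> I. j \<noteq> j' \<longrightarrow> separated m \<Omega> t (set Gs) (Z j) (Z j'))"

text \<open>In each step a further \<open>G\<close> leaves more than a fraction 1/m of the cells
  unsettled. These are split in two, so the number of cells grows by more than the factor 1 +
  1/m.\<close>

lemma ex_separated_system:
  assumes fin: "finite \<Omega>"
    and unsettled: "\<And>I Z. finite I \<Longrightarrow> I \<noteq> {} \<Longrightarrow> (\<And>j :: nat. j \<in> I \<Longrightarrow> Z j \<subseteq> X \<and> \<not> few (Z j)) \<Longrightarrow>
      \<exists>G \<in> small_sets K. card I < m * card {j \<in> I. \<not> settled m \<Omega> t (Z j) G}"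
  shows "\<exists>I Z Gs. separated_system m \<Omega> t K N I Z Gs"
proof (induction N)
  case 0
  have "separated_system m \<Omega> t K 0 {0} (\<lambda>_. X) []"
    unfolding separated_system_def by (simp add: large)
  then show ?case by blast
next
  case (Suc N)
  then obtain I Z Gs where sys: "separated_system m \<Omega> t K N I Z Gs" by blast
  then have I: "finite I" "I \<noteq> {}" and Z: "\<And>j. j \<in> I \<Longrightarrow> Z j \<subseteq> X \<and> \<not> few (Z j)"
    and Gs: "length Gs = N" "set Gs \<subseteq> small_sets K" and card: "(m + 1) ^ N \<le> m ^ N * card I"
    and sep: "\<And>j j'. j \<in> I \<Longrightarrow> j' \<in> I \<Longrightarrow> j \<noteq> j' \<Longrightarrow> separated m \<Omega> t (set Gs) (Z j) (Z j')"
    unfolding separated_system_def by simp_all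
  obtain G where G: "G \<in> small_sets K" and bad: "card I < m * card {j \<in> I. \<not> settled m \<Omega> t (Z j) G}"
    using unsettled[of I Z, OF I Z] by blast
  define U where "U = {j \<in> I. \<not> settled m \<Omega> t (Z j) G}"
  have finG: "finite G" using G unfolding small_sets_def by simp
  have "\<exists>Z' Z''. Z' \<subseteq> Z j \<and> Z'' \<subseteq> Z j \<and> \<not> few Z' \<and> \<not> few Z'' \<and> separated m \<Omega> t {G} Z' Z''"
    if "j \<in> U" for j
  proof -
    have "\<not> few (Z j)" "\<not> settled m \<Omega> t (Z j) G" using that Z[of j] unfolding U_def by auto
    then show ?thesis using split_unsettled[OF fin finG] unfolding separated_def by simp
  qed
  then have "\<forall>j \<in> U. \<exists>Z' Z''. Z' \<subseteq> Z j \<and> Z'' \<subseteq> Z j \<and> \<not> few Z' \<and> \<not> few Z'' \<and> separated m \<Omega> t {G} Z' Z''"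
    by simp
  from bchoice[OF this] obtain Z' where
    "\<forall>j \<in> U. \<exists>Z''. Z' j \<subseteq> Z j \<and> Z'' \<subseteq> Z j \<and> \<not> few (Z' j) \<and> \<not> few Z'' \<and> separated m \<Omega> t {G} (Z' j) Z''" ..
  from bchoice[OF this] obtain Z'' where Z': "\<forall>j \<in> U. Z' j \<subseteq> Z j \<and> Z'' j \<subseteq> Z j \<and> \<not> few (Z' j) \<and>
      \<not> few (Z'' j) \<and> separated m \<Omega> t {G} (Z' j) (Z'' j)" ..
  \<comment> \<open>Cell j turns into 2 * j, joined by 2 * j + 1 if it is split; \<open>Y\<close>
    leaves the other cells as they are.\<close>
  define I' where "I' = (\<lambda>j. 2 * j) ` I \<union> (\<lambda>j. 2 * j + 1) ` U"
  define Y where "Y l = (if even l then (if l div 2 \<in> U then Z' (l div 2) else Z (l div 2)) else Z'' (l div 2))"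
    for l
  have UI: "U \<subseteq> I" unfolding U_def by blast
  have I'_cases: "l div 2 \<in> I \<and> (odd l \<longrightarrow> l div 2 \<in> U)" if "l \<in> I'" for l
    using that UI unfolding I'_def by auto
  have Ysub: "Y l \<subseteq> Z (l div 2)" "\<not> few (Y l)" if "l \<in> I'" for l
    using I'_cases[OF that] Z' Z unfolding Y_def by auto
  have sepY: "separated m \<Omega> t (set (G # Gs)) (Y l) (Y l')" if l: "l \<in> I'" "l' \<in> I'" "l \<noteq> l'" for l l'
  proof (cases "l div 2 = l' div 2")
    case False
    then show ?thesis
      using I'_cases[OF l(1)] I'_cases[OF l(2)]
      by (intro separated_mono[OF sep Ysub(1)[OF l(1)] Ysub(1)[OF l(2)]]) auto
  next
    case True
    let ?j = "l div 2"
    have par: "even l \<noteq> even l'" using True l(3) by (metis div_mult_mod_eq even_iff_mod_2_eq_zero not_mod_2_eq_0_eq_1)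
    then have "?j \<in> U" using I'_cases[OF l(1)] I'_cases[OF l(2)] True by auto
    then have s: "separated m \<Omega> t {G} (Z' ?j) (Z'' ?j)" using Z' by blast
    have "{Y l, Y l'} = {Z' ?j, Z'' ?j} \<and> (Y l = Z' ?j \<and> Y l' = Z'' ?j \<or> Y l = Z'' ?j \<and> Y l' = Z' ?j)"
      using par \<open>?j \<in> U\<close> True unfolding Y_def by auto
    then have "separated m \<Omega> t {G} (Y l) (Y l')" using s separated_sym by metis
    then show ?thesis by (rule separated_mono) auto
  qed
  have "card I' = card I + card U"
  proof -
    have "card I' = card ((\<lambda>j. 2 * j) ` I) + card ((\<lambda>j. 2 * j + 1) ` U)"
      unfolding I'_def using I(1) finite_subset[OF UI I(1)]
      by (intro card_Un_disjoint) (auto, presburger)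
    moreover have "card ((\<lambda>j. 2 * j) ` I) = card I" "card ((\<lambda>j. 2 * j + 1) ` U) = card U"
      by (intro card_image inj_onI; simp)+
    ultimately show ?thesis by simp
  qed
  moreover have "card I < m * card U" using bad unfolding U_def by simp
  ultimately have "(m + 1) * card I \<le> m * card I'" by (simp add: algebra_simps)
  have "(m + 1) ^ Suc N \<le> (m + 1) * (m ^ N * card I)"
    unfolding power_Suc using card by (rule mult_le_mono2)
  also have "\<dots> = m ^ N * ((m + 1) * card I)" by (simp add: algebra_simps)
  also have "\<dots> \<le> m ^ N * (m * card I')" using \<open>(m + 1) * card I \<le> m * card I'\<close> by simp
  finally have "(m + 1) ^ Suc N \<le> m ^ Suc N * card I'" by (simp add: algebra_simps)
  moreover have "finite I'" unfolding I'_def using I(1) finite_subset[OF UI I(1)] by simp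
  moreover have "I' \<noteq> {}" unfolding I'_def using I(2) by simp
  moreover have "Y l \<subseteq> X \<and> \<not> few (Y l)" if "l \<in> I'" for l
    using Ysub[OF that] Z[of "l div 2"] I'_cases[OF that] by blast
  moreover have "set (G # Gs) \<subseteq> small_sets K" "length (G # Gs) = Suc N" using G Gs by simp_all
  ultimately have "separated_system m \<Omega> t K (Suc N) I' Y (G # Gs)"
    unfolding separated_system_def using sepY by simp
  then show ?case by blast
qed

text \<open>\<open>tame\<close> says nothing about the predictions \<open>t\<close> as such. They
  are first realised by an actual sample \<open>P\<close>, tested on the sets
  \<open>insert (y j) G\<close> for one point \<open>y j\<close> of each cell; the types counted
  consist of the conditions \<open>(P i \<union> D, G - D)\<close>. Accuracy \<open>2 * m\<close> is
  required because two points are compared: the indices bad for either of them make up at most a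
  fraction 1/m.\<close>

lemma ex_settled_system:
  assumes samp: "sample k (Suc K) (2 * m) \<Omega> t" and m: "m \<ge> 1"
  shows "\<exists>(I :: nat set) Z. finite I \<and> I \<noteq> {} \<and> (\<forall>j \<in> I. Z j \<subseteq> X \<and> \<not> few (Z j)) \<and>
    (\<forall>G \<in> small_sets K. m * card {j \<in> I. \<not> settled m \<Omega> t (Z j) G} \<le> card I)"
proof (rule ccontr)
  assume neg: "\<not> ?thesis"
  have fin: "finite \<Omega>" using samp unfolding sample_def by simp
  have unsettled: "\<exists>G \<in> small_sets K. card I < m * card {j \<in> I. \<not> settled m \<Omega> t (Z j) G}"
    if "finite I" "I \<noteq> {}" "\<And>j :: nat. j \<in> I \<Longrightarrow> Z j \<subseteq> X \<and> \<not> few (Z j)" for I Z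
  proof (rule ccontr)
    assume "\<not> ?thesis"
    then have "\<forall>G \<in> small_sets K. m * card {j \<in> I. \<not> settled m \<Omega> t (Z j) G} \<le> card I"
      by (simp add: not_less)
    then have "finite I \<and> I \<noteq> {} \<and> (\<forall>j \<in> I. Z j \<subseteq> X \<and> \<not> few (Z j)) \<and>
        (\<forall>G \<in> small_sets K. m * card {j \<in> I. \<not> settled m \<Omega> t (Z j) G} \<le> card I)"
      using that by simp
    then show False using neg by blast
  qed
  obtain d where d: "\<forall>\<Theta>. finite \<Theta> \<longrightarrow> card \<Theta> = d \<longrightarrow>
      \<Theta> \<subseteq> {(P, Q). P \<subseteq> X \<and> Q \<subseteq> X \<and> finite P \<and> finite Q \<and> card P \<le> k + K \<and> card Q \<le> k + K} \<longrightarrow>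
      \<not> shattered \<Theta> {{\<theta>. y \<in> separated_by F \<theta>} |y. y \<in> X}"
    using tame[of "k + K"] ..
  obtain N where N: "m ^ N * (card \<Omega> * 2 ^ K * N + 1) ^ d < (m + 1) ^ N"
    using exponential_beats_polynomial[OF m] .
  obtain I Z Gs where sys: "separated_system m \<Omega> t K N I Z Gs"
    using ex_separated_system[of \<Omega> K m t N, OF fin unsettled] by blast
  then have I: "finite I" and Z: "\<And>j. j \<in> I \<Longrightarrow> Z j \<subseteq> X \<and> \<not> few (Z j)"
    and Gs: "length Gs = N" "set Gs \<subseteq> small_sets K" and card: "(m + 1) ^ N \<le> m ^ N * card I"
    and sep: "\<And>j j'. j \<in> I \<Longrightarrow> j' \<in> I \<Longrightarrow> j \<noteq> j' \<Longrightarrow> separated m \<Omega> t (set Gs) (Z j) (Z j')"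
    unfolding separated_system_def by simp_all
  have Gprops: "G \<subseteq> X" "finite G" "card G \<le> K" if "G \<in> set Gs" for G
    using that Gs(2) unfolding small_sets_def by auto
  have finU: "finite (\<Union>(set Gs))" using Gprops(2) by simp
  have "\<exists>y. y \<in> Z j \<and> y \<notin> \<Union>(set Gs)" if "j \<in> I" for j
    using few_subset[OF finite_le[OF finU], of "Z j"] Z[OF that] by blast
  then obtain y where "\<forall>j \<in> I. y j \<in> Z j \<and> y j \<notin> \<Union>(set Gs)" using bchoice[of I] by metis
  then have y: "y j \<in> Z j" "G \<in> set Gs \<Longrightarrow> y j \<notin> G" if "j \<in> I" for j G using that by auto
  have yX: "y j \<in> X" if "j \<in> I" for j using y(1)[OF that] Z[OF that] by blast
  define J where "J = (\<lambda>(j, G). insert (y j) G) ` (I \<times> set Gs)"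
  have "J \<subseteq> small_sets (Suc K)"
    unfolding J_def using yX Gs(2) by (auto intro!: insert_small_sets)
  moreover have "|J| \<le>o \<kappa>" unfolding J_def using I by (intro finite_le) simp
  ultimately obtain P where P: "\<forall>i \<in> \<Omega>. P i \<subseteq> X \<and> finite (P i)" and good: "\<forall>G \<in> J.
      2 * m * card {i \<in> \<Omega>. \<not> (card (P i) = k \<and> traces (P i) G = t G i \<and> free_over (P i) G)} \<le> card \<Omega>"
    using sampleD[OF samp, of J] by blast
  \<comment> \<open>The restriction to indices of the right cardinality bounds the size of the
    conditions by k + K. The indices left out are bad for every point anyway.\<close>
  define S where "S = {i \<in> \<Omega>. card (P i) = k} \<times> (SIGMA G : set Gs. Pow G)"
  define \<Theta> where "\<Theta> = (\<lambda>(i, G, D). (P i \<union> D, G - D)) ` S"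
  have finS: "finite S" unfolding S_def using fin Gprops(2) by (intro finite_cartesian_product finite_SigmaI) auto
  have "card S \<le> card \<Omega> * 2 ^ K * N"
  proof -
    have "card (SIGMA G : set Gs. Pow G) = (\<Sum>G \<in> set Gs. card (Pow G))"
      using Gprops(2) by (intro card_SigmaI) auto
    also have "\<dots> \<le> (\<Sum>G \<in> set Gs. 2 ^ K)"
      using Gprops(2,3) by (intro sum_mono) (simp add: card_Pow power_increasing)
    also have "\<dots> \<le> N * 2 ^ K" using card_length[of Gs] Gs(1) by simp
    finally have "card (SIGMA G : set Gs. Pow G) \<le> N * 2 ^ K" .
    moreover have "card {i \<in> \<Omega>. card (P i) = k} \<le> card \<Omega>" using fin by (intro card_mono) auto
    ultimately have "card S \<le> card \<Omega> * (N * 2 ^ K)"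
      unfolding S_def card_cartesian_product by (intro mult_le_mono)
    then show ?thesis by (simp add: ac_simps)
  qed
  then have card\<Theta>: "card \<Theta> \<le> card \<Omega> * 2 ^ K * N"
    unfolding \<Theta>_def using card_image_le[OF finS] le_trans by blast
  have fin\<Theta>: "finite \<Theta>" unfolding \<Theta>_def using finS by simp
  have sub\<Theta>: "\<Theta> \<subseteq> {(P, Q). P \<subseteq> X \<and> Q \<subseteq> X \<and> finite P \<and> finite Q \<and> card P \<le> k + K \<and> card Q \<le> k + K}"
  proof
    fix \<theta> assume "\<theta> \<in> \<Theta>"
    then obtain i G D where \<theta>: "\<theta> = (P i \<union> D, G - D)" and i: "i \<in> \<Omega>" "card (P i) = k"
      and G: "G \<in> set Gs" and D: "D \<subseteq> G"
      unfolding \<Theta>_def S_def by auto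
    have "card D \<le> K" using card_mono[OF Gprops(2)[OF G] D] Gprops(3)[OF G] by simp
    then have "card (P i \<union> D) \<le> k + K" using card_Un_le[of "P i" D] i(2) by simp
    moreover have "card (G - D) \<le> k + K"
      using card_mono[OF Gprops(2)[OF G], of "G - D"] Gprops(3)[OF G] by auto
    moreover have "finite D" using D Gprops(2)[OF G] finite_subset by blast
    ultimately show "\<theta> \<in> {(P, Q). P \<subseteq> X \<and> Q \<subseteq> X \<and> finite P \<and> finite Q \<and> card P \<le> k + K \<and> card Q \<le> k + K}"
      using \<theta> P i(1) D Gprops(1,2)[OF G] by auto
  qed
  define code where "code j = {\<theta> \<in> \<Theta>. y j \<in> separated_by F \<theta>}" for j
  have inj: "inj_on code I"
  proof (rule inj_onI, rule ccontr)
    fix j j' assume j: "j \<in> I" "j' \<in> I" "code j = code j'" "j \<noteq> j'"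
    obtain G where G: "G \<in> set Gs"
      and "\<forall>z \<in> Z j. \<forall>z' \<in> Z j'. card \<Omega> < m * card {i \<in> \<Omega>. patterns t G z i \<noteq> patterns t G z' i}"
      using sep[OF j(1,2,4)] unfolding separated_def by blast
    then have diff: "card \<Omega> < m * card {i \<in> \<Omega>. patterns t G (y j) i \<noteq> patterns t G (y j') i}"
      using y(1) j(1,2) by blast
    define bad where "bad l = {i \<in> \<Omega>. \<not> (card (P i) = k \<and>
      traces (P i) (insert (y l) G) = t (insert (y l) G) i \<and> free_over (P i) (insert (y l) G))}" for l
    have bad: "2 * m * card (bad l) \<le> card \<Omega>" if "l \<in> I" for l
      using good that G unfolding bad_def J_def by auto
    have "2 * m * card (bad j \<union> bad j') \<le> 2 * m * (card (bad j) + card (bad j'))"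
      by (intro mult_le_mono2 card_Un_le)
    also have "\<dots> \<le> 2 * card \<Omega>" using bad[OF j(1)] bad[OF j(2)] by (simp add: algebra_simps)
    finally have "m * card (bad j \<union> bad j') < m * card {i \<in> \<Omega>. patterns t G (y j) i \<noteq> patterns t G (y j') i}"
      using diff by linarith
    then have more: "\<not> card {i \<in> \<Omega>. patterns t G (y j) i \<noteq> patterns t G (y j') i} \<le> card (bad j \<union> bad j')"
      by simp
    have finbad: "finite (bad j \<union> bad j')" unfolding bad_def using fin by simp
    have "\<not> {i \<in> \<Omega>. patterns t G (y j) i \<noteq> patterns t G (y j') i} \<subseteq> bad j \<union> bad j'"
      by (rule notI) (rule more[THEN notE, OF card_mono[OF finbad]])
    then obtain i where i: "i \<in> \<Omega>" "patterns t G (y j) i \<noteq> patterns t G (y j') i" "i \<notin> bad j" "i \<notin> bad j'"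
      by blast
    have k: "card (P i) = k" using i(1,3) unfolding bad_def by blast
    have pat: "patterns t G (y l) i = {D. D \<subseteq> G \<and> y l \<in> separated_by F (P i \<union> D, G - D)}"
      if "l \<in> I" "i \<notin> bad l" for l
    proof -
      have "traces (P i) (insert (y l) G) = t (insert (y l) G) i" using that(2) i(1) unfolding bad_def by blast
      then show ?thesis
        unfolding patterns_def using insert_mem_traces_iff[OF y(2)[OF that(1) G]] by auto
    qed
    have "y j \<in> separated_by F (P i \<union> D, G - D) \<longleftrightarrow> y j' \<in> separated_by F (P i \<union> D, G - D)" if "D \<subseteq> G" for D
    proof -
      have "(P i \<union> D, G - D) \<in> \<Theta>"
        unfolding \<Theta>_def S_def using i(1) k G that by (intro image_eqI[of _ _ "(i, G, D)"]) auto
      then show ?thesis using j(3) unfolding code_def by blast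
    qed
    then show False using pat[OF j(1) i(3)] pat[OF j(2) i(4)] i(2) by auto
  qed
  have "card (code ` I) \<le> (card \<Theta> + 1) ^ d"
  proof (rule card_le_if_not_shattered[OF fin\<Theta>])
    show "code ` I \<subseteq> Pow \<Theta>" unfolding code_def by blast
    fix A assume A: "A \<subseteq> \<Theta>" "card A = d"
    show "\<not> shattered A (code ` I)"
    proof
      assume sh: "shattered A (code ` I)"
      have "shattered A {{\<theta>. y \<in> separated_by F \<theta>} |y. y \<in> X}"
        unfolding shattered_def
      proof (intro allI impI)
        fix S assume "S \<subseteq> A"
        then obtain j where j: "j \<in> I" "code j \<inter> A = S" using sh unfolding shattered_def by blast
        then have "{\<theta>. y j \<in> separated_by F \<theta>} \<inter> A = S" using A(1) unfolding code_def by blast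
        then show "\<exists>B \<in> {{\<theta>. y \<in> separated_by F \<theta>} |y. y \<in> X}. B \<inter> A = S" using yX[OF j(1)] by blast
      qed
      then show False using d[rule_format, OF finite_subset[OF A(1) fin\<Theta>] A(2) order_trans[OF A(1) sub\<Theta>]] by simp
    qed
  qed
  also have "\<dots> \<le> (card \<Omega> * 2 ^ K * N + 1) ^ d" using card\<Theta> by (intro power_mono) auto
  finally have "card I \<le> (card \<Omega> * 2 ^ K * N + 1) ^ d" using card_image[OF inj] by simp
  then have "m ^ N * card I \<le> m ^ N * (card \<Omega> * 2 ^ K * N + 1) ^ d" by (rule mult_le_mono2)
  then show False using N card by linarith
qed

text \<open>The new point comes first: \<open>y j\<close> is picked in the cell \<open>Z j\<close>
  outside the exceptional sets of all \<open>G\<close> in \<open>J\<close>, and only then are the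
  old \<open>k\<close> points sampled, against test sets enlarged by \<open>y j\<close>. The
  prediction at \<open>(j, i)\<close> is the typical pattern of the cell, which depends neither on
  \<open>J\<close> nor on \<open>y j\<close>.\<close>

lemma sample_Suc:
  assumes IH: "\<And>K m. m \<ge> 1 \<Longrightarrow> \<exists>\<Omega> t. sample k K m \<Omega> t" and m: "m \<ge> 1"
  shows "\<exists>\<Omega> t. sample (Suc k) K m \<Omega> t"
proof -
  \<comment> \<open>The factor 4 pays for four sources of error: unsettled cells, untypical
    patterns, failures of the exchange and failures of the old sample. The factor 2 is the one in
    \<open>ex_settled_system\<close>.\<close>
  obtain \<Omega> t where samp: "sample k (Suc K) (2 * (4 * m)) \<Omega> t" using IH[of "2 * (4 * m)" "Suc K"] m by auto
  have fin: "finite \<Omega>" "\<Omega> \<noteq> {}" using samp unfolding sample_def by simp_all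
  obtain I :: "nat set" and Z where I: "finite I" "I \<noteq> {}" and Z: "\<forall>j \<in> I. Z j \<subseteq> X \<and> \<not> few (Z j)"
    and set: "\<forall>G \<in> small_sets K. 4 * m * card {j \<in> I. \<not> settled (4 * m) \<Omega> t (Z j) G} \<le> card I"
    using ex_settled_system[OF samp] m by auto
  have "\<exists>\<tau>. settled (4 * m) \<Omega> t (Z (snd Gj)) (fst Gj) \<longrightarrow>
      few {y \<in> Z (snd Gj). card \<Omega> < 4 * m * card {i \<in> \<Omega>. patterns t (fst Gj) y i \<noteq> \<tau> i}}" for Gj
    unfolding settled_def by blast
  from choice[OF allI[OF this]] obtain \<tau> where \<tau>: "\<forall>Gj. settled (4 * m) \<Omega> t (Z (snd Gj)) (fst Gj) \<longrightarrow>
      few {y \<in> Z (snd Gj). card \<Omega> < 4 * m * card {i \<in> \<Omega>. patterns t (fst Gj) y i \<noteq> \<tau> Gj i}}" ..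
  \<comment> \<open>Pairs are coded as numbers so that index sets keep one type throughout the
    induction.\<close>
  define \<Omega>' where "\<Omega>' = prod_encode ` (I \<times> \<Omega>)"
  define t' where "t' G n = \<tau> (G, fst (prod_decode n)) (snd (prod_decode n))" for G n
  have card\<Omega>': "card \<Omega>' = card I * card \<Omega>"
    unfolding \<Omega>'_def by (subst card_image) (auto simp: inj_prod_encode card_cartesian_product)
  have "\<exists>P. (\<forall>n \<in> \<Omega>'. P n \<subseteq> X \<and> finite (P n)) \<and> (\<forall>G \<in> J. m * card {n \<in> \<Omega>'.
      \<not> (card (P n) = Suc k \<and> traces (P n) G = t' G n \<and> free_over (P n) G)} \<le> card \<Omega>')"
    if J: "J \<subseteq> small_sets K" "|J| \<le>o \<kappa>" for J
  proof -
    define E1 where "E1 G = {y \<in> X. y \<notin> G \<and>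
      card \<Omega> < 2 * (4 * m) * card {i \<in> \<Omega>. \<exists>D \<in> patterns t G y i. D \<notin> t (insert y G) i}}" for G
    define E2 where "E2 G j = (if settled (4 * m) \<Omega> t (Z j) G then
      {y \<in> Z j. card \<Omega> < 4 * m * card {i \<in> \<Omega>. patterns t G y i \<noteq> \<tau> (G, j) i}} else {})" for G j
    have few: "few (\<Union>G \<in> J. G \<union> (E1 G \<union> E2 G j))" for j
    proof (rule few_UN[OF J(2)])
      fix G assume "G \<in> J"
      then have G: "G \<in> small_sets K" using J(1) by blast
      then have "few G" unfolding small_sets_def by (intro finite_le) simp
      moreover have "few (E1 G)" unfolding E1_def by (rule few_exceptions_to_exchange[OF samp G])
      moreover have "few (E2 G j)"
        using \<tau>[rule_format, of "(G, j)"] finite_le[of "{} :: 'x set"] unfolding E2_def by simp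
      ultimately show "few (G \<union> (E1 G \<union> E2 G j))" by (intro few_Un)
    qed
    have "\<forall>j \<in> I. \<exists>y. y \<in> Z j \<and> y \<notin> (\<Union>G \<in> J. G \<union> (E1 G \<union> E2 G j))"
    proof
      fix j assume "j \<in> I"
      then have "\<not> few (Z j)" using Z by blast
      then have "\<not> Z j \<subseteq> (\<Union>G \<in> J. G \<union> (E1 G \<union> E2 G j))" using few_subset[OF few] by blast
      then show "\<exists>y. y \<in> Z j \<and> y \<notin> (\<Union>G \<in> J. G \<union> (E1 G \<union> E2 G j))" by blast
    qed
    from bchoice[OF this] obtain y where y: "\<forall>j \<in> I. y j \<in> Z j \<and> y j \<notin> (\<Union>G \<in> J. G \<union> (E1 G \<union> E2 G j))" ..
    have yX: "y j \<in> X" if "j \<in> I" for j using y Z that by blast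
    have "\<forall>j \<in> I. \<exists>P. (\<forall>i \<in> \<Omega>. P i \<subseteq> X \<and> finite (P i)) \<and> (\<forall>H \<in> insert (y j) ` J. 2 * (4 * m) *
      card {i \<in> \<Omega>. \<not> (card (P i) = k \<and> traces (P i) H = t H i \<and> free_over (P i) H)} \<le> card \<Omega>)"
    proof
      fix j assume "j \<in> I"
      have "insert (y j) ` J \<subseteq> small_sets (Suc K)"
        using J(1) yX[OF \<open>j \<in> I\<close>] insert_small_sets by blast
      from sampleD[OF samp this image_le[OF J(2)]]
      show "\<exists>P. (\<forall>i \<in> \<Omega>. P i \<subseteq> X \<and> finite (P i)) \<and> (\<forall>H \<in> insert (y j) ` J. 2 * (4 * m) *
        card {i \<in> \<Omega>. \<not> (card (P i) = k \<and> traces (P i) H = t H i \<and> free_over (P i) H)} \<le> card \<Omega>)" .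
    qed
    from bchoice[OF this] obtain P where P: "\<forall>j \<in> I. (\<forall>i \<in> \<Omega>. P j i \<subseteq> X \<and> finite (P j i)) \<and>
      (\<forall>H \<in> insert (y j) ` J. 2 * (4 * m) *
      card {i \<in> \<Omega>. \<not> (card (P j i) = k \<and> traces (P j i) H = t H i \<and> free_over (P j i) H)} \<le> card \<Omega>)" ..
    define P' where "P' n = insert (y (fst (prod_decode n))) (P (fst (prod_decode n)) (snd (prod_decode n)))" for n
    have PX: "P j i \<subseteq> X" "finite (P j i)" if "j \<in> I" "i \<in> \<Omega>" for j i using P that by blast+
    have "P' n \<subseteq> X \<and> finite (P' n)" if n: "n \<in> \<Omega>'" for n
    proof -
      obtain j i where ji: "n = prod_encode (j, i)" "j \<in> I" "i \<in> \<Omega>" using n unfolding \<Omega>'_def by auto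
      then show ?thesis unfolding P'_def using PX[OF ji(2,3)] yX[OF ji(2)] by simp
    qed
    moreover have "m * card {n \<in> \<Omega>'. \<not> (card (P' n) = Suc k \<and> traces (P' n) G = t' G n \<and> free_over (P' n) G)}
        \<le> card \<Omega>'" if GJ: "G \<in> J" for G
    proof -
      have G: "G \<in> small_sets K" using J(1) GJ by blast
      define U where "U = {j \<in> I. \<not> settled (4 * m) \<Omega> t (Z j) G}"
      define B1 where "B1 j = {i \<in> \<Omega>. patterns t G (y j) i \<noteq> \<tau> (G, j) i}" for j
      define B2 where "B2 j = {i \<in> \<Omega>. \<exists>D \<in> patterns t G (y j) i. D \<notin> t (insert (y j) G) i}" for j
      define B3 where "B3 j = {i \<in> \<Omega>. \<not> (card (P j i) = k \<and>
        traces (P j i) (insert (y j) G) = t (insert (y j) G) i \<and> free_over (P j i) (insert (y j) G))}" for j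
      have yj: "y j \<notin> G" "y j \<notin> E1 G" "y j \<notin> E2 G j" if "j \<in> I" for j using y that GJ by blast+
      have c1: "4 * m * card (B1 j) \<le> card \<Omega>" if "j \<in> I - U" for j
        using yj(3)[of j] y that unfolding E2_def B1_def U_def by (auto simp: not_less)
      have c2: "4 * m * card (B2 j) \<le> card \<Omega>" if "j \<in> I" for j
        using yj(1,2)[OF that] yX[OF that] unfolding E1_def B2_def by (auto simp: not_less)
      have c3: "4 * m * card (B3 j) \<le> card \<Omega>" if "j \<in> I" for j
      proof -
        have "2 * (4 * m) * card (B3 j) \<le> card \<Omega>" using P that GJ unfolding B3_def by blast
        then show ?thesis by linarith
      qed
      have finB: "finite (B1 j)" "finite (B2 j)" "finite (B3 j)" for j
        unfolding B1_def B2_def B3_def using fin(1) by simp_all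
      have finU: "finite U" "U \<subseteq> I" unfolding U_def using I(1) by auto
      let ?S = "(U \<times> \<Omega>) \<union> ((SIGMA j : I - U. B1 j) \<union> ((SIGMA j : I. B2 j) \<union> (SIGMA j : I. B3 j)))"
      have bad: "{n \<in> \<Omega>'. \<not> (card (P' n) = Suc k \<and> traces (P' n) G = t' G n \<and> free_over (P' n) G)}
          \<subseteq> prod_encode ` ?S"
      proof
        fix n assume n: "n \<in> {n \<in> \<Omega>'. \<not> (card (P' n) = Suc k \<and> traces (P' n) G = t' G n \<and> free_over (P' n) G)}"
        then obtain j i where ji: "n = prod_encode (j, i)" "j \<in> I" "i \<in> \<Omega>" unfolding \<Omega>'_def by auto
        have "(j, i) \<in> ?S"
        proof (rule ccontr)
          assume notin: "(j, i) \<notin> ?S"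
          have P'n: "P' n = insert (y j) (P j i)" and t'n: "t' G n = \<tau> (G, j) i"
            unfolding P'_def t'_def ji(1) by simp_all
          have not: "i \<notin> B1 j" "i \<notin> B2 j" "i \<notin> B3 j" using notin ji by auto
          have k: "card (P j i) = k" and tr: "traces (P j i) (insert (y j) G) = t (insert (y j) G) i"
            and free: "free_over (P j i) (insert (y j) G)" using not(3) ji(3) unfolding B3_def by auto
          have Pji: "P j i \<subseteq> X" "finite (P j i)" using PX ji by auto
          have exch: "D \<in> traces (P j i) (insert (y j) G)"
            if "D \<subseteq> G" "insert (y j) D \<in> traces (P j i) (insert (y j) G)" for D
            using that not(2) ji(3) unfolding B2_def tr patterns_def by blast
          have "traces (P' n) G = patterns t G (y j) i"
            unfolding P'n traces_insert[OF yj(1)[OF ji(2)]] patterns_def tr ..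
          then have "traces (P' n) G = t' G n" using not(1) ji(3) unfolding t'n B1_def by simp
          moreover note free_over_insert[OF Pji yj(1)[OF ji(2)] free exch]
          ultimately show False using n k Pji(2) by (simp add: P'n)
        qed
        then show "n \<in> prod_encode ` ?S" using ji(1) by blast
      qed
      have finS: "finite ?S" using finU I(1) fin(1) finB by (intro finite_UnI finite_SigmaI) auto
      have "card {n \<in> \<Omega>'. \<not> (card (P' n) = Suc k \<and> traces (P' n) G = t' G n \<and> free_over (P' n) G)} \<le> card ?S"
        using card_mono[OF _ bad] card_image_le[OF finS, of prod_encode] finS by simp
      also have "\<dots> \<le> card (U \<times> \<Omega>) + (card (SIGMA j : I - U. B1 j) +
          (card (SIGMA j : I. B2 j) + card (SIGMA j : I. B3 j)))"
        by (intro order_trans[OF card_Un_le] add_left_mono order_refl)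
      also have "\<dots> = card U * card \<Omega> + ((\<Sum>j \<in> I - U. card (B1 j)) + ((\<Sum>j \<in> I. card (B2 j)) + (\<Sum>j \<in> I. card (B3 j))))"
        using I(1) finB by (simp add: card_cartesian_product)
      finally have le: "card {n \<in> \<Omega>'. \<not> (card (P' n) = Suc k \<and> traces (P' n) G = t' G n \<and> free_over (P' n) G)} \<le>
        card U * card \<Omega> + ((\<Sum>j \<in> I - U. card (B1 j)) + ((\<Sum>j \<in> I. card (B2 j)) + (\<Sum>j \<in> I. card (B3 j))))" .
      have s0: "4 * m * (card U * card \<Omega>) \<le> card I * card \<Omega>"
        using mult_le_mono1[of "4 * m * card U" "card I" "card \<Omega>"] set G unfolding U_def by (simp add: ac_simps)
      have sum: "4 * m * (\<Sum>j \<in> A. card (B j)) \<le> card I * card \<Omega>"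
        if "A \<subseteq> I" "\<And>j. j \<in> A \<Longrightarrow> 4 * m * card (B j) \<le> card \<Omega>" for A and B :: "nat \<Rightarrow> nat set"
      proof -
        have "4 * m * (\<Sum>j \<in> A. card (B j)) \<le> (\<Sum>j \<in> A. card \<Omega>)"
          unfolding sum_distrib_left using that(2) by (intro sum_mono)
        also have "\<dots> \<le> card I * card \<Omega>" using card_mono[OF I(1) that(1)] by simp
        finally show ?thesis .
      qed
      have s1: "4 * m * (\<Sum>j \<in> I - U. card (B1 j)) \<le> card I * card \<Omega>" by (rule sum) (use c1 in auto)
      have s2: "4 * m * (\<Sum>j \<in> I. card (B2 j)) \<le> card I * card \<Omega>" by (rule sum) (use c2 in auto)
      have s3: "4 * m * (\<Sum>j \<in> I. card (B3 j)) \<le> card I * card \<Omega>" by (rule sum) (use c3 in auto)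
      have "4 * m * card {n \<in> \<Omega>'. \<not> (card (P' n) = Suc k \<and> traces (P' n) G = t' G n \<and> free_over (P' n) G)} \<le>
        4 * m * (card U * card \<Omega> + ((\<Sum>j \<in> I - U. card (B1 j)) + ((\<Sum>j \<in> I. card (B2 j)) + (\<Sum>j \<in> I. card (B3 j)))))"
        using le by (rule mult_le_mono2)
      also have "\<dots> \<le> 4 * (card I * card \<Omega>)"
        using s0 s1 s2 s3 unfolding distrib_left by linarith
      finally show ?thesis unfolding card\<Omega>' by simp
    qed
    ultimately show ?thesis by (intro exI[of _ P']) blast
  qed
  then have "sample (Suc k) K m \<Omega>' t'"
    unfolding sample_def using I fin unfolding \<Omega>'_def by simp
  then show ?thesis by blast
qed

text \<open>\<open>K\<close> and \<open>m\<close> are general in the induction, since a step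
  consumes one unit of size and a factor 8 of accuracy. The empty sample has a single index and is
  predicted without error.\<close>

lemma ex_sample: "m \<ge> 1 \<Longrightarrow> \<exists>\<Omega> t. sample k K m \<Omega> t"
proof (induction k arbitrary: K m)
  case 0
  have "sample 0 K m {0} (\<lambda>G _. traces {} G)"
    unfolding sample_def
  proof (intro conjI allI impI exI ballI)
    fix J G
    have "free_over {} G" unfolding free_over_def traces_def by blast
    then show "m * card {i \<in> {0 :: nat}. \<not> (card ({} :: 'x set) = 0 \<and> traces {} G = traces {} G \<and> free_over {} G)}
        \<le> card {0 :: nat}"
      by simp
  qed simp_all
  then show ?case by blast
next
  case (Suc k)
  then show ?case by (intro sample_Suc)
qed

theorem ex_shattered: "\<exists>A \<subseteq> X. finite A \<and> card A = n \<and> shattered A F"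
proof -
  \<comment> \<open>The only test set is the empty one, hence \<open>K = 0\<close>. Accuracy 2 makes
    at most half of the indices bad, so a good one remains.\<close>
  obtain \<Omega> t where samp: "sample n 0 2 \<Omega> t" using ex_sample[of 2 n 0] by auto
  have "{{}} \<subseteq> small_sets 0" unfolding small_sets_def by simp
  from sampleD[OF samp this] obtain P where P: "\<forall>i \<in> \<Omega>. P i \<subseteq> X \<and> finite (P i)"
    and good: "2 * card {i \<in> \<Omega>. \<not> (card (P i) = n \<and> traces (P i) {} = t {} i \<and> free_over (P i) {})} \<le> card \<Omega>"
    using finite_le[of "{{}} :: 'x set set"] by auto
  have fin: "finite \<Omega>" "\<Omega> \<noteq> {}" using samp unfolding sample_def by simp_all
  have "{i \<in> \<Omega>. \<not> (card (P i) = n \<and> traces (P i) {} = t {} i \<and> free_over (P i) {})} \<noteq> \<Omega>"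
    using good fin by (intro notI) (simp add: card_gt_0_iff)
  then obtain i where i: "i \<in> \<Omega>" "card (P i) = n" "free_over (P i) {}" by blast
  have Pi: "P i \<subseteq> X" "finite (P i)" using P i(1) by auto
  have "traces (P i) {} \<noteq> {}" using traces_nonempty[OF Pi] .
  then have "{} \<in> traces (P i) {}" unfolding traces_def by blast
  then have "shattered (P i) F" using i(3) unfolding free_over_def shattered_def by blast
  then show ?thesis using Pi i(2) by blast
qed

end

section \<open>Externally definable sets\<close>

lemma sat_Exists_list:
  "sat M v (foldr Exists is \<phi>) \<longleftrightarrow>
    (\<exists>w. (\<forall>i. i \<notin> set is \<longrightarrow> w i = v i) \<and> (\<forall>i \<in> set is. w i \<in> univ M) \<and> sat M w \<phi>)"
proof (induction "is" arbitrary: v)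
  case Nil
  have "w = v" if "\<forall>i. w i = v i" for w using that by auto
  then show ?case by auto
next
  case (Cons j js)
  show ?case
  proof
    assume "sat M v (foldr Exists (j # js) \<phi>)"
    then obtain a where a: "a \<in> univ M" "sat M (v(j := a)) (foldr Exists js \<phi>)" by auto
    then obtain w where "\<forall>i. i \<notin> set js \<longrightarrow> w i = (v(j := a)) i" "\<forall>i \<in> set js. w i \<in> univ M" "sat M w \<phi>"
      using Cons.IH[of "v(j := a)"] by blast
    then show "\<exists>w. (\<forall>i. i \<notin> set (j # js) \<longrightarrow> w i = v i) \<and> (\<forall>i \<in> set (j # js). w i \<in> univ M) \<and> sat M w \<phi>"
      using a(1) by (intro exI[of _ w]) (auto split: if_splits)
  next
    assume "\<exists>w. (\<forall>i. i \<notin> set (j # js) \<longrightarrow> w i = v i) \<and> (\<forall>i \<in> set (j # js). w i \<in> univ M) \<and> sat M w \<phi>"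
    then obtain w where w: "\<forall>i. i \<notin> set (j # js) \<longrightarrow> w i = v i" "\<forall>i \<in> set (j # js). w i \<in> univ M" "sat M w \<phi>"
      by blast
    have "sat M (v(j := w j)) (foldr Exists js \<phi>)"
      unfolding Cons.IH using w by (intro exI[of _ w]) auto
    then show "sat M v (foldr Exists (j # js) \<phi>)" using w(2) by auto
  qed
qed

lemma wf_Exists_list: "wf_fm L (foldr Exists is \<phi>) \<longleftrightarrow> wf_fm L \<phi>"
  by (induction "is") auto

lemma sat_Conj_list: "sat M v (foldr Conj \<Phi> (Neg Bot)) \<longleftrightarrow> (\<forall>\<phi> \<in> set \<Phi>. sat M v \<phi>)"
  by (induction \<Phi>) auto

lemma wf_Conj_list: "wf_fm L (foldr Conj \<Phi> (Neg Bot)) \<longleftrightarrow> (\<forall>\<phi> \<in> set \<Phi>. wf_fm L \<phi>)"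
  by (induction \<Phi>) auto

lemma sat_pattern_formula:
  assumes inj: "\<forall>j < n. inj (r j)"
  shows "sat M w (foldr Conj (map (\<lambda>j. if S j then ren_fm (r j) \<psi> else Neg (ren_fm (r j) \<psi>)) [0..<n]) (Neg Bot))
    \<longleftrightarrow> (\<forall>j < n. sat M (w \<circ> r j) \<psi> \<longleftrightarrow> S j)"
proof -
  have "sat M w (if S j then ren_fm (r j) \<psi> else Neg (ren_fm (r j) \<psi>)) \<longleftrightarrow> (sat M (w \<circ> r j) \<psi> \<longleftrightarrow> S j)"
    if "j < n" for j
    using sat_ren_fm[OF inj[rule_format, OF that]] by simp
  then show ?thesis unfolding sat_Conj_list set_map ball_simps set_upt by (simp add: Ball_def del: o_apply)
qed

text \<open>For finite \<open>A\<close>, the existence of a parameter inducing the trace of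
  \<open>X\<close> on \<open>A\<close> is a first-order condition on the elements of
  \<open>A\<close>. It holds in \<open>N\<close>, witnessed by \<open>c\<close>, and so in
  \<open>M\<close>. The formula is written out because \<open>expressible\<close> is tied to one
  carrier type, while \<open>N\<close> may live on another.\<close>

lemma locally_definable_if_externally_definable:
  fixes M :: "('f, 'r, 'a) struct"
  assumes M: "is_struct L M" and ext: "externally_definable TYPE('b) L M k X"
  shows "locally_definable L M k X"
proof -
  obtain N :: "('f, 'r, 'b) struct" and e \<psi> q c where N: "is_struct L N" "elementary_embedding L e M N"
    and c: "c \<in> tuples q (univ N)" and \<psi>: "wf_fm L \<psi>" "fv \<psi> \<subseteq> {..<k + q}"
    and X: "X = {a \<in> tuples k (univ M). sat N (nth (map e a @ c)) \<psi>}"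
    using ext unfolding externally_definable_def by blast
  let ?T = "tuples k (univ M)" and ?R = "\<lambda>(M :: ('f, 'r, 'a) struct) xs. sat M (nth xs) \<psi>"
  obtain a0 where a0: "a0 \<in> univ M" using M unfolding is_struct_def by blast
  have "\<exists>d \<in> tuples q (univ M). A \<inter> sect M ?R k d = A \<inter> X" if A: "A \<subseteq> ?T" "finite A" for A
  proof -
    obtain ss where ss: "set ss = A" using finite_list[OF A(2)] by blast
    let ?n = "length ss"
    have len: "length x = k" if "x \<in> set ss" for x using that ss A(1) by (auto simp: tuples_def)
    \<comment> \<open>The point variables go to the j-th block of length \<open>k\<close>, the
      parameter variables to one block behind all of these, shared by all \<open>j\<close>.\<close>
    define r where "r j i = (if i < k then j * k + i else ?n * k + (i - k))" for j i
    have lt: "j * k + i < ?n * k" if "j < ?n" "i < k" for i j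
    proof -
      have "Suc j * k \<le> ?n * k" using that(1) by (intro mult_le_mono1) simp
      then show ?thesis using that(2) by simp
    qed
    have inj: "\<forall>j < ?n. inj (r j)"
    proof (intro allI impI injI)
      fix j i i' assume j: "j < ?n" and eq: "r j i = r j i'"
      then show "i = i'"
        using lt[OF j, of i] lt[OF j, of i'] unfolding r_def by (cases "i < k"; cases "i' < k") simp_all
    qed
    define \<Phi> where "\<Phi> = map (\<lambda>j. if ss ! j \<in> X then ren_fm (r j) \<psi> else Neg (ren_fm (r j) \<psi>)) [0..<?n]"
    define \<chi> where "\<chi> = foldr Exists [?n * k..<?n * k + q] (foldr Conj \<Phi> (Neg Bot))"
    have wf: "wf_fm L \<chi>" unfolding \<chi>_def \<Phi>_def using \<psi>(1) by (auto simp: wf_Exists_list wf_Conj_list wf_ren_fm)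
    \<comment> \<open>Elementarity is stated for valuations into the universe, so the variables
      beyond the blocks receive the value \<open>a0\<close>.\<close>
    define v where "v i = (if i < ?n * k then concat ss ! i else a0)" for i
    have concat: "concat ss \<in> tuples (?n * k) (univ M)" using concat_tuples[of ss k "univ M"] A(1) ss by simp
    have "v i \<in> univ M" for i
      using concat a0 nth_mem[of i "concat ss"] unfolding v_def tuples_def by auto
    then have v: "range v \<subseteq> univ M" by blast
    note sat_\<Phi> = sat_pattern_formula[of ?n r _ _ "\<lambda>j. ss ! j \<in> X" \<psi>, OF inj, folded \<Phi>_def]
    have "sat N (e \<circ> v) \<chi>"
      unfolding \<chi>_def sat_Exists_list
    proof (intro exI conjI)
      let ?w = "\<lambda>i. if i < ?n * k then e (concat ss ! i) else if i < ?n * k + q then c ! (i - ?n * k) else e a0"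
      show "\<forall>i. i \<notin> set [?n * k..<?n * k + q] \<longrightarrow> ?w i = (e \<circ> v) i" by (auto simp: v_def)
      show "\<forall>i \<in> set [?n * k..<?n * k + q]. ?w i \<in> univ N"
        using c by (auto simp: tuples_def intro!: subsetD[OF _ nth_mem])
      have "sat N (?w \<circ> r j) \<psi> \<longleftrightarrow> ss ! j \<in> X" if j: "j < ?n" for j
      proof -
        have mem: "ss ! j \<in> ?T" using j A(1) ss by auto
        have eq: "(?w \<circ> r j) i = (map e (ss ! j) @ c) ! i" if "i < k + q" for i
          using that lt[OF j] nth_concat_const[OF len j] tuples_length[OF mem]
          by (auto simp: r_def nth_append)
        have "sat N (?w \<circ> r j) \<psi> \<longleftrightarrow> sat N (nth (map e (ss ! j) @ c)) \<psi>"
          by (rule sat_cong, rule eq) (use \<psi>(2) in auto)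
        then show ?thesis using mem X by simp
      qed
      then show "sat N ?w (foldr Conj \<Phi> (Neg Bot))"
        unfolding sat_\<Phi> by (intro allI impI)
    qed
    then have "sat M v \<chi>" using N(2) wf v unfolding elementary_embedding_def by blast
    then obtain w where w: "\<forall>i. i \<notin> set [?n * k..<?n * k + q] \<longrightarrow> w i = v i"
      "\<forall>i \<in> set [?n * k..<?n * k + q]. w i \<in> univ M" "sat M w (foldr Conj \<Phi> (Neg Bot))"
      unfolding \<chi>_def sat_Exists_list by blast
    define d where "d = map (\<lambda>l. w (?n * k + l)) [0..<q]"
    have d: "d \<in> tuples q (univ M)" using w(2) unfolding d_def tuples_def by auto
    have "sat M (nth (ss ! j @ d)) \<psi> \<longleftrightarrow> ss ! j \<in> X" if j: "j < ?n" for j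
    proof -
      have "length (ss ! j) = k" using len j by simp
      then have eq: "(w \<circ> r j) i = (ss ! j @ d) ! i" if "i < k + q" for i
        using that lt[OF j, of i] nth_concat_const[OF len j, of i] w(1)
        by (auto simp: r_def nth_append d_def v_def)
      have "sat M (w \<circ> r j) \<psi> \<longleftrightarrow> sat M (nth (ss ! j @ d)) \<psi>"
        by (rule sat_cong, rule eq) (use \<psi>(2) in auto)
      then show ?thesis using w(3)[unfolded sat_\<Phi>, rule_format, OF j] by simp
    qed
    then have "sat M (nth (a @ d)) \<psi> \<longleftrightarrow> a \<in> X" if "a \<in> A" for a
      using that ss by (metis in_set_conv_nth)
    then have "A \<inter> sect M ?R k d = A \<inter> X" using A(1) unfolding sect_def by blast
    then show ?thesis using d by blast
  qed
  moreover have "expressible L (k + q) ?R" using \<psi> by (rule expressible_fm)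
  moreover have "X \<subseteq> ?T" using X by blast
  ultimately show ?thesis unfolding locally_definable_def by (intro conjI exI[of _ q] exI[of _ ?R]) simp_all
qed

section \<open>Instances inside X and the set of their parameters\<close>

lemma definable_sect:
  fixes R :: "('f, 'r, 'a) struct \<Rightarrow> 'a list \<Rightarrow> bool"
  assumes M: "is_struct L M" and R: "expressible L (k + q) R" and d: "d \<in> tuples q (univ M)"
  shows "definable L M k (sect M R k d)"
proof -
  obtain \<phi> where \<phi>: "wf_fm L \<phi>" "fv \<phi> \<subseteq> {..<k + q}"
    and sat: "\<And>(M :: ('f, 'r, 'a) struct) xs.
      is_struct L M \<Longrightarrow> xs \<in> tuples (k + q) (univ M) \<Longrightarrow> sat M (nth xs) \<phi> \<longleftrightarrow> R M xs"
    using R unfolding expressible_def by blast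
  have "sect M R k d = {a \<in> tuples k (univ M). sat M (nth (a @ d)) \<phi>}"
    unfolding sect_def using sat[OF M tuples_append[OF _ d]] by blast
  then show ?thesis
    unfolding definable_def using \<phi> d by (intro exI[of _ \<phi>] exI[of _ q] bexI[of _ d]) simp_all
qed

lemma definable_tuples: "definable L M k (tuples k (univ M))"
  unfolding definable_def
  by (intro exI[of _ "Neg Bot"] exI[of _ 0] bexI[of _ "[]"]) (auto simp: tuples_def)

text \<open>
  The complement of \<open>{b. sect M R k b \<subseteq> X}\<close> is a projection of a locally definable set, hence of one
  that definable sets approximate from inside; projecting those shows that it is locally definable.
\<close>

lemma locally_definable_sect_subset:
  fixes M :: "('f, 'r, 'a) struct"
  assumes M: "is_struct L M" and NIP: "NIP TYPE('a) L (Th L M)" and X: "locally_definable L M k X"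
    and R: "expressible L (k + q) (R :: ('f, 'r, 'a) struct \<Rightarrow> _)"
  shows "locally_definable L M q {b \<in> tuples q (univ M). sect M R k b \<subseteq> X}" (is "locally_definable L M q ?Y")
proof -
  let ?U = "univ M"
  obtain q1 R1 where R1: "expressible L (k + q1) (R1 :: ('f, 'r, 'a) struct \<Rightarrow> _)"
    and loc: "\<forall>A \<subseteq> tuples k ?U. finite A \<longrightarrow> (\<exists>c \<in> tuples q1 ?U. A \<inter> sect M R1 k c = A \<inter> X)"
    using X unfolding locally_definable_def by blast
  define W where "W = {x @ b |x b. b \<in> tuples q ?U \<and> x \<in> sect M R k b \<and> x \<notin> X}"
  have W_iff: "x @ b \<in> W \<longleftrightarrow> x \<in> sect M R k b \<and> x \<notin> X" if "x \<in> tuples k ?U" "b \<in> tuples q ?U" for x b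
  proof
    assume "x @ b \<in> W"
    then obtain x' b' where *: "x @ b = x' @ b'" "x' \<in> sect M R k b'" "x' \<notin> X" unfolding W_def by blast
    have "length x = length x'" using * tuples_length[OF that(1)] tuples_length[of x' k ?U] unfolding sect_def by simp
    then show "x \<in> sect M R k b \<and> x \<notin> X" using * by simp
  next
    assume "x \<in> sect M R k b \<and> x \<notin> X"
    then show "x @ b \<in> W" unfolding W_def using that(2) by blast
  qed
  have "locally_definable L M (k + q) W"
  proof -
    define R' where "R' = (\<lambda>M xs. R M (take (k + q) xs) \<and> \<not> R1 M (take k xs @ take q1 (drop (k + q) xs)))"
    have "expressible L ((k + q) + q1) R'"
      unfolding R'_def
      using expressible_pair_left[OF R, of q1] expressible_pair_right[OF R1, of q]
      by (intro expressible_conj expressible_not) (simp_all add: add.assoc)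
    moreover have "\<exists>c \<in> tuples q1 ?U. A \<inter> sect M R' (k + q) c = A \<inter> W"
      if A: "A \<subseteq> tuples (k + q) ?U" "finite A" for A
    proof -
      have tk: "take k ` A \<subseteq> tuples k ?U" using A(1) by (auto simp: tuples_def dest: in_set_takeD)
      obtain c where c: "c \<in> tuples q1 ?U" "take k ` A \<inter> sect M R1 k c = take k ` A \<inter> X"
        using loc[rule_format, OF tk finite_imageI[OF A(2)]] by blast
      have "z \<in> sect M R' (k + q) c \<longleftrightarrow> z \<in> W" if z: "z \<in> A" for z
      proof -
        obtain x b where xb: "z = x @ b" "x \<in> tuples k ?U" "b \<in> tuples q ?U"
          using tuples_split z A(1) by blast
        have x: "take k z = x" using xb tuples_length[OF xb(2)] by simp
        then have "x \<in> sect M R1 k c \<longleftrightarrow> x \<in> X" using c(2) z by blast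
        then have 1: "R1 M (x @ c) \<longleftrightarrow> x \<in> X" using xb(2) unfolding sect_def by blast
        have "R' M (z @ c) \<longleftrightarrow> R M (x @ b) \<and> \<not> R1 M (x @ c)"
          unfolding R'_def xb(1) using tuples_length[OF xb(2)] tuples_length[OF xb(3)] tuples_length[OF c(1)] by simp
        then have "z \<in> sect M R' (k + q) c \<longleftrightarrow> R M (x @ b) \<and> x \<notin> X"
          using 1 z A(1) unfolding sect_def by blast
        also have "\<dots> \<longleftrightarrow> z \<in> W" unfolding xb(1) W_iff[OF xb(2,3)] using xb(2) by (simp add: sect_def)
        finally show ?thesis .
      qed
      then show ?thesis using c(1) by blast
    qed
    moreover have "W \<subseteq> tuples (k + q) ?U" unfolding W_def sect_def using tuples_append by blast
    ultimately show ?thesis unfolding locally_definable_def by (intro conjI exI[of _ q1] exI[of _ R']) simp_all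
  qed
  then have "inner_approximable L M (k + q) W W" by (rule honest_definition[OF M NIP])
  then obtain q2 R2 where R2: "expressible L ((k + q) + q2) (R2 :: ('f, 'r, 'a) struct \<Rightarrow> _)"
    and inner: "\<forall>A \<subseteq> W. finite A \<longrightarrow> (\<exists>d \<in> tuples q2 ?U. A \<subseteq> sect M R2 (k + q) d \<and> sect M R2 (k + q) d \<subseteq> W)"
    unfolding inner_approximable_def by blast
  define R3 where "R3 = (\<lambda>M xs. \<not> (\<exists>x \<in> tuples k (univ M).
    R2 M (take k (drop (q + q2) (xs @ x)) @ take (q + q2) (xs @ x))))"
  have "expressible L ((q + q2) + k) (\<lambda>M xs. R2 M (take k (drop (q + q2) xs) @ take (q + q2) xs))"
    using expressible_blocks[of L "[(q + q2, k), (0, q + q2)]" R2 "(q + q2) + k"] R2 by (simp add: ac_simps)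
  then have R3: "expressible L (q + q2) R3"
    unfolding R3_def by (intro expressible_not expressible_ex)
  have "\<exists>d \<in> tuples q2 ?U. A \<inter> sect M R3 q d = A \<inter> ?Y" if A: "A \<subseteq> tuples q ?U" "finite A" for A
  proof -
    \<comment> \<open>An instance of \<open>R2\<close> has to cover only one counterexample for each
      of the finitely many \<open>b\<close>; its inclusion in \<open>W\<close> prevents false
      ones.\<close>
    have "\<forall>b \<in> A - ?Y. \<exists>x. x \<in> tuples k ?U \<and> x @ b \<in> W"
    proof
      fix b assume "b \<in> A - ?Y"
      then have b: "b \<in> tuples q ?U" "\<not> sect M R k b \<subseteq> X" using A(1) by auto
      then obtain x where "x \<in> sect M R k b" "x \<notin> X" by blast
      moreover from this have "x \<in> tuples k ?U" by (simp add: sect_def)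
      ultimately show "\<exists>x. x \<in> tuples k ?U \<and> x @ b \<in> W" using W_iff b(1) by blast
    qed
    from bchoice[OF this] obtain f where f: "\<forall>b \<in> A - ?Y. f b \<in> tuples k ?U \<and> f b @ b \<in> W" ..
    have "(\<lambda>b. f b @ b) ` (A - ?Y) \<subseteq> W" "finite ((\<lambda>b. f b @ b) ` (A - ?Y))" using f A(2) by auto
    then obtain d where d: "d \<in> tuples q2 ?U" "(\<lambda>b. f b @ b) ` (A - ?Y) \<subseteq> sect M R2 (k + q) d"
      "sect M R2 (k + q) d \<subseteq> W"
      using inner[rule_format, of "(\<lambda>b. f b @ b) ` (A - ?Y)"] by blast
    have "b \<in> sect M R3 q d \<longleftrightarrow> b \<in> ?Y" if b: "b \<in> A" for b
    proof -
      have bq: "b \<in> tuples q ?U" using b A(1) by blast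
      have "R2 M (take k (drop (q + q2) ((b @ d) @ x)) @ take (q + q2) ((b @ d) @ x)) \<longleftrightarrow>
          x @ b \<in> sect M R2 (k + q) d" if "x \<in> tuples k ?U" for x
        using tuples_append[OF that bq] tuples_length[OF that] tuples_length[OF bq] tuples_length[OF d(1)]
        by (simp add: sect_def)
      then have R3_iff: "R3 M (b @ d) \<longleftrightarrow> \<not> (\<exists>x \<in> tuples k ?U. x @ b \<in> sect M R2 (k + q) d)"
        unfolding R3_def by (simp only: cong: bex_cong)
      have "(\<exists>x \<in> tuples k ?U. x @ b \<in> sect M R2 (k + q) d) \<longleftrightarrow> b \<notin> ?Y"
      proof
        assume "\<exists>x \<in> tuples k ?U. x @ b \<in> sect M R2 (k + q) d"
        then obtain x where "x \<in> tuples k ?U" "x @ b \<in> W" using d(3) by blast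
        then have "x \<in> sect M R k b" "x \<notin> X" using W_iff[OF _ bq] by blast+
        then show "b \<notin> ?Y" by blast
      next
        assume "b \<notin> ?Y"
        then have "f b @ b \<in> sect M R2 (k + q) d" "f b \<in> tuples k ?U" using d(2) f b by blast+
        then show "\<exists>x \<in> tuples k ?U. x @ b \<in> sect M R2 (k + q) d" by blast
      qed
      then show ?thesis using R3_iff bq unfolding sect_def[of M R3 q d] by blast
    qed
    then show ?thesis using d(1) by blast
  qed
  moreover have "?Y \<subseteq> tuples q ?U" by blast
  ultimately show ?thesis
    unfolding locally_definable_def using R3 by (intro conjI exI[of _ q2] exI[of _ R3]) simp_all
qed

section \<open>Tameness of the family of instances inside X\<close>

lemma shattered_mono: "F \<subseteq> F' \<Longrightarrow> shattered A F \<Longrightarrow> shattered A F'"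
  unfolding shattered_def by (meson subsetD)

lemma ex_list_of_length:
  assumes "finite S" "x \<in> S" "card S \<le> n"
  shows "\<exists>xs. length xs = n \<and> set xs = S"
proof -
  obtain ys where ys: "set ys = S" "distinct ys" using finite_distinct_list[OF assms(1)] by blast
  then have "length ys \<le> n" using assms(3) distinct_card[of ys] by simp
  then show ?thesis
    using ys assms(2) by (intro exI[of _ "ys @ replicate (n - length ys) x"]) auto
qed

text \<open>
  \<open>tame\<close> speaks of \<open>{y. \<exists>b \<in> Y. \<dots>}\<close> for the set \<open>Y\<close> of parameters \<open>b\<close> with \<open>sect M R k b \<subseteq> X\<close>, which is
  not definable. A shattered configuration involves only finitely many witnesses \<open>b\<close>, so \<open>Y\<close> can be
  replaced by a definable subset \<open>sect M R3 q e\<close>.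
\<close>

lemma separated_by_tame:
  fixes M :: "('f, 'r, 'a) struct"
  assumes M: "is_struct L M" and NIP: "NIP TYPE('a) L (Th L M)"
    and X: "X \<subseteq> tuples k (univ M)" "x0 \<in> X" and z0: "z0 \<in> tuples k (univ M)" "z0 \<notin> X"
    and R: "expressible L (k + q) (R :: ('f, 'r, 'a) struct \<Rightarrow> _)"
    and Y: "Y = {b \<in> tuples q (univ M). sect M R k b \<subseteq> X}"
    and inner: "inner_approximable L M q Y Y"
    and F: "F = {sect M R k b |b. b \<in> Y \<and> x0 \<in> sect M R k b}"
  shows "\<exists>d. \<forall>\<Theta>. finite \<Theta> \<longrightarrow> card \<Theta> = d \<longrightarrow>
      \<Theta> \<subseteq> {(P, Q). P \<subseteq> X \<and> Q \<subseteq> X \<and> finite P \<and> finite Q \<and> card P \<le> K \<and> card Q \<le> K} \<longrightarrow>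
      \<not> shattered \<Theta> {{\<theta>. y \<in> separated_by F \<theta>} |y. y \<in> X}"
proof -
  let ?U = "univ M"
  obtain q3 R3 where R3: "expressible L (q + q3) (R3 :: ('f, 'r, 'a) struct \<Rightarrow> _)"
    and approx: "\<forall>A \<subseteq> Y. finite A \<longrightarrow> (\<exists>e \<in> tuples q3 ?U. A \<subseteq> sect M R3 q e \<and> sect M R3 q e \<subseteq> Y)"
    using inner unfolding inner_approximable_def by blast
  \<comment> \<open>P and Q vary in size but a formula has fixed variables, so each is listed with
    repetitions as \<open>n\<close> tuples. The extra entry is a filler that also covers empty sets:
    \<open>x0\<close> lies in every member of \<open>F\<close> and \<open>z0\<close> in
    none.\<close>
  define n where "n = Suc K"
  define p where "p = q3 + (n * k + n * k)"
  \<comment> \<open>The blocks of \<open>zs\<close> are e, the list for P, the list for Q, the point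
    y and the parameter b. The first three form the shattered point, y is its parameter, and b is
    quantified in \<open>\<Psi>\<close>.\<close>
  define \<Phi> where "\<Phi> = (\<lambda>M zs.
    R3 M (take q (drop (p + k) zs) @ take q3 zs) \<and>
    R M (take k (drop p zs) @ take q (drop (p + k) zs)) \<and>
    (\<forall>j \<in> {..<n}. R M (take k (drop (q3 + j * k) zs) @ take q (drop (p + k) zs)) \<and>
      \<not> R M (take k (drop (q3 + n * k + j * k) zs) @ take q (drop (p + k) zs))))"
  define \<Psi> where "\<Psi> = (\<lambda>M xs. \<exists>b \<in> tuples q (univ M). \<Phi> M (xs @ b))"
  have jn: "j * k + k \<le> n * k" if "j < n" for j
  proof -
    have "Suc j * k \<le> n * k" using that by (intro mult_le_mono1) simp
    then show ?thesis by simp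
  qed
  have \<Phi>: "expressible L ((p + k) + q) \<Phi>"
    unfolding \<Phi>_def
  proof (intro expressible_conj expressible_ball expressible_not)
    show "expressible L (p + k + q) (\<lambda>M zs. R3 M (take q (drop (p + k) zs) @ take q3 zs))"
      using expressible_blocks[of L "[(p + k, q), (0, q3)]" R3 "p + k + q"] R3 by (simp add: p_def)
    show "expressible L (p + k + q) (\<lambda>M zs. R M (take k (drop p zs) @ take q (drop (p + k) zs)))"
      using expressible_blocks[of L "[(p, k), (p + k, q)]" R "p + k + q"] R by simp
    fix j assume "j \<in> {..<n}"
    then have j: "j * k + k \<le> n * k" using jn by simp
    show "expressible L (p + k + q) (\<lambda>M zs. R M (take k (drop (q3 + j * k) zs) @ take q (drop (p + k) zs)))"
      using expressible_blocks[of L "[(q3 + j * k, k), (p + k, q)]" R "p + k + q"] R j by (simp add: p_def)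
    show "expressible L (p + k + q) (\<lambda>M zs. R M (take k (drop (q3 + n * k + j * k) zs) @ take q (drop (p + k) zs)))"
      using expressible_blocks[of L "[(q3 + n * k + j * k, k), (p + k, q)]" R "p + k + q"] R j
      by (simp add: p_def)
  qed simp
  have \<Psi>: "expressible L (p + k) \<Psi>" unfolding \<Psi>_def using \<Phi> by (rule expressible_ex)
  obtain d where d: "\<forall>A \<subseteq> tuples p ?U. finite A \<longrightarrow> card A = d \<longrightarrow>
      \<not> shattered A {sect M \<Psi> p c |c. c \<in> tuples k ?U}"
    using NIP_expressible[OF M NIP \<Psi>] by blast
  have eval: "\<Psi> M ((e @ concat ps @ concat qs) @ y) \<longleftrightarrow> (\<exists>b \<in> sect M R3 q e. y \<in> sect M R k b \<and>
      set ps \<subseteq> sect M R k b \<and> set qs \<inter> sect M R k b = {})"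
    if e: "e \<in> tuples q3 ?U" and y: "y \<in> tuples k ?U" and ps: "length ps = n" "set ps \<subseteq> tuples k ?U"
      and qs: "length qs = n" "set qs \<subseteq> tuples k ?U" for e ps qs y
  proof -
    have len: "length e = q3" "length y = k" using e y by (simp_all add: tuples_length)
    have lps: "length (concat ps) = n * k" and lqs: "length (concat qs) = n * k"
      using tuples_length[OF concat_tuples[OF ps(2)]] tuples_length[OF concat_tuples[OF qs(2)]] ps(1) qs(1)
      by simp_all
    have tps: "take k (drop (j * k) (concat ps)) = ps ! j" and tqs: "take k (drop (j * k) (concat qs)) = qs ! j"
      if "j < n" for j
      using that ps qs by (auto intro!: take_drop_concat simp: tuples_length)
    have "\<Phi> M (((e @ concat ps @ concat qs) @ y) @ b) \<longleftrightarrow> b \<in> sect M R3 q e \<and> y \<in> sect M R k b \<and>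
        set ps \<subseteq> sect M R k b \<and> set qs \<inter> sect M R k b = {}" if b: "b \<in> tuples q ?U" for b
    proof -
      let ?zs = "((e @ concat ps @ concat qs) @ y) @ b"
      have lb: "length b = q" using b by (rule tuples_length)
      have 1: "take q (drop (p + k) ?zs) = b" "take q3 ?zs = e" "take k (drop p ?zs) = y"
        using len lps lqs lb by (simp_all add: p_def)
      have 2: "take k (drop (q3 + j * k) ?zs) = ps ! j" if "j < n" for j
        using jn[OF that] tps[OF that] len lps by simp
      have 3: "take k (drop (q3 + n * k + j * k) ?zs) = qs ! j" if "j < n" for j
        using jn[OF that] tqs[OF that] len lps lqs by (simp add: add.assoc)
      have "\<Phi> M ?zs \<longleftrightarrow> R3 M (b @ e) \<and> R M (y @ b) \<and> (\<forall>j \<in> {..<n}. R M (ps ! j @ b) \<and> \<not> R M (qs ! j @ b))"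
        unfolding \<Phi>_def 1 using 2 3 by simp
      also have "\<dots> \<longleftrightarrow> R3 M (b @ e) \<and> R M (y @ b) \<and> (\<forall>x \<in> set ps. R M (x @ b)) \<and> (\<forall>x \<in> set qs. \<not> R M (x @ b))"
        unfolding all_set_conv_all_nth ps(1) qs(1) by auto
      also have "\<dots> \<longleftrightarrow> b \<in> sect M R3 q e \<and> y \<in> sect M R k b \<and> set ps \<subseteq> sect M R k b \<and> set qs \<inter> sect M R k b = {}"
        using b y ps(2) qs(2) unfolding sect_def by blast
      finally show ?thesis .
    qed
    moreover have "sect M R3 q e \<subseteq> tuples q ?U" unfolding sect_def by blast
    ultimately show ?thesis unfolding \<Psi>_def by blast
  qed
  have "\<not> shattered \<Theta> {{\<theta>. y \<in> separated_by F \<theta>} |y. y \<in> X}"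
    if \<Theta>: "finite \<Theta>" "card \<Theta> = d"
      "\<Theta> \<subseteq> {(P, Q). P \<subseteq> X \<and> Q \<subseteq> X \<and> finite P \<and> finite Q \<and> card P \<le> K \<and> card Q \<le> K}" for \<Theta>
  proof
    assume sh: "shattered \<Theta> {{\<theta>. y \<in> separated_by F \<theta>} |y. y \<in> X}"
    have \<Theta>': "fst \<theta> \<subseteq> X" "snd \<theta> \<subseteq> X" "finite (fst \<theta>)" "finite (snd \<theta>)" "card (fst \<theta>) \<le> K" "card (snd \<theta>) \<le> K"
      if "\<theta> \<in> \<Theta>" for \<theta> using subsetD[OF \<Theta>(3) that] by (simp_all add: case_prod_beta)
    have "\<forall>S \<in> Pow \<Theta>. \<exists>y. y \<in> X \<and> {\<theta>. y \<in> separated_by F \<theta>} \<inter> \<Theta> = S"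
      using sh unfolding shattered_def by blast
    from bchoice[OF this] obtain y where y: "\<forall>S \<in> Pow \<Theta>. y S \<in> X \<and> {\<theta>. y S \<in> separated_by F \<theta>} \<inter> \<Theta> = S" ..
    \<comment> \<open>One witness is chosen for each positive pair; negative pairs stay negative
      because the approximating instance lies inside \<open>Y\<close>.\<close>
    define W where "W = {(S, \<theta>). S \<in> Pow \<Theta> \<and> \<theta> \<in> S}"
    have finW: "finite W"
      by (rule finite_subset[of _ "Pow \<Theta> \<times> \<Theta>"]) (use \<Theta>(1) in \<open>auto simp: W_def\<close>)
    have "\<forall>w \<in> W. \<exists>b. b \<in> Y \<and> x0 \<in> sect M R k b \<and> y (fst w) \<in> sect M R k b \<and>
        fst (snd w) \<subseteq> sect M R k b \<and> snd (snd w) \<inter> sect M R k b = {}"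
    proof
      fix w assume "w \<in> W"
      then have "fst w \<in> Pow \<Theta>" "snd w \<in> fst w" unfolding W_def by auto
      then have "y (fst w) \<in> separated_by F (snd w)" using y by blast
      then show "\<exists>b. b \<in> Y \<and> x0 \<in> sect M R k b \<and> y (fst w) \<in> sect M R k b \<and>
        fst (snd w) \<subseteq> sect M R k b \<and> snd (snd w) \<inter> sect M R k b = {}"
        unfolding separated_by_def F by blast
    qed
    from bchoice[OF this] obtain b where b: "\<forall>w \<in> W. b w \<in> Y \<and> x0 \<in> sect M R k (b w) \<and>
        y (fst w) \<in> sect M R k (b w) \<and> fst (snd w) \<subseteq> sect M R k (b w) \<and> snd (snd w) \<inter> sect M R k (b w) = {}" ..
    have "b ` W \<subseteq> Y" using b by blast
    then obtain e where e: "e \<in> tuples q3 ?U" "b ` W \<subseteq> sect M R3 q e" "sect M R3 q e \<subseteq> Y"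
      using approx[rule_format, OF _ finite_imageI[OF finW]] by blast
    have "\<forall>\<theta> \<in> \<Theta>. \<exists>ps. length ps = n \<and> set ps = insert x0 (fst \<theta>)"
      using \<Theta>' by (intro ballI ex_list_of_length[of _ x0]) (auto simp: n_def intro: order_trans[OF card_insert_le_m1])
    from bchoice[OF this] obtain ps where ps: "\<forall>\<theta> \<in> \<Theta>. length (ps \<theta>) = n \<and> set (ps \<theta>) = insert x0 (fst \<theta>)" ..
    have "\<forall>\<theta> \<in> \<Theta>. \<exists>qs. length qs = n \<and> set qs = insert z0 (snd \<theta>)"
      using \<Theta>' by (intro ballI ex_list_of_length[of _ z0]) (auto simp: n_def intro: order_trans[OF card_insert_le_m1])
    from bchoice[OF this] obtain qs where qs: "\<forall>\<theta> \<in> \<Theta>. length (qs \<theta>) = n \<and> set (qs \<theta>) = insert z0 (snd \<theta>)" ..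
    define \<pi> where "\<pi> \<theta> = e @ concat (ps \<theta>) @ concat (qs \<theta>)" for \<theta>
    have tup: "set (ps \<theta>) \<subseteq> tuples k ?U" "set (qs \<theta>) \<subseteq> tuples k ?U" if "\<theta> \<in> \<Theta>" for \<theta>
      using that ps qs \<Theta>'[OF that] X z0 by auto
    have \<pi>: "\<pi> \<theta> \<in> tuples p ?U" if "\<theta> \<in> \<Theta>" for \<theta>
    proof -
      have "concat (ps \<theta>) \<in> tuples (n * k) ?U" "concat (qs \<theta>) \<in> tuples (n * k) ?U"
        using concat_tuples[OF tup(1)[OF that]] concat_tuples[OF tup(2)[OF that]] ps qs that by simp_all
      then show ?thesis unfolding \<pi>_def p_def using e(1) by (intro tuples_append)
    qed
    have key: "\<Psi> M (\<pi> \<theta> @ y S) \<longleftrightarrow> \<theta> \<in> S" if S: "S \<in> Pow \<Theta>" and \<theta>: "\<theta> \<in> \<Theta>" for S \<theta>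
    proof -
      have yS: "y S \<in> X" "{\<theta>. y S \<in> separated_by F \<theta>} \<inter> \<Theta> = S" using y S by blast+
      have "y S \<in> tuples k ?U" using yS(1) X(1) by blast
      then have ev: "\<Psi> M (\<pi> \<theta> @ y S) \<longleftrightarrow> (\<exists>b \<in> sect M R3 q e. y S \<in> sect M R k b \<and>
          set (ps \<theta>) \<subseteq> sect M R k b \<and> set (qs \<theta>) \<inter> sect M R k b = {})"
        unfolding \<pi>_def using eval[OF e(1) _ _ tup(1)[OF \<theta>] _ tup(2)[OF \<theta>]] ps qs \<theta> by blast
      show ?thesis
      proof
        assume "\<Psi> M (\<pi> \<theta> @ y S)"
        then obtain c where c: "c \<in> sect M R3 q e" "y S \<in> sect M R k c"
          "set (ps \<theta>) \<subseteq> sect M R k c" "set (qs \<theta>) \<inter> sect M R k c = {}" using ev by blast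
        have ps\<theta>: "set (ps \<theta>) = insert x0 (fst \<theta>)" and qs\<theta>: "set (qs \<theta>) = insert z0 (snd \<theta>)"
          using ps qs \<theta> by blast+
        have "sect M R k c \<in> F" unfolding F using c(1,3) e(3) ps\<theta> by blast
        moreover have "fst \<theta> \<subseteq> sect M R k c" "snd \<theta> \<inter> sect M R k c = {}" using c(3,4) ps\<theta> qs\<theta> by blast+
        ultimately have "y S \<in> separated_by F \<theta>" unfolding separated_by_def using c(2) by blast
        then show "\<theta> \<in> S" using yS(2) \<theta> by blast
      next
        assume "\<theta> \<in> S"
        then have w: "(S, \<theta>) \<in> W" unfolding W_def using S by blast
        let ?b = "b (S, \<theta>)"
        have bS: "?b \<in> Y" "x0 \<in> sect M R k ?b" "y S \<in> sect M R k ?b" "fst \<theta> \<subseteq> sect M R k ?b"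
          "snd \<theta> \<inter> sect M R k ?b = {}" using bspec[OF b w] by simp_all
        have "z0 \<notin> sect M R k ?b" using bS(1) z0(2) unfolding Y by blast
        then have "set (qs \<theta>) \<inter> sect M R k ?b = {}" "set (ps \<theta>) \<subseteq> sect M R k ?b"
          using bS qs ps \<theta> by auto
        moreover have "?b \<in> sect M R3 q e" using e(2) w by blast
        ultimately show "\<Psi> M (\<pi> \<theta> @ y S)" unfolding ev using bS(3) by blast
      qed
    qed
    have "inj_on \<pi> \<Theta>"
    proof (rule inj_onI)
      fix \<theta> \<theta>' assume \<theta>: "\<theta> \<in> \<Theta>" "\<theta>' \<in> \<Theta>" and eq: "\<pi> \<theta> = \<pi> \<theta>'"
      then have single: "{\<theta>} \<in> Pow \<Theta>" by simp
      have "\<Psi> M (\<pi> \<theta> @ y {\<theta>})" using key[OF single \<theta>(1)] by simp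
      then show "\<theta> = \<theta>'" using key[OF single \<theta>(2)] unfolding eq by simp
    qed
    then have "card (\<pi> ` \<Theta>) = d" using \<Theta>(2) by (simp add: card_image)
    moreover have "shattered (\<pi> ` \<Theta>) {sect M \<Psi> p c |c. c \<in> tuples k ?U}"
      unfolding shattered_def
    proof (intro allI impI)
      fix S' assume S': "S' \<subseteq> \<pi> ` \<Theta>"
      define S where "S = {\<theta> \<in> \<Theta>. \<pi> \<theta> \<in> S'}"
      have S: "S \<in> Pow \<Theta>" unfolding S_def by blast
      then have "y S \<in> tuples k ?U" using y X(1) by blast
      moreover have "\<pi> \<theta> \<in> sect M \<Psi> p (y S) \<longleftrightarrow> \<pi> \<theta> \<in> S'" if "\<theta> \<in> \<Theta>" for \<theta>
        using key[OF S that] \<pi>[OF that] that unfolding sect_def S_def by simp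
      then have "sect M \<Psi> p (y S) \<inter> \<pi> ` \<Theta> = S'" using S' by blast
      ultimately show "\<exists>B \<in> {sect M \<Psi> p c |c. c \<in> tuples k ?U}. B \<inter> \<pi> ` \<Theta> = S'" by blast
    qed
    moreover have "\<pi> ` \<Theta> \<subseteq> tuples p ?U" using \<pi> by blast
    ultimately show False using d[rule_format, OF _ finite_imageI[OF \<Theta>(1)]] by blast
  qed
  then show ?thesis by blast
qed

theorem theorem5p1:
  fixes \<kappa> :: "'c rel"
    and L :: "('f, 'r) signature"
    and M :: "('f, 'r, 'a) struct"
    and k :: nat
    and X :: "'a list set"
  assumes "Cinfinite \<kappa>"
    and "is_struct L M"
    and "NIP TYPE('a) L (Th L M)"
    and "k \<ge> 1"
    and "externally_definable TYPE('b) L M k X"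
    and "cardSuc \<kappa> \<le>o |X|"
  shows "\<exists>D. D \<subseteq> X \<and> definable L M k D \<and> \<kappa> \<le>o |D|"
proof (rule ccontr)
  assume neg: "\<not> ?thesis"
  note M = assms(2) and NIP = assms(3)
  let ?T = "tuples k (univ M)"
  have Card: "Card_order \<kappa>" and wo: "Well_order \<kappa>"
    using assms(1) by (auto simp: card_order_on_well_order_on)
  have lt: "\<kappa> <o |X|" using cardSuc_greater[OF Card] assms(6) ordLess_ordLeq_trans by blast
  then have large: "\<not> |X| \<le>o \<kappa>" using not_ordLess_ordLeq by blast
  have small: "|D| <o \<kappa>" if "D \<subseteq> X" "definable L M k D" for D
    using neg that wo card_of_Well_order[of D] not_ordLeq_iff_ordLess by blast
  have X: "locally_definable L M k X"
    using M assms(5) by (rule locally_definable_if_externally_definable)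
  then have XT: "X \<subseteq> ?T" unfolding locally_definable_def by blast
  \<comment> \<open>The set of all tuples is definable, so \<open>X\<close> omits one of them; this
    supplies the filler \<open>z0\<close>.\<close>
  have "X \<noteq> ?T" using neg definable_tuples[of L M k] lt ordLess_imp_ordLeq by blast
  then obtain z0 where z0: "z0 \<in> ?T" "z0 \<notin> X" using XT by blast
  have "X \<noteq> {}"
  proof
    assume "X = {}"
    then have "|X| \<le>o \<kappa>" using card_of_empty1[of \<kappa>] wo by simp
    then show False using large by blast
  qed
  then obtain x0 where x0: "x0 \<in> X" by blast
  obtain q R where R: "expressible L (k + q) (R :: ('f, 'r, 'a) struct \<Rightarrow> _)"
    and approx: "\<forall>A \<subseteq> X. finite A \<longrightarrow> (\<exists>d \<in> tuples q (univ M). A \<subseteq> sect M R k d \<and> sect M R k d \<subseteq> X)"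
    using honest_definition[OF M NIP X] unfolding inner_approximable_def by blast
  define Y where "Y = {b \<in> tuples q (univ M). sect M R k b \<subseteq> X}"
  \<comment> \<open>The filler \<open>x0\<close> is demanded in every member; cofinality survives
    since a finite set can be covered together with \<open>x0\<close>.\<close>
  define F where "F = {sect M R k b |b. b \<in> Y \<and> x0 \<in> sect M R k b}"
  have "inner_approximable L M q Y Y"
    unfolding Y_def
    by (rule honest_definition[OF M NIP locally_definable_sect_subset[OF M NIP X R]])
  then interpret tame_cofinal_family \<kappa> X F
  proof (unfold_locales, goal_cases)
    case (3 B)
    then obtain b where "B = sect M R k b" "b \<in> tuples q (univ M)" "B \<subseteq> X" unfolding F_def Y_def by blast
    then show ?case using small definable_sect[OF M R] by blast
  next
    case (4 A)
    then have "insert x0 A \<subseteq> X" "finite (insert x0 A)" using x0 by simp_all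
    then obtain d where "d \<in> tuples q (univ M)" "insert x0 A \<subseteq> sect M R k d" "sect M R k d \<subseteq> X"
      using approx by blast
    then show ?case unfolding F_def Y_def by blast
  next
    case (5 K)
    then show ?case using separated_by_tame[OF M NIP XT x0 z0 R Y_def _ F_def] by blast
  qed (use assms(1) large in blast)+
  obtain n where n: "\<forall>A \<subseteq> ?T. finite A \<longrightarrow> card A = n \<longrightarrow>
      \<not> shattered A {sect M R k c |c. c \<in> tuples q (univ M)}"
    using NIP_expressible[OF M NIP R] by blast
  obtain A where A: "A \<subseteq> X" "finite A" "card A = n" "shattered A F" using ex_shattered by blast
  have "F \<subseteq> {sect M R k c |c. c \<in> tuples q (univ M)}" unfolding F_def Y_def by blast
  then have "shattered A {sect M R k c |c. c \<in> tuples q (univ M)}" using A(4) by (rule shattered_mono)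
  then show False using n[rule_format, OF order_trans[OF A(1) XT] A(2,3)] by simp
qed

end
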